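(* Let $\mathcal{A}$ be a dual Banach algebra such that there exists $\varphi\in\Delta_{wk^*}(\mathcal{A})$, and let $I$ be a totally ordered set with a smallest element. Then the dual Banach algebra $UP(I,\mathcal{A})$ of $I\times I$ upper triangular matrices over $\mathcal{A}$ is strong pseudo-Connes amenable if and only if $\mathcal{A}$ is strong pseudo-Connes amenable and $|I|=1$.
   Context: A Banach algebra $\mathcal{A}$ is a dual Banach algebra if there is a closed submodule $\mathcal{A}_*$ of the dual bimodule $\mathcal{A}^*$ with $\mathcal{A}=(\mathcal{A}_* )^*$; the $wk^*$-topology on $\mathcal{A}$ is $\sigma(\mathcal{A},\mathcal{A}_* )$. $\Delta_{wk^*}(\mathcal{A})$ denotes the set of all non-zero $wk^*$-continuous multiplicative linear functionals on $\mathcal{A}$. For a totally ordered set $I$, $UP(I,\mathcal{A})$ is the set of all matrices $[a_{i,j}]_{i,j\in I}$ with $a_{i,j}\in\mathcal{A}$, $a_{i,j}=0$ whenever $i>j$, and $\|[a_{i,j}]\|=\sum_{i,j\in I}\|a_{i,j}\|<\infty$, with the usual matrix operations. It is a dual Banach algebra, with predual the $c_0$-direct sum of copies of $\mathcal{A}_*$ indexed by the pairs $i\le j$, paired entrywise. For a dual Banach algebra $\mathcal{A}$ and a Banach $\mathcal{A}$-bimodule $E$, $\sigma wc(E)$ is the closed submodule of all $x\in E$ such that the maps $\mathcal{A}\to E$, $a\mapsto a\cdot x$ and $a\mapsto x\cdot a$, are $wk^*$-$wk$-continuous. The projective tensor product $\mathcal{A}\hat\otimes\mathcal{A}$ is an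 $\mathcal{A}$-bimodule via $a\cdot(b\otimes c)=ab\otimes c$, $(b\otimes c)\cdot a=b\otimes ca$; duals carry the dual module actions. Write $\sigma wc(\mathcal{A}\hat\otimes\mathcal{A})^*$ for $\sigma wc((\mathcal{A}\hat\otimes\mathcal{A})^* )$. Let $\pi:\mathcal{A}\hat\otimes\mathcal{A}\to\mathcal{A}$, $\pi(a\otimes b)=ab$. Then $\pi^*$ maps $\mathcal{A}_*$ into $\sigma wc(\mathcal{A}\hat\otimes\mathcal{A})^*$, and $\pi_{\sigma wc}:(\sigma wc(\mathcal{A}\hat\otimes\mathcal{A})^* )^*\to\mathcal{A}$ denotes the adjoint of $\pi^*|_{\mathcal{A}_*}$; it is an $\mathcal{A}$-bimodule morphism. $\mathcal{A}$ is strong pseudo-Connes amenable if there is a (not necessarily bounded) net $(m_\alpha)$ in $(\sigma wc(\mathcal{A}\hat\otimes\mathcal{A})^* )^*$ such that for every $a\in\mathcal{A}$: (i) $a\cdot m_\alpha-m_\alpha\cdot a\to0$ in the $wk^*$-topology of $(\sigma wc(\mathcal{A}\hat\otimes\mathcal{A})^* )^*$; (ii) $a\,\pi_{\sigma wc}(m_\alpha)=\pi_{\sigma wc}(m_\alpha)\,a$ for all $\alpha$, and $a\,\pi_{\sigma wc}(m_\alpha)\to a$ in the $wk^*$-topology of $\mathcal{A}$. *)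

theory Defs
  imports "HOL-Analysis.Analysis"
begin

section \<open>Complex normed spaces and Banach algebras\<close>

class scaleC =
  fixes scaleC :: "complex \<Rightarrow> 'a \<Rightarrow> 'a" (infixr "*\<^sub>C" 75)

class complex_vector = ab_group_add + scaleC +
  assumes scaleC_add_right: "c *\<^sub>C (x + y) = c *\<^sub>C x + c *\<^sub>C y"
    and scaleC_add_left: "(c + d) *\<^sub>C x = c *\<^sub>C x + d *\<^sub>C x"
    and scaleC_scaleC: "c *\<^sub>C d *\<^sub>C x = (c * d) *\<^sub>C x"
    and scaleC_one: "1 *\<^sub>C x = x"
begin

lemma scaleC_zero_left [simp]: "0 *\<^sub>C x = 0"
  using scaleC_add_left[of 0 0 x] by simp

lemma scaleC_zero_right [simp]: "c *\<^sub>C 0 = 0"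
  using scaleC_add_right[of c 0 0] by simp

lemma scaleC_minus_left: "(- c) *\<^sub>C x = - (c *\<^sub>C x)"
  using scaleC_add_left[of "- c" c x] by (simp add: eq_neg_iff_add_eq_0)

lemma scaleC_minus_right: "c *\<^sub>C (- x) = - (c *\<^sub>C x)"
  using scaleC_add_right[of c "- x" x] by (simp add: eq_neg_iff_add_eq_0)

lemma scaleC_diff_right: "c *\<^sub>C (x - y) = c *\<^sub>C x - c *\<^sub>C y"
  using scaleC_add_right[of c x "- y"] by (simp add: scaleC_minus_right)

lemma uminus_scaleC: "- x = (- 1) *\<^sub>C x"
  by (simp add: scaleC_minus_left scaleC_one)

end

class complex_normed_vector = complex_vector + real_normed_vector +
  assumes scaleR_scaleC: "r *\<^sub>R x = complex_of_real r *\<^sub>C x"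
    and norm_scaleC: "norm (c *\<^sub>C x) = cmod c * norm x"

class complex_banach_algebra = complex_normed_vector + real_normed_algebra + banach +
  assumes scaleC_mult_left: "(c *\<^sub>C x) * y = c *\<^sub>C (x * y)"
    and scaleC_mult_right: "x * (c *\<^sub>C y) = c *\<^sub>C (x * y)"

instantiation complex :: complex_banach_algebra
begin

definition scaleC_complex :: "complex \<Rightarrow> complex \<Rightarrow> complex"
  where "scaleC_complex c x = c * x"

instance
  by standard (auto simp: scaleC_complex_def algebra_simps scaleR_conv_of_real norm_mult)

end

definition bounded_clinear :: "('a::complex_normed_vector \<Rightarrow> 'b::complex_normed_vector) \<Rightarrow> bool"
  where "bounded_clinear f \<longleftrightarrow> bounded_linear f \<and> (\<forall>c x. f (c *\<^sub>C x) = c *\<^sub>C f x)"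

definition bounded_cbilinear ::
    "('a::complex_normed_vector \<Rightarrow> 'b::complex_normed_vector \<Rightarrow> 'c::complex_normed_vector) \<Rightarrow> bool"
  where "bounded_cbilinear B \<longleftrightarrow> bounded_bilinear B \<and>
    (\<forall>c x y. B (c *\<^sub>C x) y = c *\<^sub>C B x y \<and> B x (c *\<^sub>C y) = c *\<^sub>C B x y)"

lemma bounded_clinearD:
  assumes "bounded_clinear f"
  shows "bounded_linear f" "f (c *\<^sub>C x) = c *\<^sub>C f x"
  using assms by (auto simp: bounded_clinear_def)

lemma bounded_clinearI:
  assumes "\<And>x y. f (x + y) = f x + f y" "\<And>c x. f (c *\<^sub>C x) = c *\<^sub>C f x"
    "\<And>x. norm (f x) \<le> norm x * K"
  shows "bounded_clinear f"
  unfolding bounded_clinear_def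
  by (auto intro!: bounded_linear_intro[where K = K] simp: assms scaleR_scaleC)

definition csubspace :: "'a::complex_vector set \<Rightarrow> bool"
  where "csubspace S \<longleftrightarrow> 0 \<in> S \<and> (\<forall>x\<in>S. \<forall>y\<in>S. x + y \<in> S) \<and> (\<forall>c. \<forall>x\<in>S. c *\<^sub>C x \<in> S)"


section \<open>Dual spaces\<close>

typedef (overloaded) 'a cdual =
  "{f :: 'a::complex_normed_vector \<Rightarrow>\<^sub>L complex. \<forall>c x. blinfun_apply f (c *\<^sub>C x) = c * blinfun_apply f x}"
  by (rule exI[of _ 0]) auto

setup_lifting type_definition_cdual

lift_definition cdual_apply :: "'a::complex_normed_vector cdual \<Rightarrow> 'a \<Rightarrow> complex"
  is blinfun_apply .


instantiation cdual :: (complex_normed_vector) complex_normed_vector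
begin

lift_definition zero_cdual :: "'a cdual" is 0 by simp
lift_definition plus_cdual :: "'a cdual \<Rightarrow> 'a cdual \<Rightarrow> 'a cdual" is "(+)"
  by (simp add: blinfun.add_left distrib_left)
lift_definition minus_cdual :: "'a cdual \<Rightarrow> 'a cdual \<Rightarrow> 'a cdual" is "(-)"
  by (simp add: blinfun.diff_left right_diff_distrib)
lift_definition uminus_cdual :: "'a cdual \<Rightarrow> 'a cdual" is uminus
  by (simp add: blinfun.minus_left)
lift_definition scaleR_cdual :: "real \<Rightarrow> 'a cdual \<Rightarrow> 'a cdual" is scaleR
  by (simp add: blinfun.scaleR_left)
lift_definition norm_cdual :: "'a cdual \<Rightarrow> real" is norm .
lift_definition scaleC_cdual :: "complex \<Rightarrow> 'a cdual \<Rightarrow> 'a cdual"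
  is "\<lambda>c f. blinfun_mult_right c o\<^sub>L f"
  by (simp add: blinfun_mult_right.rep_eq)

definition dist_cdual :: "'a cdual \<Rightarrow> 'a cdual \<Rightarrow> real" where "dist_cdual f g = norm (f - g)"
definition sgn_cdual :: "'a cdual \<Rightarrow> 'a cdual" where "sgn_cdual f = inverse (norm f) *\<^sub>R f"
definition uniformity_cdual :: "('a cdual \<times> 'a cdual) filter"
  where "uniformity_cdual = (INF e\<in>{0<..}. principal {(x, y). dist x y < e})"
definition open_cdual :: "'a cdual set \<Rightarrow> bool"
  where "open_cdual U = (\<forall>x\<in>U. \<forall>\<^sub>F (x', y) in uniformity. x' = x \<longrightarrow> y \<in> U)"

lemma norm_blinfun_mult_right_compose:
  fixes f :: "'b::real_normed_vector \<Rightarrow>\<^sub>L complex"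
  shows "norm (blinfun_mult_right c o\<^sub>L f) = cmod c * norm f"
proof (cases "c = 0")
  case True
  then have "blinfun_mult_right c o\<^sub>L f = 0"
    by (intro blinfun_eqI) (simp add: blinfun_mult_right.rep_eq)
  then show ?thesis using True by simp
next
  case False
  have le: "norm (blinfun_mult_right d o\<^sub>L g) \<le> cmod d * norm g"
    for d and g :: "'b \<Rightarrow>\<^sub>L complex"
    by (rule norm_blinfun_bound)
       (auto simp: blinfun_mult_right.rep_eq norm_mult mult.assoc intro!: mult_left_mono norm_blinfun)
  let ?g = "blinfun_mult_right c o\<^sub>L f"
  have "f = blinfun_mult_right (1 / c) o\<^sub>L ?g"
    using False by (intro blinfun_eqI) (simp add: blinfun_mult_right.rep_eq)
  then have "norm f \<le> cmod (1 / c) * norm ?g" using le by metis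
  then have "cmod c * norm f \<le> norm ?g" using False by (simp add: norm_divide field_simps)
  with le[of c f] show ?thesis by simp
qed

instance
proof
  fix x y z :: "'a cdual" and a b :: real and c d :: complex
  show "x + y + z = x + (y + z)" by transfer simp
  show "x + y = y + x" by transfer simp
  show "0 + x = x" by transfer simp
  show "- x + x = 0" by transfer simp
  show "x - y = x + - y" by transfer simp
  show "a *\<^sub>R (x + y) = a *\<^sub>R x + a *\<^sub>R y" by transfer (simp add: scaleR_add_right)
  show "(a + b) *\<^sub>R x = a *\<^sub>R x + b *\<^sub>R x" by transfer (simp add: scaleR_add_left)
  show "a *\<^sub>R b *\<^sub>R x = (a * b) *\<^sub>R x" by transfer simp
  show "1 *\<^sub>R x = x" by transfer simp
  show "dist x y = norm (x - y)" by (simp add: dist_cdual_def)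
  show "sgn x = inverse (norm x) *\<^sub>R x" by (simp add: sgn_cdual_def)
  show "uniformity = (INF e\<in>{0<..}. principal {(x::'a cdual, y). dist x y < e})"
    by (simp add: uniformity_cdual_def)
  show "open U = (\<forall>x\<in>U. \<forall>\<^sub>F (x', y) in uniformity. x' = x \<longrightarrow> y \<in> U)" for U :: "'a cdual set"
    by (simp add: open_cdual_def)
  show "(norm x = 0) = (x = 0)" by transfer simp
  show "norm (x + y) \<le> norm x + norm y" by transfer (rule norm_triangle_ineq)
  show "norm (a *\<^sub>R x) = \<bar>a\<bar> * norm x" by transfer simp
  show "c *\<^sub>C (x + y) = c *\<^sub>C x + c *\<^sub>C y"
    by transfer (auto intro!: blinfun_eqI simp: blinfun_mult_right.rep_eq blinfun.add_left algebra_simps)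
  show "(c + d) *\<^sub>C x = c *\<^sub>C x + d *\<^sub>C x"
    by transfer (auto intro!: blinfun_eqI simp: blinfun_mult_right.rep_eq blinfun.add_left algebra_simps)
  show "c *\<^sub>C d *\<^sub>C x = (c * d) *\<^sub>C x"
    by transfer (auto intro!: blinfun_eqI simp: blinfun_mult_right.rep_eq)
  show "1 *\<^sub>C x = x"
    by transfer (auto intro!: blinfun_eqI simp: blinfun_mult_right.rep_eq)
  show "a *\<^sub>R x = complex_of_real a *\<^sub>C x"
    by transfer (auto intro!: blinfun_eqI simp: blinfun_mult_right.rep_eq blinfun.scaleR_left scaleR_conv_of_real)
  show "norm (c *\<^sub>C x) = cmod c * norm x"
    by transfer (rule norm_blinfun_mult_right_compose)
qed

end

lemma cdual_apply_bounded_clinear: "bounded_clinear (cdual_apply f)"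
  by transfer (auto simp: bounded_clinear_def scaleC_complex_def blinfun.bounded_linear_right)

lemma cdual_apply_simps [simp]:
  "cdual_apply 0 x = 0" "cdual_apply (f + g) x = cdual_apply f x + cdual_apply g x"
  "cdual_apply (f - g) x = cdual_apply f x - cdual_apply g x"
  "cdual_apply (- f) x = - cdual_apply f x" "cdual_apply (c *\<^sub>C f) x = c * cdual_apply f x"
  by (transfer; simp add: blinfun.add_left blinfun.diff_left blinfun.minus_left blinfun_mult_right.rep_eq)+

lemma cdual_eqI: "(\<And>x. cdual_apply f x = cdual_apply g x) \<Longrightarrow> f = g"
  by transfer (rule blinfun_eqI)

lemma norm_cdual_apply: "norm (cdual_apply f x) \<le> norm f * norm x"
  by transfer (rule norm_blinfun)

lemma norm_cdual_eq_onorm: "norm f = onorm (cdual_apply f)"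
  by transfer (rule norm_blinfun.rep_eq)

lemma ex_cdual:
  assumes "bounded_clinear f"
  shows "\<exists>g. \<forall>x. cdual_apply g x = f x"
proof -
  have f: "blinfun_apply (Blinfun f) = f"
    using assms by (simp add: bounded_clinear_def bounded_linear_Blinfun_apply)
  then have "Blinfun f \<in> {g. \<forall>c x. blinfun_apply g (c *\<^sub>C x) = c * blinfun_apply g x}"
    using assms by (simp add: bounded_clinear_def scaleC_complex_def)
  then have "cdual_apply (Abs_cdual (Blinfun f)) = f"
    by (simp add: cdual_apply.rep_eq Abs_cdual_inverse f)
  then show ?thesis by metis
qed

instance cdual :: (complex_normed_vector) banach
proof
  fix X :: "nat \<Rightarrow> 'a cdual"
  assume "Cauchy X"
  then have "Cauchy (\<lambda>n. Rep_cdual (X n))"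
    by (simp add: Cauchy_def dist_norm norm_cdual.rep_eq minus_cdual.rep_eq)
  then obtain f where f: "(\<lambda>n. Rep_cdual (X n)) \<longlonglongrightarrow> f"
    using Cauchy_convergent convergent_def by blast
  have "blinfun_apply f (c *\<^sub>C x) = c * blinfun_apply f x" for c x
  proof (rule LIMSEQ_unique)
    show "(\<lambda>n. blinfun_apply (Rep_cdual (X n)) (c *\<^sub>C x)) \<longlonglongrightarrow> blinfun_apply f (c *\<^sub>C x)"
      by (intro tendsto_intros f)
    have "(\<lambda>n. c * blinfun_apply (Rep_cdual (X n)) x) \<longlonglongrightarrow> c * blinfun_apply f x"
      by (intro tendsto_intros f)
    then show "(\<lambda>n. blinfun_apply (Rep_cdual (X n)) (c *\<^sub>C x)) \<longlonglongrightarrow> c * blinfun_apply f x"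
      by (subst Rep_cdual[simplified, rule_format])
  qed
  then have "Rep_cdual (Abs_cdual f) = f" by (simp add: Abs_cdual_inverse)
  with f have "X \<longlonglongrightarrow> Abs_cdual f"
    by (simp add: tendsto_iff dist_norm norm_cdual.rep_eq minus_cdual.rep_eq)
  then show "convergent X" by (rule convergentI)
qed


section \<open>Completion of a seminormed space\<close>

class complex_seminormed_vector = complex_vector +
  fixes seminorm :: "'a \<Rightarrow> real"
  assumes seminorm_triangle: "seminorm (x + y) \<le> seminorm x + seminorm y"
    and seminorm_scaleC: "seminorm (c *\<^sub>C x) = cmod c * seminorm x"
begin

lemma seminorm_zero [simp]: "seminorm 0 = 0"
  using seminorm_scaleC[of 0 0] by simp

lemma seminorm_minus: "seminorm (- x) = seminorm x"
  using seminorm_scaleC[of "- 1" x] by (simp add: scaleC_minus_left scaleC_one)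

lemma seminorm_nonneg: "seminorm x \<ge> 0"
  using seminorm_triangle[of x "- x"] by (simp add: seminorm_minus)

lemma seminorm_minus_commute: "seminorm (x - y) = seminorm (y - x)"
  using seminorm_minus[of "x - y"] by simp

lemma seminorm_diff_triangle: "seminorm (x - z) \<le> seminorm (x - y) + seminorm (y - z)"
  using seminorm_triangle[of "x - y" "y - z"] by (simp add: algebra_simps)

lemma seminorm_reverse: "\<bar>seminorm x - seminorm y\<bar> \<le> seminorm (x - y)"
  using seminorm_triangle[of "x - y" y] seminorm_triangle[of "y - x" x]
  by (simp add: seminorm_minus_commute abs_le_iff)

definition seminorm_Cauchy :: "(nat \<Rightarrow> 'a) \<Rightarrow> bool"
  where "seminorm_Cauchy X \<longleftrightarrow> (\<forall>e>0. \<exists>N. \<forall>m\<ge>N. \<forall>n\<ge>N. seminorm (X m - X n) < e)"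

definition seminorm_Cauchy_equiv :: "(nat \<Rightarrow> 'a) \<Rightarrow> (nat \<Rightarrow> 'a) \<Rightarrow> bool"
  where "seminorm_Cauchy_equiv X Y \<longleftrightarrow>
    seminorm_Cauchy X \<and> seminorm_Cauchy Y \<and> (\<lambda>n. seminorm (X n - Y n)) \<longlonglongrightarrow> 0"

lemma seminorm_Cauchy_const: "seminorm_Cauchy (\<lambda>_. x)"
  by (simp add: seminorm_Cauchy_def)

lemma seminorm_Cauchy_dominated:
  assumes "seminorm_Cauchy X" "seminorm_Cauchy Y"
    and "\<And>m n. seminorm (Z m - Z n) \<le> K * seminorm (X m - X n) + seminorm (Y m - Y n)" "K \<ge> 0"
  shows "seminorm_Cauchy Z"
  unfolding seminorm_Cauchy_def
proof (intro allI impI)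
  fix e :: real assume "e > 0"
  then have e: "e / 2 / (K + 1) > 0" "e / 2 > 0" using \<open>K \<ge> 0\<close> by auto
  obtain M where M: "\<And>m n. m \<ge> M \<Longrightarrow> n \<ge> M \<Longrightarrow> seminorm (X m - X n) < e / 2 / (K + 1)"
    using assms(1) e(1) unfolding seminorm_Cauchy_def by blast
  obtain N where N: "\<And>m n. m \<ge> N \<Longrightarrow> n \<ge> N \<Longrightarrow> seminorm (Y m - Y n) < e / 2"
    using assms(2) e(2) unfolding seminorm_Cauchy_def by blast
  show "\<exists>N. \<forall>m\<ge>N. \<forall>n\<ge>N. seminorm (Z m - Z n) < e"
  proof (intro exI[of _ "max M N"] allI impI)
    fix m n assume "m \<ge> max M N" "n \<ge> max M N"
    then have 1: "seminorm (X m - X n) < e / 2 / (K + 1)" and 2: "seminorm (Y m - Y n) < e / 2"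
      using M N by auto
    have "K * seminorm (X m - X n) \<le> (K + 1) * seminorm (X m - X n)"
      by (simp add: algebra_simps seminorm_nonneg)
    also have "\<dots> < e / 2" using 1 \<open>K \<ge> 0\<close> by (simp add: field_simps)
    finally show "seminorm (Z m - Z n) < e" using assms(3)[of m n] 2 by linarith
  qed
qed

lemma seminorm_Cauchy_add:
  assumes "seminorm_Cauchy X" "seminorm_Cauchy Y"
  shows "seminorm_Cauchy (\<lambda>n. X n + Y n)"
proof (rule seminorm_Cauchy_dominated[OF assms, where K = 1])
  show "seminorm ((X m + Y m) - (X n + Y n)) \<le> 1 * seminorm (X m - X n) + seminorm (Y m - Y n)" for m n
    using seminorm_triangle[of "X m - X n" "Y m - Y n"] by (simp add: algebra_simps)
qed simp

lemma seminorm_Cauchy_scaleC: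
  assumes "seminorm_Cauchy X"
  shows "seminorm_Cauchy (\<lambda>n. c *\<^sub>C X n)"
  by (rule seminorm_Cauchy_dominated[OF assms seminorm_Cauchy_const[of 0], where K = "cmod c"])
     (simp_all flip: scaleC_diff_right add: seminorm_scaleC)

lemma seminorm_Cauchy_norm: "seminorm_Cauchy X \<Longrightarrow> convergent (\<lambda>n. seminorm (X n))"
proof (rule real_Cauchy_convergent)
  assume X: "seminorm_Cauchy X"
  show "Cauchy (\<lambda>n. seminorm (X n))"
    unfolding Cauchy_def dist_real_def
    using X seminorm_reverse unfolding seminorm_Cauchy_def by (meson le_less_trans)
qed

lemma seminorm_Cauchy_equiv_add:
  assumes "seminorm_Cauchy_equiv X X'" "seminorm_Cauchy_equiv Y Y'"
  shows "seminorm_Cauchy_equiv (\<lambda>n. X n + Y n) (\<lambda>n. X' n + Y' n)"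
proof -
  have "(\<lambda>n. seminorm (X n + Y n - (X' n + Y' n))) \<longlonglongrightarrow> 0"
  proof (rule tendsto_sandwich[OF _ _ tendsto_const])
    show "(\<lambda>n. seminorm (X n - X' n) + seminorm (Y n - Y' n)) \<longlonglongrightarrow> 0"
      using assms unfolding seminorm_Cauchy_equiv_def by (auto intro: tendsto_add_zero)
    show "\<forall>\<^sub>F n in sequentially. seminorm (X n + Y n - (X' n + Y' n)) \<le> seminorm (X n - X' n) + seminorm (Y n - Y' n)"
      using seminorm_triangle[of "X n - X' n" "Y n - Y' n" for n] by (intro always_eventually) (simp add: algebra_simps)
  qed (simp add: seminorm_nonneg)
  with assms show ?thesis
    unfolding seminorm_Cauchy_equiv_def by (blast intro: seminorm_Cauchy_add)
qed

lemma seminorm_Cauchy_equiv_scaleC: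
  assumes "seminorm_Cauchy_equiv X Y"
  shows "seminorm_Cauchy_equiv (\<lambda>n. c *\<^sub>C X n) (\<lambda>n. c *\<^sub>C Y n)"
  using assms unfolding seminorm_Cauchy_equiv_def
  by (auto intro: seminorm_Cauchy_scaleC tendsto_mult_right_zero simp flip: scaleC_diff_right simp: seminorm_scaleC)

lemma seminorm_Cauchy_equiv_sym: "seminorm_Cauchy_equiv X Y \<Longrightarrow> seminorm_Cauchy_equiv Y X"
  by (simp add: seminorm_Cauchy_equiv_def seminorm_minus_commute)

lemma seminorm_Cauchy_equiv_trans:
  assumes "seminorm_Cauchy_equiv X Y" "seminorm_Cauchy_equiv Y Z"
  shows "seminorm_Cauchy_equiv X Z"
proof -
  have "(\<lambda>n. seminorm (X n - Z n)) \<longlonglongrightarrow> 0"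
  proof (rule tendsto_sandwich[OF _ _ tendsto_const])
    show "(\<lambda>n. seminorm (X n - Y n) + seminorm (Y n - Z n)) \<longlonglongrightarrow> 0"
      using assms unfolding seminorm_Cauchy_equiv_def by (auto intro: tendsto_add_zero)
  qed (simp_all add: seminorm_nonneg seminorm_diff_triangle)
  with assms show ?thesis unfolding seminorm_Cauchy_equiv_def by blast
qed

lemma seminorm_Cauchy_equiv_norm:
  assumes "seminorm_Cauchy_equiv X Y"
  shows "lim (\<lambda>n. seminorm (X n)) = lim (\<lambda>n. seminorm (Y n))"
proof -
  have "(\<lambda>n. seminorm (X n) - seminorm (Y n)) \<longlonglongrightarrow> 0"
    by (rule Lim_null_comparison[of _ "\<lambda>n. seminorm (X n - Y n)"])
       (use assms in \<open>auto simp: seminorm_Cauchy_equiv_def seminorm_reverse\<close>)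
  moreover have "(\<lambda>n. seminorm (X n) - seminorm (Y n)) \<longlonglongrightarrow>
      lim (\<lambda>n. seminorm (X n)) - lim (\<lambda>n. seminorm (Y n))"
    using assms by (intro tendsto_diff)
      (auto simp: seminorm_Cauchy_equiv_def convergent_LIMSEQ_iff[symmetric] intro: seminorm_Cauchy_norm)
  ultimately show ?thesis using LIMSEQ_unique by fastforce
qed

end

quotient_type (overloaded) 'v completion =
  "nat \<Rightarrow> 'v::complex_seminormed_vector" / partial: seminorm_Cauchy_equiv
proof (rule part_equivpI)
  show "\<exists>X :: nat \<Rightarrow> 'v. seminorm_Cauchy_equiv X X"
    by (rule exI[of _ "\<lambda>_. 0"]) (simp add: seminorm_Cauchy_equiv_def seminorm_Cauchy_const)
  show "symp (seminorm_Cauchy_equiv :: (nat \<Rightarrow> 'v) \<Rightarrow> _)"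
    by (rule sympI) (rule seminorm_Cauchy_equiv_sym)
  show "transp (seminorm_Cauchy_equiv :: (nat \<Rightarrow> 'v) \<Rightarrow> _)"
    by (rule transpI) (rule seminorm_Cauchy_equiv_trans)
qed

lift_definition of_seminormed :: "'v::complex_seminormed_vector \<Rightarrow> 'v completion"
  is "\<lambda>x _. x"
  by (simp add: seminorm_Cauchy_equiv_def seminorm_Cauchy_const)

instantiation completion :: (complex_seminormed_vector) complex_normed_vector
begin

lift_definition zero_completion :: "'a completion" is "\<lambda>_. 0"
  by (simp add: seminorm_Cauchy_equiv_def seminorm_Cauchy_const)
lift_definition plus_completion :: "'a completion \<Rightarrow> 'a completion \<Rightarrow> 'a completion"
  is "\<lambda>X Y n. X n + Y n"
  by (rule seminorm_Cauchy_equiv_add)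
lift_definition scaleC_completion :: "complex \<Rightarrow> 'a completion \<Rightarrow> 'a completion"
  is "\<lambda>c X n. c *\<^sub>C X n"
  by (rule seminorm_Cauchy_equiv_scaleC)
lift_definition uminus_completion :: "'a completion \<Rightarrow> 'a completion" is "\<lambda>X n. - X n"
  by (subst (1 2) uminus_scaleC) (rule seminorm_Cauchy_equiv_scaleC)
lift_definition minus_completion :: "'a completion \<Rightarrow> 'a completion \<Rightarrow> 'a completion"
  is "\<lambda>X Y n. X n - Y n"
  by (subst (1 2) diff_conv_add_uminus, subst (1 2) uminus_scaleC)
     (intro seminorm_Cauchy_equiv_add seminorm_Cauchy_equiv_scaleC)
lift_definition norm_completion :: "'a completion \<Rightarrow> real" is "\<lambda>X. lim (\<lambda>n. seminorm (X n))"
  by (rule seminorm_Cauchy_equiv_norm)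

definition scaleR_completion :: "real \<Rightarrow> 'a completion \<Rightarrow> 'a completion"
  where "scaleR_completion r x = complex_of_real r *\<^sub>C x"
definition dist_completion :: "'a completion \<Rightarrow> 'a completion \<Rightarrow> real"
  where "dist_completion x y = norm (x - y)"
definition sgn_completion :: "'a completion \<Rightarrow> 'a completion"
  where "sgn_completion x = inverse (norm x) *\<^sub>R x"
definition uniformity_completion :: "('a completion \<times> 'a completion) filter"
  where "uniformity_completion = (INF e\<in>{0<..}. principal {(x, y). dist x y < e})"
definition open_completion :: "'a completion set \<Rightarrow> bool"
  where "open_completion U = (\<forall>x\<in>U. \<forall>\<^sub>F (x', y) in uniformity. x' = x \<longrightarrow> y \<in> U)"

instance
proof
  fix x y z :: "'a completion" and a b :: real and c d :: complex
  have refl_if: "seminorm_Cauchy_equiv X Y" if "seminorm_Cauchy_equiv X X" "\<And>n. X n = Y n"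
    for X Y :: "nat \<Rightarrow> 'a"
    using that by (metis ext)
  note [simp] = seminorm_Cauchy_equiv_add seminorm_Cauchy_equiv_scaleC
  show add_assoc: "x + y + z = x + (y + z)"
    by transfer (rule refl_if, auto simp: add.assoc)
  show "x + y = y + x" by transfer (rule refl_if, auto simp: add.commute)
  show "0 + x = x" by transfer simp
  show "- x + x = 0"
    by transfer (auto simp: seminorm_Cauchy_equiv_def seminorm_Cauchy_const)
  show "x - y = x + - y"
  proof transfer
    fix X Y :: "nat \<Rightarrow> 'a"
    assume "seminorm_Cauchy_equiv X X" "seminorm_Cauchy_equiv Y Y"
    then have "seminorm_Cauchy_equiv (\<lambda>n. X n + (- 1) *\<^sub>C Y n) (\<lambda>n. X n + (- 1) *\<^sub>C Y n)"
      by simp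
    then show "seminorm_Cauchy_equiv (\<lambda>n. X n - Y n) (\<lambda>n. X n + - Y n)"
      by (simp add: scaleC_minus_left scaleC_one)
  qed
  show C1: "c *\<^sub>C (x + y) = c *\<^sub>C x + c *\<^sub>C y" for c :: complex and x y :: "'a completion"
    by transfer (rule refl_if, auto simp: scaleC_add_right)
  show C2: "(c + d) *\<^sub>C x = c *\<^sub>C x + d *\<^sub>C x" for c d :: complex and x :: "'a completion"
    by transfer (rule refl_if, auto simp flip: scaleC_add_left)
  show C3: "c *\<^sub>C d *\<^sub>C x = (c * d) *\<^sub>C x" for c d :: complex and x :: "'a completion"
    by transfer (rule refl_if, auto simp: scaleC_scaleC)
  show C4: "1 *\<^sub>C x = x" for x :: "'a completion"
    by transfer (simp add: scaleC_one)
  show "a *\<^sub>R x = complex_of_real a *\<^sub>C x" by (simp add: scaleR_completion_def)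
  show "a *\<^sub>R (x + y) = a *\<^sub>R x + a *\<^sub>R y" by (simp add: scaleR_completion_def C1)
  show "(a + b) *\<^sub>R x = a *\<^sub>R x + b *\<^sub>R x" by (simp add: scaleR_completion_def C2)
  show "a *\<^sub>R b *\<^sub>R x = (a * b) *\<^sub>R x" by (simp add: scaleR_completion_def C3)
  show "1 *\<^sub>R x = x" by (simp add: scaleR_completion_def C4)
  show "dist x y = norm (x - y)" by (simp add: dist_completion_def)
  show "sgn x = inverse (norm x) *\<^sub>R x" by (simp add: sgn_completion_def)
  show "uniformity = (INF e\<in>{0<..}. principal {(x::'a completion, y). dist x y < e})"
    by (simp add: uniformity_completion_def)
  show "open U = (\<forall>x\<in>U. \<forall>\<^sub>F (x', y) in uniformity. x' = x \<longrightarrow> y \<in> U)" for U :: "'a completion set"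
    by (simp add: open_completion_def)
  have L: "(\<lambda>n. seminorm (X n)) \<longlonglongrightarrow> lim (\<lambda>n. seminorm (X n))"
    if "seminorm_Cauchy_equiv X X" for X :: "nat \<Rightarrow> 'a"
    using that seminorm_Cauchy_norm by (auto simp: seminorm_Cauchy_equiv_def convergent_LIMSEQ_iff)
  show "(norm x = 0) = (x = 0)"
  proof transfer
    fix X :: "nat \<Rightarrow> 'a" assume X: "seminorm_Cauchy_equiv X X"
    show "(lim (\<lambda>n. seminorm (X n)) = 0) = seminorm_Cauchy_equiv X (\<lambda>_. 0)"
      using L[OF X] X by (auto simp: seminorm_Cauchy_equiv_def seminorm_Cauchy_const dest: limI)
  qed
  show "norm (x + y) \<le> norm x + norm y"
  proof transfer
    fix X Y :: "nat \<Rightarrow> 'a" assume X: "seminorm_Cauchy_equiv X X" and Y: "seminorm_Cauchy_equiv Y Y"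
    show "lim (\<lambda>n. seminorm (X n + Y n)) \<le> lim (\<lambda>n. seminorm (X n)) + lim (\<lambda>n. seminorm (Y n))"
      by (rule LIMSEQ_le[OF L[OF seminorm_Cauchy_equiv_add[OF X Y]] tendsto_add[OF L[OF X] L[OF Y]]])
         (auto simp: seminorm_triangle)
  qed
  show N: "norm (c *\<^sub>C x) = cmod c * norm x" for c :: complex and x :: "'a completion"
  proof transfer
    fix c and X :: "nat \<Rightarrow> 'a" assume X: "seminorm_Cauchy_equiv X X"
    show "lim (\<lambda>n. seminorm (c *\<^sub>C X n)) = cmod c * lim (\<lambda>n. seminorm (X n))"
      unfolding seminorm_scaleC by (rule limI) (intro tendsto_intros L X)
  qed
  show "norm (a *\<^sub>R x) = \<bar>a\<bar> * norm x" by (simp add: scaleR_completion_def N)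
qed

end

lemma of_seminormed_add: "of_seminormed (x + y) = of_seminormed x + of_seminormed y"
  by transfer (simp add: seminorm_Cauchy_equiv_def seminorm_Cauchy_const)

lemma of_seminormed_scaleC: "of_seminormed (c *\<^sub>C x) = c *\<^sub>C of_seminormed x"
  by transfer (simp add: seminorm_Cauchy_equiv_def seminorm_Cauchy_const)

lemma of_seminormed_diff: "of_seminormed (x - y) = of_seminormed x - of_seminormed y"
  by transfer (simp add: seminorm_Cauchy_equiv_def seminorm_Cauchy_const)

lemma norm_of_seminormed: "norm (of_seminormed x) = seminorm x"
  by transfer simp

lemma of_seminormed_tendsto:
  assumes C: "seminorm_Cauchy X"
  shows "(\<lambda>n. of_seminormed (X n)) \<longlonglongrightarrow> abs_completion X"
proof (rule LIMSEQ_I)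
  have X: "seminorm_Cauchy_equiv X X" using C by (simp add: seminorm_Cauchy_equiv_def)
  fix e :: real assume "e > 0"
  then have "e / 2 > 0" by simp
  then obtain N where N: "\<And>m n. m \<ge> N \<Longrightarrow> n \<ge> N \<Longrightarrow> seminorm (X m - X n) < e / 2"
    using C unfolding seminorm_Cauchy_def by blast
  have "norm (of_seminormed (X n) - abs_completion X) < e" if "n \<ge> N" for n
  proof -
    have eq: "seminorm_Cauchy_equiv (\<lambda>k. X n - X k) (\<lambda>k. X n - X k)"
      using seminorm_Cauchy_equiv_add[OF _ seminorm_Cauchy_equiv_scaleC[OF X, of "- 1"],
          of "\<lambda>_. X n" "\<lambda>_. X n"]
      by (simp add: seminorm_Cauchy_equiv_def seminorm_Cauchy_const scaleC_minus_left scaleC_one)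
    have "of_seminormed (X n) - abs_completion X = abs_completion (\<lambda>k. X n - X k)"
      unfolding of_seminormed.abs_eq
      by (subst minus_completion.abs_eq)
         (use X in \<open>auto simp: seminorm_Cauchy_equiv_def seminorm_Cauchy_const\<close>)
    then have "norm (of_seminormed (X n) - abs_completion X) = lim (\<lambda>k. seminorm (X n - X k))"
      using norm_completion.abs_eq[OF eq] by simp
    moreover have "lim (\<lambda>k. seminorm (X n - X k)) \<le> e / 2"
    proof (rule LIMSEQ_le_const2)
      show "(\<lambda>k. seminorm (X n - X k)) \<longlonglongrightarrow> lim (\<lambda>k. seminorm (X n - X k))"
        using eq seminorm_Cauchy_norm by (auto simp: seminorm_Cauchy_equiv_def convergent_LIMSEQ_iff)
      show "\<exists>N. \<forall>k\<ge>N. seminorm (X n - X k) \<le> e / 2"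
        using N[OF that] by (intro exI[of _ N]) (auto intro: less_imp_le)
    qed
    ultimately show ?thesis using \<open>e > 0\<close> by simp
  qed
  then show "\<exists>no. \<forall>n\<ge>no. norm (of_seminormed (X n) - abs_completion X) < e" by blast
qed

lemma completion_approx:
  obtains X where "seminorm_Cauchy X" "(\<lambda>n. of_seminormed (X n)) \<longlonglongrightarrow> x"
proof -
  obtain X where X: "seminorm_Cauchy_equiv X X" "x = abs_completion X"
    by (metis Quotient3_abs_rep Quotient3_completion Quotient3_rep_reflp)
  with of_seminormed_tendsto that show ?thesis by (auto simp: seminorm_Cauchy_equiv_def)
qed

instance completion :: (complex_seminormed_vector) banach
proof
  fix x :: "nat \<Rightarrow> 'a completion"
  assume x: "Cauchy x"
  have "\<exists>u. norm (of_seminormed u - x n) < 1 / Suc n" for n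
  proof -
    obtain X where "(\<lambda>k. of_seminormed (X k)) \<longlonglongrightarrow> x n" by (rule completion_approx)
    then have "\<exists>k. norm (of_seminormed (X k) - x n) < 1 / Suc n"
      by (meson LIMSEQ_D order_refl zero_less_divide_1_iff of_nat_0_less_iff zero_less_Suc)
    then show ?thesis by blast
  qed
  then obtain U where U: "\<And>n. norm (of_seminormed (U n) - x n) < 1 / Suc n" by metis
  have lim0: "(\<lambda>n. of_seminormed (U n) - x n) \<longlonglongrightarrow> 0"
    by (rule Lim_null_comparison[OF _ LIMSEQ_inverse_real_of_nat])
       (use U in \<open>auto simp: inverse_eq_divide intro!: always_eventually less_imp_le\<close>)
  have "Cauchy (\<lambda>n. of_seminormed (U n))"
    unfolding Cauchy_def
  proof (intro allI impI)
    fix e :: real assume "e > 0"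
    then have e: "e / 3 > 0" by simp
    obtain M where M: "\<And>m n. m \<ge> M \<Longrightarrow> n \<ge> M \<Longrightarrow> dist (x m) (x n) < e / 3"
      using x e unfolding Cauchy_def by blast
    obtain N where N: "\<And>n. n \<ge> N \<Longrightarrow> dist (of_seminormed (U n)) (x n) < e / 3"
      using LIMSEQ_D[OF lim0 e] by (auto simp: dist_norm)
    show "\<exists>N. \<forall>m\<ge>N. \<forall>n\<ge>N. dist (of_seminormed (U m)) (of_seminormed (U n)) < e"
    proof (intro exI[of _ "max M N"] allI impI)
      fix m n assume mn: "m \<ge> max M N" "n \<ge> max M N"
      show "dist (of_seminormed (U m)) (of_seminormed (U n)) < e"
        by (rule dist_triangle_third[of _ "x m" _ "x n"])
           (use mn M[of m n] N[of m] N[of n] in \<open>auto simp: dist_commute\<close>)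
    qed
  qed
  then have C: "seminorm_Cauchy U"
    unfolding seminorm_Cauchy_def Cauchy_def dist_norm of_seminormed_diff[symmetric] norm_of_seminormed
    by blast
  then have "(\<lambda>n. of_seminormed (U n)) \<longlonglongrightarrow> abs_completion U"
    by (rule of_seminormed_tendsto)
  then have "(\<lambda>n. of_seminormed (U n) - (of_seminormed (U n) - x n)) \<longlonglongrightarrow> abs_completion U - 0"
    by (intro tendsto_diff lim0)
  then show "convergent x" by (simp add: convergentI)
qed


lemma completion_extension:
  fixes L :: "'v::complex_seminormed_vector \<Rightarrow> 'w::{complex_normed_vector, banach}"
  assumes add: "\<And>x y. L (x + y) = L x + L y" and scale: "\<And>c x. L (c *\<^sub>C x) = c *\<^sub>C L x"
    and bound: "\<And>x. norm (L x) \<le> K * seminorm x"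
  shows "\<exists>!M. bounded_clinear M \<and> (\<forall>x. M (of_seminormed x) = L x)"
proof -
  have diff: "L (x - y) = L x - L y" for x y
    by (metis add add_diff_cancel_right' diff_add_cancel)
  have "K * seminorm x \<le> max K 0 * seminorm x" for x :: 'v
    by (intro mult_right_mono) (auto simp: seminorm_nonneg)
  with bound have bound': "norm (L x) \<le> max K 0 * seminorm x" for x
    using order_trans by blast
  have ex: "\<exists>X. seminorm_Cauchy X \<and> (\<lambda>n. of_seminormed (X n)) \<longlonglongrightarrow> x" for x :: "'v completion"
    using completion_approx by blast
  then obtain R where R: "\<And>x. seminorm_Cauchy (R x)" "\<And>x. (\<lambda>n. of_seminormed (R x n)) \<longlonglongrightarrow> (x :: 'v completion)"
    by metis
  define M where "M x = lim (\<lambda>n. L (R x n))" for x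
  have CL: "(\<lambda>n. L (R x n)) \<longlonglongrightarrow> M x" for x
  proof -
    have "Cauchy (\<lambda>n. L (R x n))"
      unfolding Cauchy_def dist_norm diff[symmetric]
    proof (intro allI impI)
      fix e :: real assume "e > 0"
      then have "e / (max K 0 + 1) > 0" by (simp add: add_nonneg_pos)
      then obtain N where N: "\<And>m n. m \<ge> N \<Longrightarrow> n \<ge> N \<Longrightarrow> seminorm (R x m - R x n) < e / (max K 0 + 1)"
        using R(1)[of x] unfolding seminorm_Cauchy_def by blast
      have "norm (L (R x m - R x n)) < e" if "m \<ge> N" "n \<ge> N" for m n
      proof -
        have "norm (L (R x m - R x n)) \<le> (max K 0 + 1) * seminorm (R x m - R x n)"
          using bound'[of "R x m - R x n"] seminorm_nonneg[of "R x m - R x n"] by (simp add: algebra_simps)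
        also have "\<dots> < e" using N[OF that] by (simp add: field_simps add_nonneg_pos)
        finally show ?thesis .
      qed
      then show "\<exists>N. \<forall>m\<ge>N. \<forall>n\<ge>N. norm (L (R x m - R x n)) < e" by blast
    qed
    then show ?thesis unfolding M_def by (simp add: Cauchy_convergent_iff convergent_LIMSEQ_iff)
  qed
  have key: "(\<lambda>n. L (X n)) \<longlonglongrightarrow> M x" if "(\<lambda>n. of_seminormed (X n)) \<longlonglongrightarrow> x" for X x
  proof -
    have "(\<lambda>n. norm (of_seminormed (X n) - of_seminormed (R x n))) \<longlonglongrightarrow> norm (x - x)"
      by (intro tendsto_intros that R)
    then have "(\<lambda>n. max K 0 * seminorm (X n - R x n)) \<longlonglongrightarrow> 0"
      by (simp add: of_seminormed_diff[symmetric] norm_of_seminormed tendsto_mult_right_zero)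
    then have "(\<lambda>n. L (X n) - L (R x n)) \<longlonglongrightarrow> 0"
      by (rule Lim_null_comparison[rotated]) (auto simp: diff[symmetric] bound')
    from tendsto_add[OF this CL[of x]] show ?thesis by simp
  qed
  have M: "bounded_clinear M"
  proof (rule bounded_clinearI)
    fix x y :: "'v completion" and c
    have "(\<lambda>n. of_seminormed (R x n + R y n)) \<longlonglongrightarrow> x + y"
      unfolding of_seminormed_add by (intro tendsto_intros R)
    from key[OF this] have "(\<lambda>n. L (R x n) + L (R y n)) \<longlonglongrightarrow> M (x + y)" by (simp add: add)
    with tendsto_add[OF CL[of x] CL[of y]] show "M (x + y) = M x + M y"
      using LIMSEQ_unique by blast
    have lim_scale: "(\<lambda>n. c *\<^sub>C Y n) \<longlonglongrightarrow> c *\<^sub>C y" if "Y \<longlonglongrightarrow> y"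
      for Y and y :: "'x::complex_normed_vector"
    proof -
      have "(\<lambda>n. cmod c * norm (Y n - y)) \<longlonglongrightarrow> 0"
        using that by (intro tendsto_mult_right_zero) (simp add: LIM_zero_iff tendsto_norm_zero_iff)
      then have "(\<lambda>n. norm (c *\<^sub>C Y n - c *\<^sub>C y)) \<longlonglongrightarrow> 0"
        by (simp add: scaleC_diff_right[symmetric] norm_scaleC)
      then have "(\<lambda>n. c *\<^sub>C Y n - c *\<^sub>C y) \<longlonglongrightarrow> 0"
        by (rule tendsto_norm_zero_cancel)
      then show ?thesis by (simp add: LIM_zero_iff)
    qed
    have "(\<lambda>n. of_seminormed (c *\<^sub>C R x n)) \<longlonglongrightarrow> c *\<^sub>C x"
      unfolding of_seminormed_scaleC by (intro lim_scale R)
    from key[OF this] have "(\<lambda>n. c *\<^sub>C L (R x n)) \<longlonglongrightarrow> M (c *\<^sub>C x)" by (simp add: scale)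
    with lim_scale[OF CL[of x]] show "M (c *\<^sub>C x) = c *\<^sub>C M x"
      using LIMSEQ_unique by blast
    show "norm (M x) \<le> norm x * max K 0"
    proof (rule LIMSEQ_le)
      show "\<exists>N. \<forall>n\<ge>N. norm (L (R x n)) \<le> norm (of_seminormed (R x n)) * max K 0"
        using bound' unfolding norm_of_seminormed by (metis mult.commute)
      show "(\<lambda>n. norm (L (R x n))) \<longlonglongrightarrow> norm (M x)" by (intro tendsto_intros CL)
      show "(\<lambda>n. norm (of_seminormed (R x n)) * max K 0) \<longlonglongrightarrow> norm x * max K 0"
        by (intro tendsto_intros R)
    qed
  qed
  have M_eq: "M (of_seminormed x) = L x" for x
    using key[of "\<lambda>_. x" "of_seminormed x"] by (simp add: LIMSEQ_const_iff)
  show ?thesis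
  proof (rule ex1I[of _ M])
    show "bounded_clinear M \<and> (\<forall>x. M (of_seminormed x) = L x)" using M M_eq by blast
    fix M' assume M': "bounded_clinear M' \<and> (\<forall>x. M' (of_seminormed x) = L x)"
    show "M' = M"
    proof
      fix x
      have "(\<lambda>n. M' (of_seminormed (R x n))) \<longlonglongrightarrow> M' x"
        using M' by (intro bounded_linear.tendsto[OF _ R(2)]) (simp add: bounded_clinear_def)
      with M' have "(\<lambda>n. L (R x n)) \<longlonglongrightarrow> M' x" by simp
      with CL[of x] show "M' x = M x" using LIMSEQ_unique by blast
    qed
  qed
qed


section \<open>The projective tensor product\<close>

text \<open>The algebraic tensor product is the set of formal finite sums of pairs
  \<open>(a, b)\<close>, modulo the congruence generated by the tensor relations.\<close>

inductive tensor_eq ::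
    "('a::complex_vector \<times> 'b::complex_vector) list \<Rightarrow> ('a \<times> 'b) list \<Rightarrow> bool" where
  tensor_eq_refl: "tensor_eq xs xs"
| tensor_eq_sym: "tensor_eq xs ys \<Longrightarrow> tensor_eq ys xs"
| tensor_eq_trans: "tensor_eq xs ys \<Longrightarrow> tensor_eq ys zs \<Longrightarrow> tensor_eq xs zs"
| tensor_eq_append: "tensor_eq xs xs' \<Longrightarrow> tensor_eq ys ys' \<Longrightarrow> tensor_eq (xs @ ys) (xs' @ ys')"
| tensor_eq_commute: "tensor_eq (xs @ ys) (ys @ xs)"
| tensor_eq_add_left: "tensor_eq [(a + a', b)] [(a, b), (a', b)]"
| tensor_eq_add_right: "tensor_eq [(a, b + b')] [(a, b), (a, b')]"
| tensor_eq_scale: "tensor_eq [(c *\<^sub>C a, b)] [(a, c *\<^sub>C b)]"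
| tensor_eq_zero: "tensor_eq [(0, b)] []"

definition tensor_scale :: "complex \<Rightarrow> ('a::complex_vector \<times> 'b) list \<Rightarrow> ('a \<times> 'b) list"
  where "tensor_scale c = map (\<lambda>(a, b). (c *\<^sub>C a, b))"

lemma tensor_scale_simps [simp]:
  "tensor_scale c [] = []" "tensor_scale c ((a, b) # xs) = (c *\<^sub>C a, b) # tensor_scale c xs"
  "tensor_scale c (xs @ ys) = tensor_scale c xs @ tensor_scale c ys"
  by (simp_all add: tensor_scale_def)

lemma tensor_eq_scaleC: "tensor_eq xs ys \<Longrightarrow> tensor_eq (tensor_scale c xs) (tensor_scale c ys)"
proof (induction rule: tensor_eq.induct)
  case (tensor_eq_scale d a b)
  have "tensor_eq [(d *\<^sub>C (c *\<^sub>C a), b)] [(c *\<^sub>C a, d *\<^sub>C b)]" by (rule tensor_eq.intros)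
  then show ?case by (simp add: scaleC_scaleC mult.commute)
qed (auto simp: scaleC_add_right intro: tensor_eq.intros)

lemma tensor_eq_scaleC_add:
  "tensor_eq (tensor_scale (c + d) xs) (tensor_scale c xs @ tensor_scale d xs)"
proof (induction xs)
  case Nil
  show ?case by (simp add: tensor_eq_refl)
next
  case (Cons x xs)
  obtain a b where x: "x = (a, b)" by (cases x)
  let ?c = "tensor_scale c xs" and ?d = "tensor_scale d xs"
  have "tensor_eq ([((c + d) *\<^sub>C a, b)] @ tensor_scale (c + d) xs)
      ([(c *\<^sub>C a, b), (d *\<^sub>C a, b)] @ (?c @ ?d))"
    unfolding scaleC_add_left by (intro tensor_eq_append tensor_eq_add_left Cons)
  moreover have "tensor_eq ([(c *\<^sub>C a, b)] @ (([(d *\<^sub>C a, b)] @ ?c) @ ?d))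
      ([(c *\<^sub>C a, b)] @ ((?c @ [(d *\<^sub>C a, b)]) @ ?d))"
    by (intro tensor_eq_append tensor_eq_refl tensor_eq_commute)
  ultimately show ?case by (auto simp: x intro: tensor_eq_trans)
qed

lemma tensor_eq_scaleC_0: "tensor_eq (tensor_scale 0 xs) []"
proof (induction xs)
  case (Cons x xs)
  obtain a b where x: "x = (a, b)" by (cases x)
  have "tensor_eq ([(0, b)] @ tensor_scale 0 xs) ([] @ [])"
    by (intro tensor_eq_append tensor_eq_zero Cons)
  then show ?case by (simp add: x)
qed (simp add: tensor_eq_refl)

quotient_type (overloaded) ('a, 'b) atensor =
  "('a::complex_vector \<times> 'b::complex_vector) list" / tensor_eq
  by (rule equivpI) (auto intro!: reflpI sympI transpI intro: tensor_eq.intros)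

instantiation atensor :: (complex_vector, complex_vector) complex_vector
begin

lift_definition zero_atensor :: "('a, 'b) atensor" is "[]" .
lift_definition plus_atensor :: "('a, 'b) atensor \<Rightarrow> ('a, 'b) atensor \<Rightarrow> ('a, 'b) atensor" is "(@)"
  by (rule tensor_eq_append)
lift_definition scaleC_atensor :: "complex \<Rightarrow> ('a, 'b) atensor \<Rightarrow> ('a, 'b) atensor" is tensor_scale
  by (rule tensor_eq_scaleC)
definition uminus_atensor :: "('a, 'b) atensor \<Rightarrow> ('a, 'b) atensor"
  where "uminus_atensor x = (- 1) *\<^sub>C x"
definition minus_atensor :: "('a, 'b) atensor \<Rightarrow> ('a, 'b) atensor \<Rightarrow> ('a, 'b) atensor"
  where "minus_atensor x y = x + - y"

instance
proof
  fix x y z :: "('a, 'b) atensor" and c d :: complex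
  show "x + y + z = x + (y + z)" by transfer (simp add: tensor_eq_refl)
  show "x + y = y + x" by transfer (rule tensor_eq_commute)
  show "0 + x = x" by transfer (simp add: tensor_eq_refl)
  show one: "1 *\<^sub>C x = x" for x :: "('a, 'b) atensor"
    by transfer (simp add: tensor_scale_def scaleC_one tensor_eq_refl)
  show add: "(c + d) *\<^sub>C x = c *\<^sub>C x + d *\<^sub>C x" for c d and x :: "('a, 'b) atensor"
    by transfer (rule tensor_eq_scaleC_add)
  have zero: "0 *\<^sub>C x = 0" by transfer (rule tensor_eq_scaleC_0)
  show "- x + x = 0"
    using add[of "- 1" 1 x] by (simp add: uminus_atensor_def one zero)
  show "x - y = x + - y" by (simp add: minus_atensor_def)
  show "c *\<^sub>C (x + y) = c *\<^sub>C x + c *\<^sub>C y" by transfer (simp add: tensor_eq_refl)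
  show "c *\<^sub>C d *\<^sub>C x = (c * d) *\<^sub>C x"
    by transfer (simp add: tensor_scale_def scaleC_scaleC case_prod_unfold comp_def tensor_eq_refl)
qed

end

lift_definition atensor_pair :: "'a::complex_vector \<Rightarrow> 'b::complex_vector \<Rightarrow> ('a, 'b) atensor"
  is "\<lambda>a b. [(a, b)]" .

text \<open>The projective norm is the infimum of \<open>\<Sum>\<^sub>k \<parallel>a\<^sub>k\<parallel> \<parallel>b\<^sub>k\<parallel>\<close> over all representations
  \<open>\<Sum>\<^sub>k a\<^sub>k \<otimes> b\<^sub>k\<close>.  It is only used as a seminorm here, since
  the completion identifies elements at distance zero anyway.\<close>

definition tensor_weight :: "('a::real_normed_vector \<times> 'b::real_normed_vector) list \<Rightarrow> real"
  where "tensor_weight xs = (\<Sum>(a, b)\<leftarrow>xs. norm a * norm b)"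

lemma tensor_weight_nonneg: "tensor_weight xs \<ge> 0"
  unfolding tensor_weight_def by (intro sum_list_nonneg) auto

lemma tensor_weight_append: "tensor_weight (xs @ ys) = tensor_weight xs + tensor_weight ys"
  by (simp add: tensor_weight_def)

lemma tensor_weight_scale:
  fixes xs :: "('a::complex_normed_vector \<times> 'b::real_normed_vector) list"
  shows "tensor_weight (tensor_scale c xs) = cmod c * tensor_weight xs"
  by (induction xs) (auto simp: tensor_weight_def norm_scaleC algebra_simps)

instantiation atensor :: (complex_normed_vector, complex_normed_vector) complex_seminormed_vector
begin

definition seminorm_atensor :: "('a, 'b) atensor \<Rightarrow> real"
  where "seminorm_atensor x = Inf {tensor_weight xs | xs. x = abs_atensor xs}"

lemma seminorm_atensor_le: "seminorm (abs_atensor xs) \<le> tensor_weight xs"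
  unfolding seminorm_atensor_def
  by (rule cInf_lower) (auto intro!: bdd_belowI[of _ 0] simp: tensor_weight_nonneg)

lemma seminorm_atensor_approx:
  fixes x :: "('a, 'b) atensor"
  assumes "e > 0"
  obtains xs where "x = abs_atensor xs" "tensor_weight xs < seminorm x + e"
proof -
  have "\<exists>xs. x = abs_atensor xs" by (metis Quotient3_abs_rep Quotient3_atensor)
  then have "{tensor_weight xs | xs. x = abs_atensor xs} \<noteq> {}" by blast
  from cInf_lessD[OF this, of "seminorm x + e"] assms that show ?thesis
    by (auto simp: seminorm_atensor_def)
qed

instance
proof
  fix x y :: "('a, 'b) atensor" and c :: complex
  show "seminorm (x + y) \<le> seminorm x + seminorm y"
  proof (rule field_le_epsilon)
    fix e :: real assume "e > 0"
    then have e: "e / 2 > 0" by simp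
    obtain xs where xs: "x = abs_atensor xs" "tensor_weight xs < seminorm x + e / 2"
      by (rule seminorm_atensor_approx[OF e])
    obtain ys where ys: "y = abs_atensor ys" "tensor_weight ys < seminorm y + e / 2"
      by (rule seminorm_atensor_approx[OF e])
    have "seminorm (x + y) \<le> tensor_weight (xs @ ys)"
      using seminorm_atensor_le[of "xs @ ys"] by (simp add: xs(1) ys(1) plus_atensor.abs_eq)
    then show "seminorm (x + y) \<le> seminorm x + seminorm y + e"
      using xs(2) ys(2) by (simp add: tensor_weight_append)
  qed
  have le: "seminorm (c *\<^sub>C x) \<le> cmod c * seminorm x" for c and x :: "('a, 'b) atensor"
  proof (rule field_le_epsilon)
    fix e :: real assume "e > 0"
    then have e: "e / (cmod c + 1) > 0" by (simp add: add_nonneg_pos)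
    obtain xs where xs: "x = abs_atensor xs" "tensor_weight xs < seminorm x + e / (cmod c + 1)"
      by (rule seminorm_atensor_approx[OF e])
    have "seminorm (c *\<^sub>C x) \<le> cmod c * tensor_weight xs"
      using seminorm_atensor_le[of "tensor_scale c xs"]
      by (simp add: xs(1) scaleC_atensor.abs_eq tensor_weight_scale)
    also have "\<dots> \<le> cmod c * (seminorm x + e / (cmod c + 1))"
      using xs(2) by (intro mult_left_mono) auto
    also have "\<dots> = cmod c * seminorm x + cmod c * (e / (cmod c + 1))"
      by (simp add: distrib_left)
    also have "cmod c * (e / (cmod c + 1)) \<le> e"
      using \<open>e > 0\<close> by (simp add: pos_divide_le_eq add_nonneg_pos add_pos_nonneg algebra_simps)
    finally show "seminorm (c *\<^sub>C x) \<le> cmod c * seminorm x + e" by simp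
  qed
  show "seminorm (c *\<^sub>C x) = cmod c * seminorm x"
  proof (cases "c = 0")
    case True
    have "seminorm (0 :: ('a, 'b) atensor) \<le> 0"
      using seminorm_atensor_le[of "[]"] by (simp add: zero_atensor_def tensor_weight_def)
    moreover have "seminorm (0 :: ('a, 'b) atensor) \<ge> 0"
      unfolding seminorm_atensor_def
      by (rule cInf_greatest) (auto simp: tensor_weight_nonneg zero_atensor_def)
    ultimately show ?thesis using True by simp
  next
    case False
    have "seminorm x \<le> cmod (1 / c) * seminorm (c *\<^sub>C x)"
      using le[of "1 / c" "c *\<^sub>C x"] False by (simp add: scaleC_scaleC scaleC_one)
    then have "cmod c * seminorm x \<le> seminorm (c *\<^sub>C x)"
      using False by (simp add: norm_divide field_simps)
    with le[of c x] show ?thesis by simp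
  qed
qed

end

type_synonym ('a, 'b) ptensor = "('a, 'b) atensor completion"

definition tensor :: "'a::complex_normed_vector \<Rightarrow> 'b::complex_normed_vector \<Rightarrow> ('a, 'b) ptensor"
    (infixl "\<otimes>\<^sub>p" 70)
  where "a \<otimes>\<^sub>p b = of_seminormed (atensor_pair a b)"

lemma bounded_cbilinear_tensor: "bounded_cbilinear (\<otimes>\<^sub>p)"
proof -
  have 1: "atensor_pair (a + a') b = atensor_pair a b + atensor_pair a' b" for a a' :: 'a and b :: 'b
    by transfer (simp add: tensor_eq_add_left)
  have 2: "atensor_pair a (b + b') = atensor_pair a b + atensor_pair a b'" for a :: 'a and b b' :: 'b
    by transfer (simp add: tensor_eq_add_right)
  have 3: "atensor_pair (c *\<^sub>C a) b = c *\<^sub>C atensor_pair a b" for a :: 'a and b :: 'b and c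
    by transfer (simp add: tensor_eq_refl)
  have 4: "atensor_pair a (c *\<^sub>C b) = c *\<^sub>C atensor_pair a b" for a :: 'a and b :: 'b and c
    by transfer (simp add: tensor_eq_sym[OF tensor_eq_scale])
  have 5: "norm (a \<otimes>\<^sub>p b) \<le> norm a * norm b * 1" for a :: 'a and b :: 'b
    using seminorm_atensor_le[of "[(a, b)]"]
    by (simp add: tensor_def norm_of_seminormed atensor_pair.abs_eq tensor_weight_def)
  have "bounded_bilinear ((\<otimes>\<^sub>p) :: 'a \<Rightarrow> 'b \<Rightarrow> _)"
    by (rule bounded_bilinear.intro)
       (use 5 in \<open>auto simp: tensor_def 1 2 3 4 of_seminormed_add of_seminormed_scaleC scaleR_scaleC
         intro!: exI[of _ 1]\<close>)
  then show ?thesis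
    by (simp add: bounded_cbilinear_def tensor_def 3 4 of_seminormed_scaleC)
qed

text \<open>The bounded linear map determined by a bounded bilinear one.\<close>

definition tensor_lift ::
    "('a::complex_normed_vector \<Rightarrow> 'b::complex_normed_vector \<Rightarrow> 'c::complex_normed_vector)
      \<Rightarrow> ('a, 'b) ptensor \<Rightarrow> 'c"
  where "tensor_lift B = (THE L. bounded_clinear L \<and> (\<forall>a b. L (a \<otimes>\<^sub>p b) = B a b))"

lemma tensor_universal:
  fixes B :: "'a::complex_normed_vector \<Rightarrow> 'b::complex_normed_vector \<Rightarrow> 'c::{complex_normed_vector, banach}"
  assumes "bounded_cbilinear B"
  shows "\<exists>!L. bounded_clinear L \<and> (\<forall>a b. L (a \<otimes>\<^sub>p b) = B a b)"
proof -
  interpret B: bounded_bilinear B using assms by (simp add: bounded_cbilinear_def)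
  have BC: "B (c *\<^sub>C a) b = c *\<^sub>C B a b" "B a (c *\<^sub>C b) = c *\<^sub>C B a b" for a b c
    using assms by (simp_all add: bounded_cbilinear_def)
  define S where "S = (\<lambda>xs. \<Sum>(a, b)\<leftarrow>xs. B a b)"
  have S_append: "S (xs @ ys) = S xs + S ys" for xs ys by (simp add: S_def)
  have S_scale: "S (tensor_scale c xs) = c *\<^sub>C S xs" for c xs
    by (induction xs) (auto simp: S_def BC scaleC_add_right)
  have S_eq: "S xs = S ys" if "tensor_eq xs ys" for xs ys
    using that
    by (induction rule: tensor_eq.induct)
       (auto simp: S_append add.commute, auto simp: S_def BC B.add_left B.add_right B.zero_left)
  obtain K where K: "\<And>a b. norm (B a b) \<le> norm a * norm b * K" "K \<ge> 0"
    using B.nonneg_bounded by blast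
  have S_bound: "norm (S xs) \<le> K * tensor_weight xs" for xs
  proof (induction xs)
    case (Cons x xs)
    obtain a b where x: "x = (a, b)" by (cases x)
    have "norm (S (x # xs)) \<le> norm (B a b) + norm (S xs)"
      by (simp add: S_def x norm_triangle_ineq)
    also have "\<dots> \<le> norm a * norm b * K + K * tensor_weight xs"
      by (intro add_mono K Cons)
    finally show ?case by (simp add: tensor_weight_def x algebra_simps)
  qed (simp add: S_def tensor_weight_def)
  define L where "L x = S (rep_atensor x)" for x
  have L_abs: "L (abs_atensor xs) = S xs" for xs
    unfolding L_def by (rule S_eq, rule Quotient3_rep_abs[OF Quotient3_atensor], rule tensor_eq_refl)
  have ex: "\<exists>xs. x = abs_atensor xs" for x :: "('a, 'b) atensor"
    by (metis Quotient3_abs_rep Quotient3_atensor)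
  have L_add: "L (x + y) = L x + L y" for x y
    using ex[of x] ex[of y] by (auto simp: plus_atensor.abs_eq L_abs S_append)
  have L_scale: "L (c *\<^sub>C x) = c *\<^sub>C L x" for c x
    using ex[of x] by (auto simp: scaleC_atensor.abs_eq L_abs S_scale)
  have L_bound: "norm (L x) \<le> K * seminorm x" for x
  proof (rule field_le_epsilon)
    fix e :: real assume "e > 0"
    then have e: "e / (K + 1) > 0" using K(2) by simp
    obtain xs where xs: "x = abs_atensor xs" "tensor_weight xs < seminorm x + e / (K + 1)"
      by (rule seminorm_atensor_approx[OF e])
    have "norm (L x) \<le> K * tensor_weight xs" by (simp add: xs(1) L_abs S_bound)
    also have "\<dots> \<le> K * (seminorm x + e / (K + 1))"
      using xs(2) K(2) by (intro mult_left_mono) auto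
    also have "\<dots> = K * seminorm x + K * (e / (K + 1))" by (simp add: distrib_left)
    also have "K * (e / (K + 1)) \<le> e"
      using \<open>e > 0\<close> K(2) by (simp add: pos_divide_le_eq algebra_simps)
    finally show "norm (L x) \<le> K * seminorm x + e" by simp
  qed
  have L_pair: "L (atensor_pair a b) = B a b" for a b
    by (simp add: atensor_pair.abs_eq L_abs S_def)
  obtain M where M: "bounded_clinear M" "\<And>x. M (of_seminormed x) = L x"
    and uniq: "\<And>M'. bounded_clinear M' \<Longrightarrow> (\<And>x. M' (of_seminormed x) = L x) \<Longrightarrow> M' = M"
    using completion_extension[of L K, OF L_add L_scale L_bound] by blast
  show ?thesis
  proof (rule ex1I[of _ M])
    show "bounded_clinear M \<and> (\<forall>a b. M (a \<otimes>\<^sub>p b) = B a b)"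
      using M by (simp add: tensor_def L_pair)
    fix M' assume M': "bounded_clinear M' \<and> (\<forall>a b. M' (a \<otimes>\<^sub>p b) = B a b)"
    interpret M': bounded_linear M' using M' by (simp add: bounded_clinear_def)
    have "M' (of_seminormed (abs_atensor xs)) = S xs" for xs
    proof (induction xs)
      case Nil
      have "of_seminormed (abs_atensor []) = (0 :: ('a, 'b) ptensor)"
        using of_seminormed_diff[of "0 :: ('a, 'b) atensor" 0] by (simp add: zero_atensor_def)
      then show ?case by (simp add: S_def M'.zero)
    next
      case (Cons x xs)
      obtain a b where x: "x = (a, b)" by (cases x)
      have "abs_atensor (x # xs) = atensor_pair a b + abs_atensor xs"
        by (simp add: atensor_pair.abs_eq plus_atensor.abs_eq x)
      then show ?case
        using M' Cons by (simp add: of_seminormed_add M'.add tensor_def S_def x)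
    qed
    then have "M' (of_seminormed x) = L x" for x
      using ex[of x] L_abs by auto
    with M' show "M' = M" by (intro uniq) auto
  qed
qed

lemma tensor_lift:
  fixes B :: "'a::complex_normed_vector \<Rightarrow> 'b::complex_normed_vector \<Rightarrow> 'c::{complex_normed_vector, banach}"
  assumes "bounded_cbilinear B"
  shows "bounded_clinear (tensor_lift B)" "tensor_lift B (a \<otimes>\<^sub>p b) = B a b"
  using theI'[OF tensor_universal[OF assms]] unfolding tensor_lift_def by auto


section \<open>Upper triangular matrices\<close>

definition abs_summable_matrix :: "('i \<Rightarrow> 'j \<Rightarrow> 'a::real_normed_vector) \<Rightarrow> bool"
  where "abs_summable_matrix M \<longleftrightarrow> (\<lambda>(i, j). norm (M i j)) summable_on UNIV"

definition matrix_l1_norm :: "('i \<Rightarrow> 'j \<Rightarrow> 'a::real_normed_vector) \<Rightarrow> real"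
  where "matrix_l1_norm M = (\<Sum>\<^sub>\<infinity>(i, j). norm (M i j))"

lemma matrix_l1_norm_nonneg: "matrix_l1_norm M \<ge> 0"
  unfolding matrix_l1_norm_def by (intro infsum_nonneg) auto

lemma abs_summable_matrix_bounded:
  assumes "\<And>F. finite F \<Longrightarrow> (\<Sum>(i, j)\<in>F. norm (M i j)) \<le> K"
  shows "abs_summable_matrix M" "matrix_l1_norm M \<le> K"
proof -
  show s: "abs_summable_matrix M"
    unfolding abs_summable_matrix_def
    by (rule nonneg_bdd_above_summable_on) (use assms in \<open>auto intro!: bdd_aboveI2\<close>)
  then show "matrix_l1_norm M \<le> K"
    unfolding abs_summable_matrix_def matrix_l1_norm_def
    by (rule infsum_le_finite_sums) (use assms in auto)
qed

lemma sum_le_matrix_l1_norm: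
  assumes "abs_summable_matrix M" "finite F"
  shows "(\<Sum>(i, j)\<in>F. norm (M i j)) \<le> matrix_l1_norm M"
  using assms unfolding abs_summable_matrix_def matrix_l1_norm_def
  by (intro finite_sum_le_infsum) auto

lemma norm_entry_le_matrix_l1_norm:
  assumes "abs_summable_matrix M"
  shows "norm (M i j) \<le> matrix_l1_norm M"
  using sum_le_matrix_l1_norm[OF assms, of "{(i, j)}"] by simp

lemma abs_summable_matrix_add:
  assumes "abs_summable_matrix M" "abs_summable_matrix N"
  shows "abs_summable_matrix (\<lambda>i j. M i j + N i j)"
    "matrix_l1_norm (\<lambda>i j. M i j + N i j) \<le> matrix_l1_norm M + matrix_l1_norm N"
proof -
  have "(\<Sum>(i, j)\<in>F. norm (M i j + N i j)) \<le> matrix_l1_norm M + matrix_l1_norm N" if "finite F" for F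
  proof -
    have "(\<Sum>(i, j)\<in>F. norm (M i j + N i j)) \<le> (\<Sum>(i, j)\<in>F. norm (M i j)) + (\<Sum>(i, j)\<in>F. norm (N i j))"
      unfolding sum.distrib[symmetric] by (intro sum_mono) (auto simp: norm_triangle_ineq)
    with sum_le_matrix_l1_norm[OF assms(1) that] sum_le_matrix_l1_norm[OF assms(2) that]
    show ?thesis by simp
  qed
  then show "abs_summable_matrix (\<lambda>i j. M i j + N i j)"
    "matrix_l1_norm (\<lambda>i j. M i j + N i j) \<le> matrix_l1_norm M + matrix_l1_norm N"
    using abs_summable_matrix_bounded[of "\<lambda>i j. M i j + N i j"] by blast+
qed

lemma abs_summable_matrix_scaleC:
  fixes M :: "'i \<Rightarrow> 'j \<Rightarrow> 'a::complex_normed_vector"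
  assumes "abs_summable_matrix M"
  shows "abs_summable_matrix (\<lambda>i j. c *\<^sub>C M i j)"
    "matrix_l1_norm (\<lambda>i j. c *\<^sub>C M i j) = cmod c * matrix_l1_norm M"
  using assms unfolding abs_summable_matrix_def matrix_l1_norm_def case_prod_unfold norm_scaleC
  by (auto intro: summable_on_cmult_right infsum_cmult_right)

lemma has_sum_product_nonneg:
  fixes f :: "'x \<Rightarrow> real" and g :: "'y \<Rightarrow> real"
  assumes f: "(f has_sum a) A" and g: "(g has_sum b) B"
    and nonneg: "\<And>x. f x \<ge> 0" "\<And>y. g y \<ge> 0"
  shows "((\<lambda>(x, y). f x * g y) has_sum (a * b)) (A \<times> B)"
proof (rule has_sum_SigmaI)
  show inner: "((\<lambda>y. case (x, y) of (x, y) \<Rightarrow> f x * g y) has_sum (f x * b)) B" for x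
    using has_sum_cmult_right[OF g] by simp
  show outer: "((\<lambda>x. f x * b) has_sum (a * b)) A"
    by (rule has_sum_cmult_left[OF f])
  show "(\<lambda>(x, y). f x * g y) summable_on A \<times> B"
    by (rule summable_on_SigmaI[OF inner has_sum_imp_summable[OF outer]]) (simp add: nonneg)
qed

context
  fixes M :: "'i \<Rightarrow> 'k \<Rightarrow> 'a::{real_normed_algebra, banach}" and N :: "'k \<Rightarrow> 'j \<Rightarrow> 'a"
  assumes M: "abs_summable_matrix M" and N: "abs_summable_matrix N"
begin

lemma matrix_mult_triple:
  shows "(\<lambda>((i, j), k). norm (M i k) * norm (N k j)) summable_on UNIV"
    "(\<Sum>\<^sub>\<infinity>((i, j), k). norm (M i k) * norm (N k j)) \<le> matrix_l1_norm M * matrix_l1_norm N"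
proof -
  let ?P = "\<lambda>(p, q). (case p of (i, k) \<Rightarrow> norm (M i k)) * (case q of (k, j) \<Rightarrow> norm (N k j))"
  let ?h = "\<lambda>((i, j), k). ((i, k), (k, j))"
  have P: "(?P has_sum (matrix_l1_norm M * matrix_l1_norm N)) (UNIV \<times> UNIV)"
    unfolding matrix_l1_norm_def
    by (intro has_sum_product_nonneg has_sum_infsum)
       (use M N in \<open>auto simp: abs_summable_matrix_def\<close>)
  have inj: "inj ?h" by (auto simp: inj_def)
  have eq: "?P \<circ> ?h = (\<lambda>((i, j), k). norm (M i k) * norm (N k j))"
    by (auto simp: fun_eq_iff)
  have s: "?P summable_on range ?h"
    by (rule summable_on_subset[OF has_sum_imp_summable[OF P]]) auto
  then show "(\<lambda>((i, j), k). norm (M i k) * norm (N k j)) summable_on UNIV"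
    unfolding summable_on_reindex[OF inj] eq .
  have "infsum ?P (range ?h) \<le> infsum ?P (UNIV \<times> UNIV)"
    by (rule infsum_mono2[OF s has_sum_imp_summable[OF P]]) auto
  then show "(\<Sum>\<^sub>\<infinity>((i, j), k). norm (M i k) * norm (N k j)) \<le> matrix_l1_norm M * matrix_l1_norm N"
    unfolding infsum_reindex[OF inj] eq infsumI[OF P] .
qed

lemma matrix_mult_abs_summable_triple: "(\<lambda>((i, j), k). norm (M i k * N k j)) summable_on UNIV"
proof -
  have "(\<lambda>x. norm (case x of ((i, j), k) \<Rightarrow> M i k * N k j)) summable_on UNIV"
    by (rule Infinite_Sum.abs_summable_on_comparison_test'[OF matrix_mult_triple(1)]) (auto simp: norm_mult_ineq)
  then show ?thesis by (simp add: case_prod_unfold)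
qed

lemma matrix_mult_inner:
  "(\<lambda>k. norm (M i k * N k j)) summable_on UNIV" "(\<lambda>k. M i k * N k j) summable_on UNIV"
proof -
  show "(\<lambda>k. norm (M i k * N k j)) summable_on UNIV"
    using summable_on_SigmaD1[where A = UNIV and B = "\<lambda>_. UNIV" and x = "(i, j)"
        and f = "\<lambda>(i, j) k. norm (M i k * N k j)"]
      matrix_mult_abs_summable_triple by (simp add: case_prod_unfold)
  then show "(\<lambda>k. M i k * N k j) summable_on UNIV" by (rule abs_summable_summable)
qed

lemma matrix_mult_bound:
  shows "abs_summable_matrix (\<lambda>i j. \<Sum>\<^sub>\<infinity>k. M i k * N k j)"
    "matrix_l1_norm (\<lambda>i j. \<Sum>\<^sub>\<infinity>k. M i k * N k j) \<le> matrix_l1_norm M * matrix_l1_norm N"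
proof -
  let ?S = "\<lambda>(i, j). \<Sum>\<^sub>\<infinity>k. norm (M i k * N k j)"
  have S: "?S summable_on UNIV"
    using summable_on_Sigma_banach[where A = UNIV and B = "\<lambda>_. UNIV"
        and f = "\<lambda>(i, j) k. norm (M i k * N k j)"] matrix_mult_abs_summable_triple
    by (simp add: case_prod_unfold)
  have le: "norm (\<Sum>\<^sub>\<infinity>k. M i k * N k j) \<le> (\<Sum>\<^sub>\<infinity>k. norm (M i k * N k j))" for i j
    by (rule norm_infsum_bound[OF matrix_mult_inner(1)])
  have "(\<lambda>p. norm (case p of (i, j) \<Rightarrow> \<Sum>\<^sub>\<infinity>k. M i k * N k j)) summable_on UNIV"
    by (rule Infinite_Sum.abs_summable_on_comparison_test'[OF S]) (use le in auto)
  then show 1: "abs_summable_matrix (\<lambda>i j. \<Sum>\<^sub>\<infinity>k. M i k * N k j)"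
    by (simp add: abs_summable_matrix_def case_prod_unfold)
  have "matrix_l1_norm (\<lambda>i j. \<Sum>\<^sub>\<infinity>k. M i k * N k j) \<le> infsum ?S UNIV"
    unfolding matrix_l1_norm_def
    by (rule infsum_mono) (use 1 S le in \<open>auto simp: abs_summable_matrix_def\<close>)
  also have "\<dots> = (\<Sum>\<^sub>\<infinity>((i, j), k). norm (M i k * N k j))"
    using infsum_Sigma'_banach[where A = UNIV and B = "\<lambda>_. UNIV"
        and f = "\<lambda>(i, j) k. norm (M i k * N k j)"] matrix_mult_abs_summable_triple
    by (simp add: case_prod_unfold)
  also have "\<dots> \<le> (\<Sum>\<^sub>\<infinity>((i, j), k). norm (M i k) * norm (N k j))"
    by (rule infsum_mono[OF matrix_mult_abs_summable_triple matrix_mult_triple(1)])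
       (auto simp: norm_mult_ineq)
  also note matrix_mult_triple(2)
  finally show "matrix_l1_norm (\<lambda>i j. \<Sum>\<^sub>\<infinity>k. M i k * N k j) \<le> matrix_l1_norm M * matrix_l1_norm N" .
qed

end

lemma matrix_mult_assoc:
  fixes L :: "'i \<Rightarrow> 'k \<Rightarrow> 'a::{real_normed_algebra, banach}"
  assumes L: "abs_summable_matrix L" and M: "abs_summable_matrix M" and N: "abs_summable_matrix N"
  shows "(\<Sum>\<^sub>\<infinity>l. (\<Sum>\<^sub>\<infinity>k. L i k * M k l) * N l j) = (\<Sum>\<^sub>\<infinity>k. L i k * (\<Sum>\<^sub>\<infinity>l. M k l * N l j))"
proof -
  have S: "(\<lambda>(k, l). matrix_l1_norm L * matrix_l1_norm N * norm (M k l)) summable_on UNIV"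
    using M unfolding abs_summable_matrix_def case_prod_unfold by (rule summable_on_cmult_right)
  have "norm (L i k * M k l * N l j) \<le> matrix_l1_norm L * matrix_l1_norm N * norm (M k l)" for k l
  proof -
    have "norm (L i k * M k l * N l j) \<le> norm (L i k) * norm (M k l) * norm (N l j)"
      by (meson norm_mult_ineq mult_right_mono norm_ge_zero order_trans)
    also have "\<dots> \<le> matrix_l1_norm L * norm (M k l) * matrix_l1_norm N"
      by (intro mult_mono norm_entry_le_matrix_l1_norm L N mult_nonneg_nonneg matrix_l1_norm_nonneg) auto
    finally show ?thesis by (simp add: mult_ac)
  qed
  then have "(\<lambda>p. norm (case p of (k, l) \<Rightarrow> L i k * M k l * N l j)) summable_on UNIV"
    by (intro Infinite_Sum.abs_summable_on_comparison_test'[OF S]) auto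
  then have s: "(\<lambda>(k, l). L i k * M k l * N l j) summable_on UNIV \<times> UNIV"
    using abs_summable_summable by force
  have "(\<Sum>\<^sub>\<infinity>k. L i k * (\<Sum>\<^sub>\<infinity>l. M k l * N l j)) = (\<Sum>\<^sub>\<infinity>k. \<Sum>\<^sub>\<infinity>l. L i k * M k l * N l j)"
  proof (rule infsum_cong)
    fix k
    have "(\<Sum>\<^sub>\<infinity>l. L i k * (M k l * N l j)) = L i k * (\<Sum>\<^sub>\<infinity>l. M k l * N l j)"
      by (rule infsumI[OF has_sum_bounded_linear[OF bounded_linear_mult_right
            has_sum_infsum[OF matrix_mult_inner(2)[OF M N]]]])
    then show "L i k * (\<Sum>\<^sub>\<infinity>l. M k l * N l j) = (\<Sum>\<^sub>\<infinity>l. L i k * M k l * N l j)"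
      by (simp add: mult.assoc)
  qed
  also have "\<dots> = (\<Sum>\<^sub>\<infinity>l. \<Sum>\<^sub>\<infinity>k. L i k * M k l * N l j)"
    by (rule infsum_swap_banach[OF s])
  also have "\<dots> = (\<Sum>\<^sub>\<infinity>l. (\<Sum>\<^sub>\<infinity>k. L i k * M k l) * N l j)"
  proof (rule infsum_cong)
    fix l
    show "(\<Sum>\<^sub>\<infinity>k. L i k * M k l * N l j) = (\<Sum>\<^sub>\<infinity>k. L i k * M k l) * N l j"
      by (rule infsumI[OF has_sum_bounded_linear[OF bounded_linear_mult_left
            has_sum_infsum[OF matrix_mult_inner(2)[OF L M]]]])
  qed
  finally show ?thesis by simp
qed

typedef (overloaded) ('i, 'a) upmat =
  "{M :: 'i::linorder \<Rightarrow> 'i \<Rightarrow> 'a::real_normed_vector.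
      (\<forall>i j. j < i \<longrightarrow> M i j = 0) \<and> abs_summable_matrix M}"
  by (rule exI[of _ "\<lambda>_ _. 0"]) (simp add: abs_summable_matrix_def case_prod_unfold)

setup_lifting type_definition_upmat

lift_definition entry :: "('i::linorder, 'a::real_normed_vector) upmat \<Rightarrow> 'i \<Rightarrow> 'i \<Rightarrow> 'a" is "\<lambda>M. M" .

instantiation upmat :: (linorder, complex_normed_vector) complex_normed_vector
begin

lift_definition zero_upmat :: "('a, 'b) upmat" is "\<lambda>_ _. 0"
  by (simp add: abs_summable_matrix_def case_prod_unfold)
lift_definition plus_upmat :: "('a, 'b) upmat \<Rightarrow> ('a, 'b) upmat \<Rightarrow> ('a, 'b) upmat"
  is "\<lambda>M N i j. M i j + N i j"
  by (simp add: abs_summable_matrix_add)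
lift_definition scaleC_upmat :: "complex \<Rightarrow> ('a, 'b) upmat \<Rightarrow> ('a, 'b) upmat"
  is "\<lambda>c M i j. c *\<^sub>C M i j"
  by (simp add: abs_summable_matrix_scaleC)
lift_definition norm_upmat :: "('a, 'b) upmat \<Rightarrow> real" is matrix_l1_norm .

definition uminus_upmat :: "('a, 'b) upmat \<Rightarrow> ('a, 'b) upmat"
  where "uminus_upmat M = (- 1) *\<^sub>C M"
definition minus_upmat :: "('a, 'b) upmat \<Rightarrow> ('a, 'b) upmat \<Rightarrow> ('a, 'b) upmat"
  where "minus_upmat M N = M + - N"
definition scaleR_upmat :: "real \<Rightarrow> ('a, 'b) upmat \<Rightarrow> ('a, 'b) upmat"
  where "scaleR_upmat r M = complex_of_real r *\<^sub>C M"
definition dist_upmat :: "('a, 'b) upmat \<Rightarrow> ('a, 'b) upmat \<Rightarrow> real"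
  where "dist_upmat M N = norm (M - N)"
definition sgn_upmat :: "('a, 'b) upmat \<Rightarrow> ('a, 'b) upmat"
  where "sgn_upmat M = inverse (norm M) *\<^sub>R M"
definition uniformity_upmat :: "(('a, 'b) upmat \<times> ('a, 'b) upmat) filter"
  where "uniformity_upmat = (INF e\<in>{0<..}. principal {(M, N). dist M N < e})"
definition open_upmat :: "('a, 'b) upmat set \<Rightarrow> bool"
  where "open_upmat U = (\<forall>M\<in>U. \<forall>\<^sub>F (M', N) in uniformity. M' = M \<longrightarrow> N \<in> U)"

instance
proof
  fix x y z :: "('a, 'b) upmat" and a b :: real and c d :: complex
  show "x + y + z = x + (y + z)" by transfer (simp add: add.assoc)
  show "x + y = y + x" by transfer (simp add: add.commute)
  show "0 + x = x" by transfer simp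
  show "- x + x = 0"
    unfolding uminus_upmat_def by transfer (simp add: scaleC_minus_left scaleC_one)
  show "x - y = x + - y" by (simp add: minus_upmat_def)
  show C1: "c *\<^sub>C (x + y) = c *\<^sub>C x + c *\<^sub>C y" for c :: complex and x y :: "('a, 'b) upmat"
    by transfer (simp add: scaleC_add_right)
  show C2: "(c + d) *\<^sub>C x = c *\<^sub>C x + d *\<^sub>C x" for c d :: complex and x :: "('a, 'b) upmat"
    by transfer (simp add: scaleC_add_left)
  show C3: "c *\<^sub>C d *\<^sub>C x = (c * d) *\<^sub>C x" for c d :: complex and x :: "('a, 'b) upmat"
    by transfer (simp add: scaleC_scaleC)
  show C4: "1 *\<^sub>C x = x" for x :: "('a, 'b) upmat"
    by transfer (simp add: scaleC_one)
  show "a *\<^sub>R x = complex_of_real a *\<^sub>C x" by (simp add: scaleR_upmat_def)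
  show "a *\<^sub>R (x + y) = a *\<^sub>R x + a *\<^sub>R y" by (simp add: scaleR_upmat_def C1)
  show "(a + b) *\<^sub>R x = a *\<^sub>R x + b *\<^sub>R x" by (simp add: scaleR_upmat_def C2)
  show "a *\<^sub>R b *\<^sub>R x = (a * b) *\<^sub>R x" by (simp add: scaleR_upmat_def C3)
  show "1 *\<^sub>R x = x" by (simp add: scaleR_upmat_def C4)
  show "dist x y = norm (x - y)" by (simp add: dist_upmat_def)
  show "sgn x = inverse (norm x) *\<^sub>R x" by (simp add: sgn_upmat_def)
  show "uniformity = (INF e\<in>{0<..}. principal {(x::('a, 'b) upmat, y). dist x y < e})"
    by (simp add: uniformity_upmat_def)
  show "open U = (\<forall>x\<in>U. \<forall>\<^sub>F (x', y) in uniformity. x' = x \<longrightarrow> y \<in> U)"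
    for U :: "('a, 'b) upmat set"
    by (simp add: open_upmat_def)
  show "(norm x = 0) = (x = 0)"
  proof transfer
    fix M :: "'a \<Rightarrow> 'a \<Rightarrow> 'b"
    assume "(\<forall>i j. j < i \<longrightarrow> M i j = 0) \<and> abs_summable_matrix M"
    then have "norm (M i j) \<le> matrix_l1_norm M" for i j
      by (simp add: norm_entry_le_matrix_l1_norm)
    then show "(matrix_l1_norm M = 0) = (M = (\<lambda>_ _. 0))"
      by (auto simp: matrix_l1_norm_def fun_eq_iff case_prod_unfold)
  qed
  show "norm (x + y) \<le> norm x + norm y" by transfer (simp add: abs_summable_matrix_add)
  show N: "norm (c *\<^sub>C x) = cmod c * norm x" for c :: complex and x :: "('a, 'b) upmat"
    by transfer (simp add: abs_summable_matrix_scaleC)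
  show "norm (a *\<^sub>R x) = \<bar>a\<bar> * norm x" by (simp add: scaleR_upmat_def N)
qed

end

lemma entry_simps [simp]:
  "entry 0 i j = 0" "entry (M + N) i j = entry M i j + entry N i j"
  "entry (c *\<^sub>C M) i j = c *\<^sub>C entry M i j"
  by (transfer; simp)+

lemma entry_minus [simp]: "entry (- M) i j = - entry M i j"
  unfolding uminus_upmat_def entry_simps by (simp add: scaleC_minus_left scaleC_one)

lemma entry_diff [simp]: "entry (M - N) i j = entry M i j - entry N i j"
  unfolding minus_upmat_def entry_simps entry_minus by simp

lemma entry_below [simp]: "j < i \<Longrightarrow> entry M i j = 0"
  by transfer simp

lemma upmat_eqI: "(\<And>i j. entry M i j = entry N i j) \<Longrightarrow> M = N"
  by transfer (simp add: fun_eq_iff)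

lemma abs_summable_entry: "abs_summable_matrix (entry M)"
  by transfer simp

lemma norm_upmat_eq: "norm M = matrix_l1_norm (entry M)"
  by transfer simp

lemma norm_entry_le: "norm (entry M i j) \<le> norm M"
  by (simp add: norm_upmat_eq norm_entry_le_matrix_l1_norm abs_summable_entry)

lemma entry_Abs_upmat:
  assumes "\<And>i j. j < i \<Longrightarrow> M i j = 0" "abs_summable_matrix M"
  shows "entry (Abs_upmat M) = M"
  using assms by (simp add: entry.rep_eq Abs_upmat_inverse)

instance upmat :: (linorder, "{complex_normed_vector, banach}") banach
proof
  fix X :: "nat \<Rightarrow> ('a, 'b) upmat"
  assume X: "Cauchy X"
  have "Cauchy (\<lambda>n. entry (X n) i j)" for i j
    unfolding Cauchy_def dist_norm entry_diff[symmetric]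
  proof (intro allI impI)
    fix e :: real assume "e > 0"
    then obtain N where "\<And>m n. m \<ge> N \<Longrightarrow> n \<ge> N \<Longrightarrow> norm (X m - X n) < e"
      using X unfolding Cauchy_def dist_norm by blast
    then have "norm (entry (X m - X n) i j) < e" if "m \<ge> N" "n \<ge> N" for m n
      using that norm_entry_le le_less_trans by blast
    then show "\<exists>N. \<forall>m\<ge>N. \<forall>n\<ge>N. norm (entry (X m - X n) i j) < e" by blast
  qed
  then have "\<exists>l. (\<lambda>n. entry (X n) i j) \<longlonglongrightarrow> l" for i j
    by (simp add: Cauchy_convergent_iff convergent_def)
  then obtain L where L: "\<And>i j. (\<lambda>n. entry (X n) i j) \<longlonglongrightarrow> L i j" by metis
  have bound: "abs_summable_matrix (\<lambda>i j. L i j - entry (X n) i j)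
      \<and> matrix_l1_norm (\<lambda>i j. L i j - entry (X n) i j) \<le> e"
    if N: "\<And>m n. m \<ge> N \<Longrightarrow> n \<ge> N \<Longrightarrow> dist (X m) (X n) < e" and n: "n \<ge> N" for e N n
  proof -
    have "(\<Sum>(i, j)\<in>F. norm (L i j - entry (X n) i j)) \<le> e" if F: "finite F" for F
    proof (rule LIMSEQ_le_const2)
      show "(\<lambda>m. \<Sum>(i, j)\<in>F. norm (entry (X m) i j - entry (X n) i j))
          \<longlonglongrightarrow> (\<Sum>(i, j)\<in>F. norm (L i j - entry (X n) i j))"
        unfolding case_prod_unfold by (intro tendsto_intros L)
      have "(\<Sum>(i, j)\<in>F. norm (entry (X m) i j - entry (X n) i j)) \<le> e" if "m \<ge> N" for m
        using sum_le_matrix_l1_norm[OF abs_summable_entry[of "X m - X n"] F] N[OF that n]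
        by (simp add: dist_norm norm_upmat_eq)
      then show "\<exists>N. \<forall>m\<ge>N. (\<Sum>(i, j)\<in>F. norm (entry (X m) i j - entry (X n) i j)) \<le> e" by blast
    qed
    from abs_summable_matrix_bounded[OF this] show ?thesis by blast
  qed
  obtain N where "\<And>m n. m \<ge> N \<Longrightarrow> n \<ge> N \<Longrightarrow> dist (X m) (X n) < 1"
    using X unfolding Cauchy_def by (meson zero_less_one)
  with bound have "abs_summable_matrix (\<lambda>i j. L i j - entry (X N) i j)" by blast
  from abs_summable_matrix_add(1)[OF this abs_summable_entry[of "X N"]]
  have "abs_summable_matrix L" by simp
  moreover have "L i j = 0" if "j < i" for i j
    using L[of i j] that by (simp add: LIMSEQ_const_iff)
  ultimately have ent: "entry (Abs_upmat L) = L" by (simp add: entry_Abs_upmat)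
  have "X \<longlonglongrightarrow> Abs_upmat L"
    unfolding lim_sequentially
  proof (intro allI impI)
    fix e :: real assume "e > 0"
    then have "e / 2 > 0" by simp
    then obtain N where N: "\<And>m n. m \<ge> N \<Longrightarrow> n \<ge> N \<Longrightarrow> dist (X m) (X n) < e / 2"
      using X unfolding Cauchy_def by blast
    have "dist (X n) (Abs_upmat L) < e" if "n \<ge> N" for n
    proof -
      have "entry (Abs_upmat L - X n) = (\<lambda>i j. L i j - entry (X n) i j)"
        by (intro ext) (simp add: ent)
      then have "norm (Abs_upmat L - X n) = matrix_l1_norm (\<lambda>i j. L i j - entry (X n) i j)"
        by (simp add: norm_upmat_eq)
      also have "\<dots> \<le> e / 2" using bound[OF N that] by simp
      finally show ?thesis using \<open>e > 0\<close> by (simp add: dist_norm norm_minus_commute)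
    qed
    then show "\<exists>no. \<forall>n\<ge>no. dist (X n) (Abs_upmat L) < e" by blast
  qed
  then show "convergent X" by (rule convergentI)
qed

instantiation upmat :: (linorder, complex_banach_algebra) complex_banach_algebra
begin

lift_definition times_upmat :: "('a, 'b) upmat \<Rightarrow> ('a, 'b) upmat \<Rightarrow> ('a, 'b) upmat"
  is "\<lambda>M N i j. \<Sum>\<^sub>\<infinity>k. M i k * N k j"
proof safe
  fix M N :: "'a \<Rightarrow> 'a \<Rightarrow> 'b" and i j :: 'a
  assume M: "\<forall>i j. j < i \<longrightarrow> M i j = 0" "abs_summable_matrix M"
    and N: "\<forall>i j. j < i \<longrightarrow> N i j = 0" "abs_summable_matrix N"
  show "abs_summable_matrix (\<lambda>i j. \<Sum>\<^sub>\<infinity>k. M i k * N k j)"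
    by (rule matrix_mult_bound) fact+
  assume "j < i"
  then have "M i k * N k j = 0" for k
    using M(1) N(1) by (metis linorder_less_linear mult_zero_left mult_zero_right order.strict_trans)
  then show "(\<Sum>\<^sub>\<infinity>k. M i k * N k j) = 0" by simp
qed

instance
proof
  fix x y z :: "('a, 'b) upmat" and r :: real and c :: complex
  have entry_times: "entry (x * y) i j = (\<Sum>\<^sub>\<infinity>k. entry x i k * entry y k j)"
    for x y :: "('a, 'b) upmat" and i j
    by transfer simp
  have s: "(\<lambda>k. entry x i k * entry y k j) summable_on UNIV" for x y :: "('a, 'b) upmat" and i j
    by (rule matrix_mult_inner(2)[OF abs_summable_entry abs_summable_entry])
  show "x * y * z = x * (y * z)"
    by (rule upmat_eqI) (simp add: entry_times matrix_mult_assoc abs_summable_entry)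
  show "(x + y) * z = x * z + y * z"
    by (rule upmat_eqI) (simp add: entry_times distrib_right infsum_add s)
  show "x * (y + z) = x * y + x * z"
    by (rule upmat_eqI) (simp add: entry_times distrib_left infsum_add s)
  have scale: "(\<Sum>\<^sub>\<infinity>k. c *\<^sub>C (entry x i k * entry y k j)) = c *\<^sub>C (\<Sum>\<^sub>\<infinity>k. entry x i k * entry y k j)"
    for c and x y :: "('a, 'b) upmat" and i j
  proof -
    have "bounded_linear (\<lambda>v :: 'b. c *\<^sub>C v)"
      by (rule bounded_linear_intro[where K = "cmod c"])
         (auto simp: scaleC_add_right scaleR_scaleC scaleC_scaleC norm_scaleC mult.commute)
    from infsumI[OF has_sum_bounded_linear[OF this has_sum_infsum[OF s]]] show ?thesis .
  qed
  show L: "(c *\<^sub>C x) * y = c *\<^sub>C (x * y)" for c and x y :: "('a, 'b) upmat"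
    by (rule upmat_eqI) (simp add: entry_times scaleC_mult_left scale)
  show R: "x * (c *\<^sub>C y) = c *\<^sub>C (x * y)" for c and x y :: "('a, 'b) upmat"
    by (rule upmat_eqI) (simp add: entry_times scaleC_mult_right scale)
  show "(r *\<^sub>R x) * y = r *\<^sub>R (x * y)" by (simp add: scaleR_scaleC L)
  show "x * (r *\<^sub>R y) = r *\<^sub>R (x * y)" by (simp add: scaleR_scaleC R)
  show "norm (x * y) \<le> norm x * norm y"
    by transfer (blast intro: matrix_mult_bound)
qed

end

lemma entry_times: "entry (M * N) i j = (\<Sum>\<^sub>\<infinity>k. entry M i k * entry N k j)"
  by transfer simp


section \<open>Initial topologies\<close>

text \<open>The coarsest topology on \<open>X\<close> for which all functions in \<open>G\<close> are continuous.\<close>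

definition initial_topology :: "'x set \<Rightarrow> ('x \<Rightarrow> complex) set \<Rightarrow> 'x topology"
  where "initial_topology X G = topology_generated_by {{x \<in> X. g x \<in> U} | g U. g \<in> G \<and> open U}"

lemma topspace_initial_topology:
  assumes "G \<noteq> {}"
  shows "topspace (initial_topology X G) = X"
proof -
  from assms obtain g where "g \<in> G" by blast
  then have "X \<in> {{x \<in> X. g x \<in> U} | g U. g \<in> G \<and> open U}"
    by (intro CollectI exI[of _ g] exI[of _ UNIV]) auto
  then show ?thesis by (auto simp: initial_topology_def)
qed

lemma continuous_map_initial_topology:
  assumes "g \<in> G"
  shows "continuous_map (initial_topology X G) euclidean g"
proof -
  have top: "topspace (initial_topology X G) = X"
    using assms by (intro topspace_initial_topology) auto
  have "openin (initial_topology X G) {x \<in> X. g x \<in> U}" if "open U" for U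
    using assms that unfolding initial_topology_def
    by (intro topology_generated_by_Basis) blast
  then show ?thesis by (simp add: continuous_map_def top)
qed

lemma limitin_initial_topology:
  assumes "G \<noteq> {}"
  shows "limitin (initial_topology X G) f l F \<longleftrightarrow>
    l \<in> X \<and> (\<forall>\<^sub>F n in F. f n \<in> X) \<and> (\<forall>g\<in>G. ((\<lambda>n. g (f n)) \<longlongrightarrow> g l) F)"
proof (intro iffI conjI ballI)
  assume L: "limitin (initial_topology X G) f l F"
  show l: "l \<in> X" using limitin_topspace[OF L] topspace_initial_topology[OF assms] by simp
  show "\<forall>\<^sub>F n in F. f n \<in> X"
    using limitinD[OF L openin_topspace] l by (simp add: topspace_initial_topology[OF assms])
  fix g assume "g \<in> G"
  from continuous_map_limit[OF continuous_map_initial_topology[OF this] L]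
  show "((\<lambda>n. g (f n)) \<longlongrightarrow> g l) F" by (simp add: comp_def)
next
  assume A: "l \<in> X \<and> (\<forall>\<^sub>F n in F. f n \<in> X) \<and> (\<forall>g\<in>G. ((\<lambda>n. g (f n)) \<longlongrightarrow> g l) F)"
  let ?B = "{{x \<in> X. g x \<in> U} | g U. g \<in> G \<and> open U}"
  have ev: "\<forall>\<^sub>F n in F. f n \<in> U" if "generate_topology_on ?B U" "l \<in> U" for U
    using that
  proof (induction rule: generate_topology_on.induct)
    case (Basis W)
    then obtain g U where W: "W = {x \<in> X. g x \<in> U}" "g \<in> G" "open U" by blast
    then have "\<forall>\<^sub>F n in F. g (f n) \<in> U"
      using A Basis.prems by (auto intro: topological_tendstoD)
    moreover have "\<forall>\<^sub>F n in F. f n \<in> X" using A by blast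
    ultimately show ?case by eventually_elim (simp add: W)
  next
    case (UN K)
    then obtain k where k: "k \<in> K" "l \<in> k" by blast
    with UN.IH have "\<forall>\<^sub>F n in F. f n \<in> k" by blast
    then show ?case by eventually_elim (use k in blast)
  qed (auto intro: eventually_conj)
  show "limitin (initial_topology X G) f l F"
    unfolding limitin_def
    using A ev topspace_initial_topology[OF assms, of X]
    by (auto simp: initial_topology_def openin_topology_generated_by_iff)
qed

definition weak_topology :: "'e::complex_normed_vector topology"
  where "weak_topology = initial_topology UNIV (range cdual_apply)"


section \<open>Duals of subspaces and dual module actions\<close>

text \<open>For a subspace \<open>S\<close> of a normed space, \<open>S\<^sup>*\<close> is modelled by the functions on
  \<open>S\<close> (undefined elsewhere) that are linear and bounded on \<open>S\<close>.\<close>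

definition subspace_dual :: "'e::complex_normed_vector set \<Rightarrow> ('e \<Rightarrow> complex) set"
  where "subspace_dual S = {m \<in> extensional S.
    (\<forall>x\<in>S. \<forall>y\<in>S. m (x + y) = m x + m y) \<and> (\<forall>c. \<forall>x\<in>S. m (c *\<^sub>C x) = c * m x) \<and>
    (\<exists>K. \<forall>x\<in>S. cmod (m x) \<le> K * norm x)}"

definition subspace_dual_norm :: "'e::complex_normed_vector set \<Rightarrow> ('e \<Rightarrow> complex) \<Rightarrow> real"
  where "subspace_dual_norm S m = (SUP x\<in>{x \<in> S. norm x \<le> 1}. cmod (m x))"

definition weak_star_topology :: "'e::complex_normed_vector set \<Rightarrow> ('e \<Rightarrow> complex) topology"
  where "weak_star_topology S = initial_topology (subspace_dual S) ((\<lambda>x m. m x) ` S)"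

definition Cdual :: "('e::complex_normed_vector \<Rightarrow> complex) \<Rightarrow> 'e cdual"
  where "Cdual h = (THE f. cdual_apply f = h)"

lemma cdual_apply_Cdual:
  assumes "bounded_clinear h"
  shows "cdual_apply (Cdual h) = h"
proof -
  have "\<exists>!f. cdual_apply f = h"
    using ex_cdual[OF assms] by (metis cdual_eqI ext)
  then show ?thesis unfolding Cdual_def by (rule theI')
qed

text \<open>Module actions are passed around as functions \<open>l a x = a \<cdot> x\<close> and
  \<open>r x a = x \<cdot> a\<close>.  On the dual, \<open>(a \<cdot> f)(x) = f(x \<cdot> a)\<close> and \<open>(f \<cdot> a)(x) = f(a \<cdot> x)\<close>,
  so that each action on the dual comes from the opposite one on the space.\<close>

definition dual_lact :: "('e::complex_normed_vector \<Rightarrow> 'a \<Rightarrow> 'e) \<Rightarrow> 'a \<Rightarrow> 'e cdual \<Rightarrow> 'e cdual"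
  where "dual_lact r a f = Cdual (\<lambda>x. cdual_apply f (r x a))"

definition dual_ract :: "('a \<Rightarrow> 'e::complex_normed_vector \<Rightarrow> 'e) \<Rightarrow> 'e cdual \<Rightarrow> 'a \<Rightarrow> 'e cdual"
  where "dual_ract l f a = Cdual (\<lambda>x. cdual_apply f (l a x))"

definition subspace_dual_lact ::
    "'e set \<Rightarrow> ('e \<Rightarrow> 'a \<Rightarrow> 'e) \<Rightarrow> 'a \<Rightarrow> ('e \<Rightarrow> complex) \<Rightarrow> 'e \<Rightarrow> complex"
  where "subspace_dual_lact S r a m = (\<lambda>x\<in>S. m (r x a))"

definition subspace_dual_ract ::
    "'e set \<Rightarrow> ('a \<Rightarrow> 'e \<Rightarrow> 'e) \<Rightarrow> ('e \<Rightarrow> complex) \<Rightarrow> 'a \<Rightarrow> 'e \<Rightarrow> complex"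
  where "subspace_dual_ract S l m a = (\<lambda>x\<in>S. m (l a x))"


section \<open>Dual Banach algebras\<close>

text \<open>A dual Banach algebra is given by its predual \<open>P\<close>, a closed submodule of the dual
  bimodule of the algebra; \<open>\<A> = P\<^sup>*\<close> means that the canonical map
  \<open>a \<mapsto> (f \<mapsto> f(a))\<close> is an isometric bijection onto \<open>P\<^sup>*\<close>.\<close>

definition dual_banach_algebra :: "'a::complex_banach_algebra cdual set \<Rightarrow> bool"
  where "dual_banach_algebra P \<longleftrightarrow> csubspace P \<and> closed P \<and>
    (\<forall>a. \<forall>f\<in>P. dual_lact (*) a f \<in> P \<and> dual_ract (*) f a \<in> P) \<and>
    bij_betw (\<lambda>a. \<lambda>f\<in>P. cdual_apply f a) UNIV (subspace_dual P) \<and>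
    (\<forall>a. subspace_dual_norm P (\<lambda>f\<in>P. cdual_apply f a) = norm a)"

definition predual_topology :: "'a::complex_normed_vector cdual set \<Rightarrow> 'a topology"
  where "predual_topology P = initial_topology UNIV (cdual_apply ` P)"

definition wk_star_characters :: "'a::complex_banach_algebra cdual set \<Rightarrow> ('a \<Rightarrow> complex) set"
  where "wk_star_characters P = {\<phi>.
    (\<forall>x y. \<phi> (x + y) = \<phi> x + \<phi> y) \<and> (\<forall>c x. \<phi> (c *\<^sub>C x) = c * \<phi> x) \<and>
    (\<forall>x y. \<phi> (x * y) = \<phi> x * \<phi> y) \<and> (\<exists>x. \<phi> x \<noteq> 0) \<and>
    continuous_map (predual_topology P) euclidean \<phi>}"

text \<open>\<open>\<sigma>wc(E)\<close> for a bimodule \<open>E\<close> with actions \<open>l\<close> and \<open>r\<close>.\<close>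

definition sigma_wc :: "'a::complex_banach_algebra cdual set \<Rightarrow>
    ('a \<Rightarrow> 'e \<Rightarrow> 'e) \<Rightarrow> ('e \<Rightarrow> 'a \<Rightarrow> 'e) \<Rightarrow> 'e::{complex_normed_vector, banach} set"
  where "sigma_wc P l r = {x.
    continuous_map (predual_topology P) weak_topology (\<lambda>a. l a x) \<and>
    continuous_map (predual_topology P) weak_topology (\<lambda>a. r x a)}"


section \<open>Strong pseudo-Connes amenability\<close>

definition tensor_lact :: "'a::complex_banach_algebra \<Rightarrow> ('a, 'a) ptensor \<Rightarrow> ('a, 'a) ptensor"
  where "tensor_lact a = tensor_lift (\<lambda>b c. (a * b) \<otimes>\<^sub>p c)"

definition tensor_ract :: "('a, 'a) ptensor \<Rightarrow> 'a::complex_banach_algebra \<Rightarrow> ('a, 'a) ptensor"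
  where "tensor_ract u a = tensor_lift (\<lambda>b c. b \<otimes>\<^sub>p (c * a)) u"

definition tensor_mult :: "('a::complex_banach_algebra, 'a) ptensor \<Rightarrow> 'a"
  where "tensor_mult = tensor_lift (*)"

lemma tensor_lact:
  fixes a :: "'a::complex_banach_algebra"
  shows "bounded_clinear (tensor_lact a)" "tensor_lact a (b \<otimes>\<^sub>p c) = (a * b) \<otimes>\<^sub>p c"
proof -
  have 1: "bounded_bilinear ((\<otimes>\<^sub>p) :: 'a \<Rightarrow> 'a \<Rightarrow> _)"
    using bounded_cbilinear_tensor by (auto simp: bounded_cbilinear_def)
  have "bounded_cbilinear (\<lambda>b c :: 'a. (a * b) \<otimes>\<^sub>p c)"
    using bounded_cbilinear_tensor[where 'a = 'a and 'b = 'a]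
      bounded_bilinear.comp1[OF 1 bounded_linear_mult_right[of a]]
    by (auto simp: bounded_cbilinear_def scaleC_mult_right)
  then show "bounded_clinear (tensor_lact a)" "tensor_lact a (b \<otimes>\<^sub>p c) = (a * b) \<otimes>\<^sub>p c"
    unfolding tensor_lact_def by (simp_all add: tensor_lift)
qed

lemma tensor_ract:
  fixes a :: "'a::complex_banach_algebra"
  shows "bounded_clinear (\<lambda>u. tensor_ract u a)" "tensor_ract (b \<otimes>\<^sub>p c) a = b \<otimes>\<^sub>p (c * a)"
proof -
  have 1: "bounded_bilinear ((\<otimes>\<^sub>p) :: 'a \<Rightarrow> 'a \<Rightarrow> _)"
    using bounded_cbilinear_tensor by (auto simp: bounded_cbilinear_def)
  have "bounded_cbilinear (\<lambda>(b :: 'a) c. b \<otimes>\<^sub>p (c * a))"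
    using bounded_cbilinear_tensor[where 'a = 'a and 'b = 'a]
      bounded_bilinear.comp[OF 1 bounded_linear_ident bounded_linear_mult_left[of a]]
    by (auto simp: bounded_cbilinear_def scaleC_mult_left)
  then show "bounded_clinear (\<lambda>u. tensor_ract u a)" "tensor_ract (b \<otimes>\<^sub>p c) a = b \<otimes>\<^sub>p (c * a)"
    unfolding tensor_ract_def by (simp_all add: tensor_lift)
qed

lemma tensor_mult:
  shows "bounded_clinear (tensor_mult :: ('a::complex_banach_algebra, 'a) ptensor \<Rightarrow> 'a)"
    "tensor_mult (b \<otimes>\<^sub>p c) = b * (c :: 'a)"
proof -
  have "bounded_cbilinear ((*) :: 'a \<Rightarrow> 'a \<Rightarrow> 'a)"
    by (simp add: bounded_cbilinear_def bounded_bilinear_mult scaleC_mult_left scaleC_mult_right)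
  then show "bounded_clinear (tensor_mult :: ('a, 'a) ptensor \<Rightarrow> 'a)"
    "tensor_mult (b \<otimes>\<^sub>p c) = b * (c :: 'a)"
    unfolding tensor_mult_def by (simp_all add: tensor_lift)
qed

text \<open>The actions on \<open>(\<A> \<otimes>\<^sub>p \<A>)\<^sup>*\<close> and its submodule \<open>\<sigma>wc((\<A> \<otimes>\<^sub>p \<A>)\<^sup>*)\<close>.\<close>

definition tensor_dual_lact ::
    "'a::complex_banach_algebra \<Rightarrow> ('a, 'a) ptensor cdual \<Rightarrow> ('a, 'a) ptensor cdual"
  where "tensor_dual_lact = dual_lact tensor_ract"

definition tensor_dual_ract ::
    "('a, 'a) ptensor cdual \<Rightarrow> 'a::complex_banach_algebra \<Rightarrow> ('a, 'a) ptensor cdual"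
  where "tensor_dual_ract = dual_ract tensor_lact"

definition sigma_wc_tensor :: "'a::complex_banach_algebra cdual set \<Rightarrow> ('a, 'a) ptensor cdual set"
  where "sigma_wc_tensor P = sigma_wc P tensor_dual_lact tensor_dual_ract"

definition tensor_mult_adjoint :: "'a::complex_banach_algebra cdual \<Rightarrow> ('a, 'a) ptensor cdual"
  where "tensor_mult_adjoint f = Cdual (\<lambda>u. cdual_apply f (tensor_mult u))"

text \<open>The adjoint of \<open>\<pi>\<^sup>*\<close> restricted to the predual \<open>P\<close>; its value in \<open>P\<^sup>*\<close> is read as an element of \<open>\<A>\<close>.\<close>

definition pi_sigma_wc ::
    "'a::complex_banach_algebra cdual set \<Rightarrow> (('a, 'a) ptensor cdual \<Rightarrow> complex) \<Rightarrow> 'a"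
  where "pi_sigma_wc P m = (THE a. \<forall>f\<in>P. cdual_apply f a = m (tensor_mult_adjoint f))"

text \<open>The net \<open>(m\<^sub>\<alpha>)\<close> is represented by a proper filter \<open>F\<close> on the functionals.  A net gives
  the filter generated by its tails; conversely, the pairs \<open>(X, m)\<close> with \<open>m \<in> X\<close> and
  \<open>X\<close> in \<open>F\<close>, directed by reverse inclusion of the first components, index a net whose tails
  generate \<open>F\<close>, and passing to a tail turns \<open>eventually\<close> into \<open>for all \<alpha>\<close>.\<close>

definition strong_pseudo_Connes_amenable :: "'a::complex_banach_algebra cdual set \<Rightarrow> bool"
  where "strong_pseudo_Connes_amenable P \<longleftrightarrow>
    (let S = sigma_wc_tensor P; \<pi> = pi_sigma_wc P in
      \<exists>F :: (('a, 'a) ptensor cdual \<Rightarrow> complex) filter. F \<noteq> bot \<and>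
        (\<forall>\<^sub>F m in F. m \<in> subspace_dual S \<and> (\<forall>a. a * \<pi> m = \<pi> m * a)) \<and>
        (\<forall>a. limitin (weak_star_topology S)
            (\<lambda>m. \<lambda>f\<in>S. subspace_dual_lact S tensor_dual_ract a m f
              - subspace_dual_ract S tensor_dual_lact m a f) (\<lambda>f\<in>S. 0) F) \<and>
        (\<forall>a. limitin (predual_topology P) (\<lambda>m. a * \<pi> m) a F))"


section \<open>The predual of the upper triangular matrices\<close>

text \<open>The \<open>c\<^sub>0\<close>-direct sum of copies of \<open>P\<close> indexed by the pairs \<open>i \<le> j\<close>, identified with
  functionals through the entrywise pairing.\<close>

definition upmat_predual ::
    "'a::complex_banach_algebra cdual set \<Rightarrow> ('i::linorder, 'a) upmat cdual set"
  where "upmat_predual P = {g. \<exists>f :: 'i \<Rightarrow> 'i \<Rightarrow> 'a cdual.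
    (\<forall>i j. i \<le> j \<longrightarrow> f i j \<in> P) \<and>
    (\<forall>e>0. finite {(i, j). i \<le> j \<and> norm (f i j) \<ge> e}) \<and>
    (\<forall>M. cdual_apply g M = (\<Sum>\<^sub>\<infinity>(i, j)\<in>{(i, j). i \<le> j}. cdual_apply (f i j) (entry M i j)))}"

end

theory Submission
  imports Defs
begin

text \<open>
  Two facts about an arbitrary dual Banach algebra \<open>B\<close> with predual \<open>Q\<close> carry the theorem.

  The obstruction (\<open>not_strong_pseudo_Connes_amenable\<close>).  Suppose that \<open>Q\<close> contains a character
  \<open>\<omega>\<close> and a functional \<open>\<psi>\<close>, and that some \<open>e\<close> satisfies \<open>\<psi>(e x) = \<omega>(x)\<close> for all \<open>x\<close> and
  \<open>\<omega>(e) = 0\<close>.  Then \<open>B\<close> is not strong pseudo-Connes amenable.  Indeed, the functional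
  \<open>h(x \<otimes> y) = \<psi>(x) \<omega>(y)\<close> satisfies \<open>h \<cdot> e = \<omega> \<otimes> \<omega> = \<pi>\<^sup>*\<omega>\<close> and \<open>e \<cdot> h = \<omega>(e) h = 0\<close>, so
  along an amenability net \<open>\<omega>(\<pi>(m)) = m(\<pi>\<^sup>*\<omega>) = (e \<cdot> m - m \<cdot> e)(h)\<close> tends to \<open>0\<close>; on the other
  hand \<open>\<omega>(u) \<omega>(\<pi>(m)) = \<omega>(u \<pi>(m))\<close> tends to \<open>\<omega>(u)\<close> for every \<open>u\<close>, so \<open>\<omega>(\<pi>(m))\<close> tends to
  \<open>1\<close>.  In the upper triangular matrices with two indices \<open>i < j\<close> and a character \<open>\<phi>\<close> of
  \<open>\<A>\<close>, take \<open>\<omega>(M) = \<phi>(M\<^bsub>jj\<^esub>)\<close>, \<open>\<psi>(M) = \<phi>(M\<^bsub>ij\<^esub>)\<close>, and for \<open>e\<close> the matrix whose only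
  entry is a \<open>u\<close> with \<open>\<phi>(u) = 1\<close>, in position \<open>(i, j)\<close>.

  The transport principle (\<open>strong_pseudo_Connes_amenable_image\<close>).  Strong pseudo-Connes amenability
  passes along surjective bounded weak-star continuous homomorphisms: the net is pushed forward
  along the adjoint of the homomorphism tensored with itself.  Applied to \<open>M \<mapsto> M\<^bsub>ii\<^esub>\<close> it gives the
  amenability of \<open>\<A>\<close>; applied, when there is just one index, to the inverse of this map, it gives
  the converse implication.

  That \<open>h\<close> and \<open>\<pi>\<^sup>*\<omega>\<close> lie in the \<open>\<sigma>wc\<close>-part of the dual is a consequence of duality: by \<open>B = Q\<^sup>*\<close>
  every functional on the dual of \<open>B\<close> agrees on \<open>Q\<close> with the evaluation at a point of \<open>B\<close>, hence the
  orbit maps of elements of \<open>Q\<close> are weak-star to weak continuous (\<open>wk_star_continuous_orbit\<close>).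
  For the matrix algebra this uses that the \<open>c\<^sub>0\<close>-sum of copies of \<open>\<A>\<^sub>*\<close> really is a predual,
  which is \<open>dual_banach_algebra_upmat_predual\<close>.
\<close>

section \<open>Bounded complex-linear maps and their adjoints\<close>

lemma bounded_clinear_simps:
  assumes "bounded_clinear f"
  shows "f (x + y) = f x + f y" "f (x - y) = f x - f y" "f (- x) = - f x" "f 0 = 0"
    "f (c *\<^sub>C x) = c *\<^sub>C f x" "f (sum g A) = (\<Sum>i\<in>A. f (g i))"
proof -
  interpret bounded_linear f using assms by (rule bounded_clinearD)
  show "f (x + y) = f x + f y" "f (x - y) = f x - f y" "f (- x) = - f x" "f 0 = 0"
    "f (sum g A) = (\<Sum>i\<in>A. f (g i))"
    by (rule add diff neg zero sum)+
  show "f (c *\<^sub>C x) = c *\<^sub>C f x" using assms by (rule bounded_clinearD)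
qed

lemma bounded_clinear_compose:
  assumes "bounded_clinear f" "bounded_clinear g"
  shows "bounded_clinear (\<lambda>x. f (g x))"
  using assms by (auto simp: bounded_clinear_def intro: bounded_linear_compose)

lemma bounded_clinear_scaleC_right: "bounded_clinear (\<lambda>x::'a::complex_normed_vector. c *\<^sub>C x)"
  by (rule bounded_clinearI[where K = "cmod c"])
     (auto simp: scaleC_add_right scaleC_scaleC norm_scaleC mult.commute)

lemma bounded_clinear_mult_left:
  "bounded_clinear (\<lambda>x. x * a)" and bounded_clinear_mult_right: "bounded_clinear (\<lambda>x. a * x)"
  for a :: "'a::complex_banach_algebra"
  by (auto simp: bounded_clinear_def scaleC_mult_left scaleC_mult_right
      bounded_linear_mult_left bounded_linear_mult_right)

lemmas cdual_apply_linear [simp] = bounded_clinear_simps[OF cdual_apply_bounded_clinear, unfolded scaleC_complex_def]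

lemma cdual_apply_sum [simp]: "cdual_apply (sum g A) x = (\<Sum>i\<in>A. cdual_apply (g i) x)"
  by (induction A rule: infinite_finite_induct) auto

lemma norm_cdual_le:
  assumes "K \<ge> 0" "\<And>x. cmod (cdual_apply f x) \<le> K * norm x"
  shows "norm f \<le> K"
  unfolding norm_cdual_eq_onorm by (rule onorm_bound) (use assms in auto)

definition cdual_adjoint ::
    "('e::complex_normed_vector \<Rightarrow> 'f::complex_normed_vector) \<Rightarrow> 'f cdual \<Rightarrow> 'e cdual"
  where "cdual_adjoint T g = Cdual (\<lambda>x. cdual_apply g (T x))"

lemma cdual_adjoint_apply [simp]:
  assumes "bounded_clinear T"
  shows "cdual_apply (cdual_adjoint T g) x = cdual_apply g (T x)"
  unfolding cdual_adjoint_def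
  by (subst cdual_apply_Cdual) (auto intro: bounded_clinear_compose assms cdual_apply_bounded_clinear)

lemma bounded_clinear_adjoint:
  assumes "bounded_clinear T"
  shows "bounded_clinear (cdual_adjoint T)"
proof -
  obtain K where K: "K \<ge> 0" "\<And>x. norm (T x) \<le> norm x * K"
    using bounded_linear.nonneg_bounded[OF bounded_clinearD(1)[OF assms]] by blast
  show ?thesis
  proof (rule bounded_clinearI[where K = K])
    show "norm (cdual_adjoint T g) \<le> norm g * K" for g
    proof (rule norm_cdual_le)
      fix x
      have "cmod (cdual_apply g (T x)) \<le> norm g * norm (T x)" by (rule norm_cdual_apply)
      also have "\<dots> \<le> norm g * (norm x * K)" by (intro mult_left_mono K) auto
      finally show "cmod (cdual_apply (cdual_adjoint T g) x) \<le> norm g * K * norm x"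
        using assms by (simp add: mult_ac)
    qed (use K in auto)
  qed (auto intro!: cdual_eqI simp: assms)
qed

lemma dual_act_apply [simp]:
  fixes f :: "'a::complex_banach_algebra cdual"
  shows "cdual_apply (dual_lact (*) a f) x = cdual_apply f (x * a)"
    "cdual_apply (dual_ract (*) f a) x = cdual_apply f (a * x)"
  unfolding dual_lact_def dual_ract_def
  by (simp_all flip: cdual_adjoint_def add: bounded_clinear_mult_left bounded_clinear_mult_right)

lemma norm_dual_act_le:
  fixes f :: "'a::complex_banach_algebra cdual"
  shows "norm (dual_lact (*) a f) \<le> norm a * norm f" "norm (dual_ract (*) f a) \<le> norm a * norm f"
proof -
  have "cmod (cdual_apply f (x * y)) \<le> norm f * (norm x * norm y)" for x y
    using norm_cdual_apply[of f "x * y"] mult_left_mono[OF norm_mult_ineq[of x y] norm_ge_zero[of f]]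
    by linarith
  from this[of _ a] this[of a] show "norm (dual_lact (*) a f) \<le> norm a * norm f"
    "norm (dual_ract (*) f a) \<le> norm a * norm f"
    by (auto intro!: norm_cdual_le simp: mult_ac)
qed

lemma tensor_dual_act_apply [simp]:
  "cdual_apply (tensor_dual_lact a f) u = cdual_apply f (tensor_ract u a)"
  "cdual_apply (tensor_dual_ract f a) u = cdual_apply f (tensor_lact a u)"
  unfolding tensor_dual_lact_def tensor_dual_ract_def dual_lact_def dual_ract_def
  by (simp_all flip: cdual_adjoint_def add: tensor_lact tensor_ract)

lemma tensor_dual_act_adjoint:
  "tensor_dual_lact a f = cdual_adjoint (\<lambda>u. tensor_ract u a) f"
  "tensor_dual_ract f a = cdual_adjoint (tensor_lact a) f"
  by (auto intro!: cdual_eqI simp: tensor_lact tensor_ract)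

lemma tensor_mult_adjoint_apply [simp]:
  "cdual_apply (tensor_mult_adjoint f) u = cdual_apply f (tensor_mult u)"
  unfolding tensor_mult_adjoint_def by (simp flip: cdual_adjoint_def add: tensor_mult)

lemma tensor_mult_adjoint_eq: "tensor_mult_adjoint = cdual_adjoint tensor_mult"
  by (auto intro!: cdual_eqI ext simp: tensor_mult)

lemma bounded_cbilinear_compose:
  assumes "bounded_cbilinear B" "bounded_clinear f" "bounded_clinear g"
  shows "bounded_cbilinear (\<lambda>x y. B (f x) (g y))"
proof -
  interpret bounded_bilinear B using assms(1) by (simp add: bounded_cbilinear_def)
  have "bounded_bilinear (\<lambda>x y. B (f x) (g y))"
    by (rule comp) (use assms in \<open>auto simp: bounded_clinear_def\<close>)
  with assms show ?thesis by (simp add: bounded_cbilinear_def bounded_clinear_simps)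
qed

lemma bounded_clinear_compose_bilinear:
  assumes f: "bounded_clinear f" and B: "bounded_cbilinear B"
  shows "bounded_cbilinear (\<lambda>x y. f (B x y))"
proof -
  interpret f: bounded_linear f using f by (rule bounded_clinearD)
  interpret B: bounded_bilinear B using B by (simp add: bounded_cbilinear_def)
  obtain K where K: "K \<ge> 0" "\<And>x. norm (f x) \<le> norm x * K" using f.nonneg_bounded by blast
  obtain L where L: "\<And>x y. norm (B x y) \<le> norm x * norm y * L" using B.nonneg_bounded by blast
  have "norm (f (B x y)) \<le> norm x * norm y * (L * K)" for x y
  proof -
    have "norm (f (B x y)) \<le> norm (B x y) * K" by (rule K)
    also have "\<dots> \<le> norm x * norm y * L * K" by (intro mult_right_mono K L)
    finally show ?thesis by (simp add: mult_ac)
  qed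
  then have "bounded_bilinear (\<lambda>x y. f (B x y))"
    by (intro bounded_bilinear.intro)
       (auto simp: B.add_left B.add_right B.scaleR_left B.scaleR_right f.add f.scaleR)
  with B show ?thesis by (simp add: bounded_cbilinear_def bounded_clinear_simps[OF f])
qed

text \<open>Elementary tensors determine a bounded linear map; identities between maps on the
  projective tensor product are checked on them throughout.\<close>

lemma tensor_ext:
  fixes L :: "('a::complex_normed_vector, 'b::complex_normed_vector) ptensor
    \<Rightarrow> 'c::{complex_normed_vector, banach}"
  assumes L: "bounded_clinear L" and M: "bounded_clinear M"
    and eq: "\<And>a b. L (a \<otimes>\<^sub>p b) = M (a \<otimes>\<^sub>p b)"
  shows "L u = M u"
  using tensor_universal[OF bounded_clinear_compose_bilinear[OF L bounded_cbilinear_tensor]] L M eq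
  by metis

lemma tensor_act_assoc:
  fixes a b :: "'a::complex_banach_algebra"
  shows "tensor_lact a (tensor_lact b u) = tensor_lact (a * b) u" (is "?L1 = ?R1")
    and "tensor_ract (tensor_ract u a) b = tensor_ract u (a * b)" (is "?L2 = ?R2")
    and "tensor_ract (tensor_lact a u) b = tensor_lact a (tensor_ract u b)" (is "?L3 = ?R3")
proof -
  note lact = tensor_lact(1) bounded_clinear_compose[OF tensor_lact(1)]
  note ract = tensor_ract(1) bounded_clinear_compose[OF tensor_ract(1)]
  note simps = tensor_lact(2) tensor_ract(2) mult.assoc
  show "?L1 = ?R1"
    by (rule tensor_ext[OF lact(2)[OF lact(1)] lact(1), of a b "a * b"]) (simp add: simps)
  show "?L2 = ?R2"
    by (rule tensor_ext[OF ract(2)[OF ract(1)] ract(1), of a b "a * b"]) (simp add: simps)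
  show "?L3 = ?R3"
    by (rule tensor_ext[where L = "\<lambda>u. tensor_ract (tensor_lact a u) b"
          and M = "\<lambda>u. tensor_lact a (tensor_ract u b)", OF ract(2)[OF lact(1)] lact(2)[OF ract(1)]])
       (simp add: simps)
qed

lemma tensor_mult_act:
  fixes a :: "'a::complex_banach_algebra"
  shows "tensor_mult (tensor_lact a u) = a * tensor_mult u"
    "tensor_mult (tensor_ract u a) = tensor_mult u * a"
proof -
  show "tensor_mult (tensor_lact a u) = a * tensor_mult u"
    by (rule tensor_ext[of "\<lambda>u. tensor_mult (tensor_lact a u)" "\<lambda>u. a * tensor_mult u"])
       (auto intro!: bounded_clinear_compose[of tensor_mult] bounded_clinear_compose[of "\<lambda>x. a * x"]
         bounded_clinear_mult_right tensor_lact tensor_mult simp: tensor_lact(2) tensor_mult(2) mult.assoc)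
  show "tensor_mult (tensor_ract u a) = tensor_mult u * a"
    by (rule tensor_ext[of "\<lambda>u. tensor_mult (tensor_ract u a)" "\<lambda>u. tensor_mult u * a"])
       (auto intro!: bounded_clinear_compose[of tensor_mult] bounded_clinear_compose[of "\<lambda>x. x * a"]
         bounded_clinear_mult_left tensor_ract tensor_mult simp: tensor_ract(2) tensor_mult(2) mult.assoc)
qed

section \<open>Weak-star continuity\<close>

lemma continuous_map_into_initial_topology:
  assumes "G \<noteq> {}"
  shows "continuous_map T (initial_topology X G) h \<longleftrightarrow>
    h \<in> topspace T \<rightarrow> X \<and> (\<forall>g\<in>G. continuous_map T euclidean (\<lambda>x. g (h x)))"
proof (intro iffI conjI ballI)
  assume h: "continuous_map T (initial_topology X G) h"
  show "h \<in> topspace T \<rightarrow> X"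
    using h unfolding continuous_map_def topspace_initial_topology[OF assms] by blast
  show "continuous_map T euclidean (\<lambda>x. g (h x))" if "g \<in> G" for g
    using continuous_map_compose[OF h continuous_map_initial_topology[OF that]]
    by (simp add: comp_def)
next
  assume A: "h \<in> topspace T \<rightarrow> X \<and> (\<forall>g\<in>G. continuous_map T euclidean (\<lambda>x. g (h x)))"
  show "continuous_map T (initial_topology X G) h"
    unfolding initial_topology_def
  proof (rule continuous_on_generated_topo)
    fix W assume "W \<in> {{x \<in> X. g x \<in> U} | g U. g \<in> G \<and> open U}"
    then obtain g U where W: "W = {x \<in> X. g x \<in> U}" "g \<in> G" "open U" by blast
    have "h -` W \<inter> topspace T = {x \<in> topspace T. g (h x) \<in> U}"
      using A W(1) by auto
    with A W(2,3) show "openin T (h -` W \<inter> topspace T)"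
      by (simp add: continuous_map_def)
  next
    obtain g where "g \<in> G" using assms by blast
    then have "X \<in> {{x \<in> X. g x \<in> U} | g U. g \<in> G \<and> open U}"
      by (intro CollectI exI[of _ g] exI[of _ UNIV]) auto
    with A show "h ` topspace T \<subseteq> \<Union> {{x \<in> X. g x \<in> U} | g U. g \<in> G \<and> open U}" by blast
  qed
qed

abbreviation wk_star_continuous ::
    "'a::complex_normed_vector cdual set \<Rightarrow> ('a \<Rightarrow> complex) \<Rightarrow> bool"
  where "wk_star_continuous P h \<equiv> continuous_map (predual_topology P) euclidean h"

lemma wk_star_continuous_predual: "f \<in> P \<Longrightarrow> wk_star_continuous P (cdual_apply f)"
  unfolding predual_topology_def by (intro continuous_map_initial_topology) simp

lemma wk_star_continuous_compose:
  assumes "P \<noteq> {}" "Q \<noteq> {}" "wk_star_continuous Q h"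
    and "\<And>g. g \<in> Q \<Longrightarrow> \<exists>f\<in>P. \<forall>x. cdual_apply f x = cdual_apply g (T x)"
  shows "wk_star_continuous P (\<lambda>x. h (T x))"
proof -
  have "continuous_map (predual_topology P) (predual_topology Q) T"
    unfolding predual_topology_def[of Q]
  proof (subst continuous_map_into_initial_topology, safe)
    fix g assume "g \<in> Q"
    with assms(4) obtain f where "f \<in> P" "cdual_apply f = (\<lambda>x. cdual_apply g (T x))"
      by fastforce
    then show "wk_star_continuous P (\<lambda>x. cdual_apply g (T x))"
      using wk_star_continuous_predual by metis
  qed (use assms in auto)
  from continuous_map_compose[OF this assms(3)] show ?thesis by (simp add: comp_def)
qed

lemma sigma_wc_iff:
  "x \<in> sigma_wc P l r \<longleftrightarrow> (\<forall>\<Lambda>. wk_star_continuous P (\<lambda>a. cdual_apply \<Lambda> (l a x)) \<and>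
    wk_star_continuous P (\<lambda>a. cdual_apply \<Lambda> (r x a)))"
  by (auto simp: sigma_wc_def weak_topology_def continuous_map_into_initial_topology)

text \<open>A functional that vanishes on the common kernel of finitely many functionals is a linear
  combination of them.  The induction removes one functional \<open>g\<close> of the family: if \<open>g\<close> does not
  already vanish on the common kernel of the others, a point \<open>y\<close> of that kernel with
  \<open>g(y) \<noteq> 0\<close> fixes the multiple of \<open>g\<close> to be subtracted from \<open>\<phi>\<close>.\<close>

lemma linear_functional_in_span:
  fixes P :: "'a::complex_normed_vector cdual set"
  assumes "csubspace P" "finite F" "F \<subseteq> P"
    and "\<And>x y. \<phi> (x + y) = \<phi> x + \<phi> y" "\<And>c x. \<phi> (c *\<^sub>C x) = c * \<phi> x"
    and "\<And>x. (\<And>f. f \<in> F \<Longrightarrow> cdual_apply f x = 0) \<Longrightarrow> \<phi> x = 0"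
  shows "\<exists>f\<in>P. \<forall>x. cdual_apply f x = \<phi> x"
  using assms(2-)
proof (induction F arbitrary: \<phi> rule: finite_induct)
  case empty
  then show ?case using assms(1) by (intro bexI[of _ 0]) (auto simp: csubspace_def)
next
  case (insert g F)
  show ?case
  proof (cases "\<exists>y. (\<forall>f\<in>F. cdual_apply f y = 0) \<and> cdual_apply g y \<noteq> 0")
    case False
    then show ?thesis by (intro insert.IH) (use insert.prems in \<open>simp_all, metis\<close>)
  next
    case True
    then obtain y where y: "\<And>f. f \<in> F \<Longrightarrow> cdual_apply f y = 0" "cdual_apply g y \<noteq> 0" by blast
    define c where "c = \<phi> y / cdual_apply g y"
    have "\<exists>f\<in>P. \<forall>x. cdual_apply f x = \<phi> x - c * cdual_apply g x"
    proof (rule insert.IH)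
      fix x assume x: "\<And>f. f \<in> F \<Longrightarrow> cdual_apply f x = 0"
      let ?t = "- (cdual_apply g x / cdual_apply g y)"
      have "\<phi> (x + ?t *\<^sub>C y) = 0"
        by (rule insert.prems) (use x y in auto)
      then show "\<phi> x - c * cdual_apply g x = 0"
        unfolding insert.prems(2,3) by (simp add: c_def)
    qed (use insert.prems in \<open>auto simp: algebra_simps\<close>)
    then obtain f where f: "f \<in> P" "\<And>x. cdual_apply f x = \<phi> x - c * cdual_apply g x" by blast
    have "f + c *\<^sub>C g \<in> P"
      using assms(1) f(1) insert.prems(1) by (simp add: csubspace_def)
    then show ?thesis by (rule bexI[rotated]) (simp add: f)
  qed
qed

text \<open>The dual of \<open>\<sigma>(\<A>, P)\<close> is \<open>P\<close>: the preimage of the unit disc contains a basic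
  neighbourhood of \<open>0\<close>, in particular the common kernel of a finite subset of \<open>P\<close>; being a
  subspace on which the functional is bounded by \<open>1\<close>, this kernel is mapped to \<open>0\<close>.\<close>

lemma wk_star_continuous_linear_in_predual:
  fixes P :: "'a::complex_normed_vector cdual set"
  assumes P: "csubspace P" and add: "\<And>x y. \<phi> (x + y) = \<phi> x + \<phi> y"
    and scale: "\<And>c x. \<phi> (c *\<^sub>C x) = c * \<phi> x" and cont: "wk_star_continuous P \<phi>"
  shows "\<exists>f\<in>P. \<forall>x. cdual_apply f x = \<phi> x"
proof -
  let ?B = "{{x \<in> UNIV. g x \<in> U} | g U. g \<in> cdual_apply ` P \<and> open U}"
  \<comment> \<open>A neighbourhood in \<open>\<sigma>(\<A>, P)\<close> contains a whole common level set of finitely many functionals.\<close>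
  have nhd: "\<exists>F. finite F \<and> F \<subseteq> P \<and> (\<forall>y. (\<forall>f\<in>F. cdual_apply f y = cdual_apply f x) \<longrightarrow> y \<in> U)"
    if "generate_topology_on ?B U" "x \<in> U" for U x
    using that
  proof (induction arbitrary: x rule: generate_topology_on.induct)
    case (Int U V)
    obtain F where F: "finite F" "F \<subseteq> P" "\<forall>y. (\<forall>f\<in>F. cdual_apply f y = cdual_apply f x) \<longrightarrow> y \<in> U"
      using Int.IH(1)[of x] Int.prems by blast
    obtain G where G: "finite G" "G \<subseteq> P" "\<forall>y. (\<forall>f\<in>G. cdual_apply f y = cdual_apply f x) \<longrightarrow> y \<in> V"
      using Int.IH(2)[of x] Int.prems by blast
    show ?case by (rule exI[of _ "F \<union> G"]) (use F G in auto)
  next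
    case (UN K)
    then obtain k where "k \<in> K" "x \<in> k" by blast
    then show ?case using UN.IH[of k x] by blast
  next
    case (Basis W)
    then obtain f U where "W = {x. cdual_apply f x \<in> U}" "f \<in> P" by blast
    then show ?case using Basis.prems by (intro exI[of _ "{f}"]) auto
  qed simp
  have ne: "cdual_apply ` P \<noteq> {}" using P by (auto simp: csubspace_def)
  have "openin (predual_topology P) {x \<in> topspace (predual_topology P). \<phi> x \<in> ball 0 1}"
    using cont unfolding continuous_map_def by (metis open_ball open_openin)
  then have "generate_topology_on ?B {x. \<phi> x \<in> ball 0 1}"
    unfolding predual_topology_def topspace_initial_topology[OF ne]
    by (simp add: initial_topology_def openin_topology_generated_by_iff)
  from nhd[OF this, of 0] obtain F where F: "finite F" "F \<subseteq> P"
    and small: "\<And>y. (\<And>f. f \<in> F \<Longrightarrow> cdual_apply f y = 0) \<Longrightarrow> cmod (\<phi> y) < 1"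
    using scale[of 0 0] by auto
  show ?thesis
  proof (rule linear_functional_in_span[OF P F add scale])
    fix x assume x: "\<And>f. f \<in> F \<Longrightarrow> cdual_apply f x = 0"
    show "\<phi> x = 0"
    proof (rule ccontr)
      assume nz: "\<phi> x \<noteq> 0"
      have "cmod (\<phi> ((1 / \<phi> x) *\<^sub>C x)) < 1" by (rule small) (simp add: x)
      with nz show False by (simp add: scale)
    qed
  qed
qed

section \<open>Dual Banach algebras\<close>

context
  fixes P :: "'a::complex_banach_algebra cdual set"
  assumes P: "dual_banach_algebra P"
begin

lemma predual_csubspace: "csubspace P"
  and predual_closed: "closed P"
  and predual_act: "f \<in> P \<Longrightarrow> dual_lact (*) a f \<in> P" "f \<in> P \<Longrightarrow> dual_ract (*) f a \<in> P"
  using P by (auto simp: dual_banach_algebra_def)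

lemma predual_nonempty: "P \<noteq> {}"
  using predual_csubspace by (auto simp: csubspace_def)

lemma predual_separates:
  assumes "\<And>f. f \<in> P \<Longrightarrow> cdual_apply f a = cdual_apply f b"
  shows "a = b"
proof -
  have "inj (\<lambda>a. \<lambda>f\<in>P. cdual_apply f a)"
    using P by (auto simp: dual_banach_algebra_def bij_betw_def)
  moreover have "(\<lambda>f\<in>P. cdual_apply f a) = (\<lambda>f\<in>P. cdual_apply f b)"
    using assms by auto
  ultimately show ?thesis by (rule injD)
qed

lemma predual_representation:
  assumes "\<And>f g. f \<in> P \<Longrightarrow> g \<in> P \<Longrightarrow> m (f + g) = m f + m g"
    and "\<And>c f. f \<in> P \<Longrightarrow> m (c *\<^sub>C f) = c * m f"
    and "\<And>f. f \<in> P \<Longrightarrow> cmod (m f) \<le> K * norm f"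
  obtains a where "\<And>f. f \<in> P \<Longrightarrow> cdual_apply f a = m f"
proof -
  have "restrict m P \<in> subspace_dual P"
    unfolding subspace_dual_def
    by (intro CollectI conjI exI[of _ K])
       (use predual_csubspace assms in \<open>auto simp: csubspace_def\<close>)
  also have "\<dots> = range (\<lambda>a. \<lambda>f\<in>P. cdual_apply f a)"
    using P by (auto simp: dual_banach_algebra_def bij_betw_def)
  finally obtain a where "restrict m P = (\<lambda>f\<in>P. cdual_apply f a)" by blast
  then have "cdual_apply f a = m f" if "f \<in> P" for f
    using that by (metis restrict_apply')
  with that show ?thesis by blast
qed

text \<open>The canonical map of \<open>\<A>\<close> to the dual of \<open>P\<close> is isometric, so norms are almost attained on
  the unit ball of \<open>P\<close>; a rotation makes the value real.\<close>

lemma predual_norming: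
  assumes "e > 0"
  obtains f r where "f \<in> P" "norm f \<le> 1" "cdual_apply f a = complex_of_real r" "norm a - e < r"
proof -
  let ?S = "{f \<in> P. norm f \<le> 1}"
  have 0: "0 \<in> ?S" using predual_csubspace by (simp add: csubspace_def)
  have "norm a = (SUP f\<in>?S. cmod ((\<lambda>f\<in>P. cdual_apply f a) f))"
    using P by (simp add: dual_banach_algebra_def subspace_dual_norm_def)
  then have "norm a - e < (SUP f\<in>?S. cmod ((\<lambda>f\<in>P. cdual_apply f a) f))"
    using assms by linarith
  then obtain f where f: "f \<in> ?S" "norm a - e < cmod ((\<lambda>f\<in>P. cdual_apply f a) f)"
    using 0 by (subst (asm) less_cSUP_iff)
      (auto intro!: bdd_aboveI[of _ "norm a"] order_trans[OF norm_cdual_apply] mult_left_le_one_le)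
  let ?z = "cdual_apply f a"
  define c where "c = (if ?z = 0 then 1 else cnj ?z / of_real (cmod ?z))"
  have "cnj ?z * ?z = of_real (cmod ?z) * of_real (cmod ?z)"
    using complex_norm_square[of ?z] by (simp only: power2_eq_square mult.commute of_real_mult)
  then have c: "cmod c = 1" "c * ?z = of_real (cmod ?z)"
    unfolding c_def by (auto simp: norm_divide)
  show ?thesis
  proof (rule that)
    show "c *\<^sub>C f \<in> P" using f predual_csubspace by (auto simp: csubspace_def)
    show "norm (c *\<^sub>C f) \<le> 1" using f by (simp add: norm_scaleC c)
    show "cdual_apply (c *\<^sub>C f) a = of_real (cmod ?z)" by (simp add: c)
    show "norm a - e < cmod ?z" using f by simp
  qed
qed

text \<open>Restricted to \<open>P\<close>, an element of the bidual of \<open>\<A>\<close> becomes a point of \<open>\<A> = P\<^sup>*\<close>.\<close>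

lemma bidual_restricts_to_point:
  fixes \<Lambda> :: "'a cdual cdual"
  obtains x where "\<And>f. f \<in> P \<Longrightarrow> cdual_apply \<Lambda> f = cdual_apply f x"
proof (rule predual_representation[of "cdual_apply \<Lambda>" "norm \<Lambda>"])
  fix a assume "\<And>f. f \<in> P \<Longrightarrow> cdual_apply f a = cdual_apply \<Lambda> f"
  then show thesis by (intro that[of a]) simp
qed (auto simp: norm_cdual_apply)

text \<open>If \<open>x\<close> represents \<open>\<Lambda>\<close> on \<open>P\<close>, then \<open>\<Lambda>(a \<cdot> f) = (f \<cdot> x)(a)\<close> because \<open>a \<cdot> f\<close> stays in \<open>P\<close>,
  and \<open>f \<cdot> x\<close> again belongs to \<open>P\<close>.  So elements of \<open>P\<close> have weak-star to weak continuous orbit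
  maps in the full dual bimodule.\<close>

lemma wk_star_continuous_orbit:
  assumes "f \<in> P"
  shows "wk_star_continuous P (\<lambda>a. cdual_apply \<Lambda> (dual_lact (*) a f))"
    "wk_star_continuous P (\<lambda>a. cdual_apply \<Lambda> (dual_ract (*) f a))"
proof -
  obtain x where x: "\<And>f. f \<in> P \<Longrightarrow> cdual_apply \<Lambda> f = cdual_apply f x"
    using bidual_restricts_to_point[of \<Lambda>] by metis
  have "(\<lambda>a. cdual_apply \<Lambda> (dual_lact (*) a f)) = cdual_apply (dual_ract (*) f x)"
    "(\<lambda>a. cdual_apply \<Lambda> (dual_ract (*) f a)) = cdual_apply (dual_lact (*) x f)"
    by (auto simp: x predual_act assms)
  then show "wk_star_continuous P (\<lambda>a. cdual_apply \<Lambda> (dual_lact (*) a f))"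
    "wk_star_continuous P (\<lambda>a. cdual_apply \<Lambda> (dual_ract (*) f a))"
    by (auto intro!: wk_star_continuous_predual predual_act assms)
qed

text \<open>Since \<open>\<pi>\<close> is a bimodule map, the orbit of \<open>\<pi>\<^sup>*f\<close> is the image under \<open>\<pi>\<^sup>*\<close> of the orbit of
  \<open>f\<close>, and \<open>\<pi>\<^sup>*\<close> is weakly continuous.\<close>

lemma tensor_mult_adjoint_in_sigma_wc:
  assumes "f \<in> P"
  shows "tensor_mult_adjoint f \<in> sigma_wc_tensor P"
  unfolding sigma_wc_tensor_def sigma_wc_iff
proof (intro allI conjI)
  fix \<Lambda> :: "('a, 'a) ptensor cdual cdual"
  let ?\<Lambda> = "cdual_adjoint tensor_mult_adjoint \<Lambda>"
  have "bounded_clinear (tensor_mult_adjoint :: 'a cdual \<Rightarrow> _)"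
    unfolding tensor_mult_adjoint_eq by (intro bounded_clinear_adjoint tensor_mult)
  then have [simp]: "cdual_apply ?\<Lambda> h = cdual_apply \<Lambda> (tensor_mult_adjoint h)" for h
    by simp
  have "tensor_dual_lact a (tensor_mult_adjoint f) = tensor_mult_adjoint (dual_lact (*) a f)"
    "tensor_dual_ract (tensor_mult_adjoint f) a = tensor_mult_adjoint (dual_ract (*) f a)" for a
    by (auto intro!: cdual_eqI simp: tensor_mult_act)
  then show "wk_star_continuous P (\<lambda>a. cdual_apply \<Lambda> (tensor_dual_lact a (tensor_mult_adjoint f)))"
    "wk_star_continuous P (\<lambda>a. cdual_apply \<Lambda> (tensor_dual_ract (tensor_mult_adjoint f) a))"
    using wk_star_continuous_orbit[OF assms, of ?\<Lambda>] by simp_all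
qed

text \<open>Composing the orbit maps of \<open>h\<close> with multiplication by \<open>b\<close> on the algebra side preserves
  weak-star continuity because \<open>P\<close> is a submodule; on the module side, the action of \<open>b\<close> is
  bounded and hence weakly continuous.\<close>

lemma sigma_wc_tensor_act:
  assumes "h \<in> sigma_wc_tensor P"
  shows "tensor_dual_lact b h \<in> sigma_wc_tensor P" "tensor_dual_ract h b \<in> sigma_wc_tensor P"
proof -
  have h: "wk_star_continuous P (\<lambda>a. cdual_apply \<Lambda> (tensor_dual_lact a h))"
    "wk_star_continuous P (\<lambda>a. cdual_apply \<Lambda> (tensor_dual_ract h a))" for \<Lambda>
    using assms by (auto simp: sigma_wc_tensor_def sigma_wc_iff)
  have assoc: "tensor_dual_lact a (tensor_dual_lact c h) = tensor_dual_lact (a * c) h"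
    "tensor_dual_ract (tensor_dual_ract h c) a = tensor_dual_ract h (c * a)"
    "tensor_dual_ract (tensor_dual_lact c h) a = tensor_dual_lact c (tensor_dual_ract h a)"
    "tensor_dual_lact a (tensor_dual_ract h c) = tensor_dual_ract (tensor_dual_lact a h) c" for a c
    by (auto intro!: cdual_eqI simp: tensor_act_assoc)
  have adj: "bounded_clinear (tensor_dual_lact b)" "bounded_clinear (\<lambda>h. tensor_dual_ract h b)"
    unfolding tensor_dual_act_adjoint by (intro bounded_clinear_adjoint tensor_lact tensor_ract)+
  show "tensor_dual_lact b h \<in> sigma_wc_tensor P"
    unfolding sigma_wc_tensor_def sigma_wc_iff assoc(1,3)
  proof (intro allI conjI)
    fix \<Lambda>
    show "wk_star_continuous P (\<lambda>a. cdual_apply \<Lambda> (tensor_dual_lact (a * b) h))"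
      by (rule wk_star_continuous_compose[OF predual_nonempty predual_nonempty h(1)])
         (auto intro!: bexI[OF _ predual_act(1)])
    show "wk_star_continuous P (\<lambda>a. cdual_apply \<Lambda> (tensor_dual_lact b (tensor_dual_ract h a)))"
      using h(2)[of "cdual_adjoint (tensor_dual_lact b) \<Lambda>"] by (simp add: adj)
  qed
  show "tensor_dual_ract h b \<in> sigma_wc_tensor P"
    unfolding sigma_wc_tensor_def sigma_wc_iff assoc(2,4)
  proof (intro allI conjI)
    fix \<Lambda>
    show "wk_star_continuous P (\<lambda>a. cdual_apply \<Lambda> (tensor_dual_ract h (b * a)))"
      by (rule wk_star_continuous_compose[OF predual_nonempty predual_nonempty h(2)])
         (auto intro!: bexI[OF _ predual_act(2)])
    show "wk_star_continuous P (\<lambda>a. cdual_apply \<Lambda> (tensor_dual_ract (tensor_dual_lact a h) b))"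
      using h(1)[of "cdual_adjoint (\<lambda>h. tensor_dual_ract h b) \<Lambda>"] by (simp add: adj)
  qed
qed

lemma pi_sigma_wc_unique:
  assumes "\<And>f. f \<in> P \<Longrightarrow> cdual_apply f a = m (tensor_mult_adjoint f)"
  shows "pi_sigma_wc P m = a"
  unfolding pi_sigma_wc_def
  by (rule the_equality) (auto intro: predual_separates simp: assms)

text \<open>The functional \<open>f \<mapsto> m(\<pi>\<^sup>*f)\<close> on \<open>P\<close> is bounded, hence given by a point of \<open>\<A>\<close>; thus the
  description that defines \<open>\<pi>\<^bsub>\<sigma>wc\<^esub>(m)\<close> is satisfied.\<close>

lemma cdual_apply_pi_sigma_wc:
  assumes m: "m \<in> subspace_dual (sigma_wc_tensor P)" and f: "f \<in> P"
  shows "cdual_apply f (pi_sigma_wc P m) = m (tensor_mult_adjoint f)"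
proof -
  let ?adj = "tensor_mult_adjoint :: 'a cdual \<Rightarrow> _"
  have adj: "bounded_clinear ?adj"
    unfolding tensor_mult_adjoint_eq by (intro bounded_clinear_adjoint tensor_mult)
  obtain L where L: "\<And>f. norm (?adj f) \<le> norm f * L"
    using bounded_linear.bounded[OF bounded_clinearD(1)[OF adj]] by blast
  obtain K where K: "\<And>h. h \<in> sigma_wc_tensor P \<Longrightarrow> cmod (m h) \<le> K * norm h"
    using m unfolding subspace_dual_def by blast
  note mem = tensor_mult_adjoint_in_sigma_wc
  have bound: "cmod (m (?adj f)) \<le> (\<bar>K\<bar> * L) * norm f" if "f \<in> P" for f
  proof -
    have "cmod (m (?adj f)) \<le> K * norm (?adj f)" by (rule K[OF mem[OF that]])
    also have "\<dots> \<le> \<bar>K\<bar> * norm (?adj f)" by (intro mult_right_mono) auto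
    also have "\<dots> \<le> \<bar>K\<bar> * (norm f * L)" by (intro mult_left_mono L) auto
    finally show ?thesis by (simp add: mult_ac)
  qed
  obtain a where a: "\<And>f. f \<in> P \<Longrightarrow> cdual_apply f a = m (?adj f)"
    by (rule predual_representation[of "\<lambda>f. m (?adj f)", OF _ _ bound])
       (use m in \<open>auto simp: subspace_dual_def bounded_clinear_simps[OF adj] mem\<close>)
  show ?thesis using pi_sigma_wc_unique[of a m] a f by simp
qed

lemma csubspace_sigma_wc_tensor: "csubspace (sigma_wc_tensor P)"
proof -
  have adj: "bounded_clinear (tensor_dual_lact a)" "bounded_clinear (\<lambda>h. tensor_dual_ract h a)"
    for a :: 'a
    unfolding tensor_dual_act_adjoint by (intro bounded_clinear_adjoint tensor_lact tensor_ract)+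
  have scale: "wk_star_continuous P (\<lambda>a. c * k a)" if "wk_star_continuous P k" for c k
    using continuous_map_compose[OF that, of euclidean "\<lambda>z. c * z"]
    by (simp add: comp_def continuous_intros)
  show ?thesis
    unfolding csubspace_def
  proof (intro conjI ballI allI)
    show "0 \<in> sigma_wc_tensor P"
      by (simp add: sigma_wc_tensor_def sigma_wc_iff bounded_clinear_simps(4)[OF adj(1)]
          bounded_clinear_simps(4)[OF adj(2)])
    fix x assume x: "x \<in> sigma_wc_tensor P"
    show "x + y \<in> sigma_wc_tensor P" if "y \<in> sigma_wc_tensor P" for y
      using x that unfolding sigma_wc_tensor_def sigma_wc_iff
      by (simp add: bounded_clinear_simps(1)[OF adj(1)] bounded_clinear_simps(1)[OF adj(2)]
          continuous_map_add)
    show "c *\<^sub>C x \<in> sigma_wc_tensor P" for c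
      using x unfolding sigma_wc_tensor_def sigma_wc_iff
      by (simp add: bounded_clinear_simps(5)[OF adj(1)] bounded_clinear_simps(5)[OF adj(2)] scale)
  qed
qed

text \<open>Convergence in a weak-star topology is pointwise convergence of elements of the dual; this
  membership makes the commutators of \<open>m\<close> eligible.\<close>

lemma commutator_in_subspace_dual:
  assumes m: "m \<in> subspace_dual (sigma_wc_tensor P)"
  shows "(\<lambda>h\<in>sigma_wc_tensor P. m (tensor_dual_ract h a) - m (tensor_dual_lact a h))
    \<in> subspace_dual (sigma_wc_tensor P)" (is "?c \<in> _")
proof -
  let ?S = "sigma_wc_tensor P"
  have adj: "bounded_clinear (tensor_dual_lact a)" "bounded_clinear (\<lambda>h. tensor_dual_ract h a)"
    unfolding tensor_dual_act_adjoint by (intro bounded_clinear_adjoint tensor_lact tensor_ract)+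
  note S = csubspace_sigma_wc_tensor[unfolded csubspace_def]
  obtain K where K: "\<And>h. h \<in> ?S \<Longrightarrow> cmod (m h) \<le> K * norm h"
    using m unfolding subspace_dual_def by blast
  have K': "cmod (m h) \<le> \<bar>K\<bar> * norm h" if "h \<in> ?S" for h
    using K[OF that] mult_right_mono[OF abs_ge_self[of K] norm_ge_zero[of h]] by linarith
  obtain L where L: "\<And>h. norm (tensor_dual_lact a h) \<le> norm h * L"
    using bounded_linear.bounded[OF bounded_clinearD(1)[OF adj(1)]] by blast
  obtain R where R: "\<And>h. norm (tensor_dual_ract h a) \<le> norm h * R"
    using bounded_linear.bounded[OF bounded_clinearD(1)[OF adj(2)]] by blast
  have bound: "cmod (m (tensor_dual_ract h a) - m (tensor_dual_lact a h)) \<le> (\<bar>K\<bar> * (R + L)) * norm h"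
    if h: "h \<in> ?S" for h
  proof -
    have "cmod (m (tensor_dual_ract h a) - m (tensor_dual_lact a h))
        \<le> cmod (m (tensor_dual_ract h a)) + cmod (m (tensor_dual_lact a h))"
      by (rule norm_triangle_ineq4)
    also have "\<dots> \<le> \<bar>K\<bar> * norm (tensor_dual_ract h a) + \<bar>K\<bar> * norm (tensor_dual_lact a h)"
      by (intro add_mono K' sigma_wc_tensor_act h)
    also have "\<dots> \<le> \<bar>K\<bar> * (norm h * R) + \<bar>K\<bar> * (norm h * L)"
      by (intro add_mono mult_left_mono L R) auto
    finally show ?thesis by (simp add: algebra_simps)
  qed
  have lin: "x \<in> ?S \<Longrightarrow> y \<in> ?S \<Longrightarrow> m (x + y) = m x + m y"
    "x \<in> ?S \<Longrightarrow> m (c *\<^sub>C x) = c * m x" for x y c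
    using m by (auto simp: subspace_dual_def)
  have add: "m (tensor_dual_ract (x + y) a) - m (tensor_dual_lact a (x + y))
      = m (tensor_dual_ract x a) - m (tensor_dual_lact a x)
        + (m (tensor_dual_ract y a) - m (tensor_dual_lact a y))" if "x \<in> ?S" "y \<in> ?S" for x y
    using that by (simp add: bounded_clinear_simps(1)[OF adj(1)] bounded_clinear_simps(1)[OF adj(2)]
        lin sigma_wc_tensor_act)
  have scale: "m (tensor_dual_ract (c *\<^sub>C x) a) - m (tensor_dual_lact a (c *\<^sub>C x))
      = c * (m (tensor_dual_ract x a) - m (tensor_dual_lact a x))" if "x \<in> ?S" for x c
    using that by (simp add: bounded_clinear_simps(5)[OF adj(1)] bounded_clinear_simps(5)[OF adj(2)]
        lin sigma_wc_tensor_act right_diff_distrib)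
  show ?thesis
    unfolding subspace_dual_def
  proof (intro CollectI conjI ballI allI exI[of _ "\<bar>K\<bar> * (R + L)"])
    fix x assume x: "x \<in> ?S"
    show "?c (x + y) = ?c x + ?c y" if "y \<in> ?S" for y
      using x that S by (simp only: restrict_apply' add)
    show "?c (c *\<^sub>C x) = c * ?c x" for c
      using x S by (simp only: restrict_apply' scale)
    show "cmod (?c x) \<le> \<bar>K\<bar> * (R + L) * norm x"
      using bound[OF x] x by (simp only: restrict_apply')
  qed simp
qed

text \<open>The two limits in the definition, spelled out on the functionals that test them.\<close>

lemma strong_pseudo_Connes_amenable_iff:
  "strong_pseudo_Connes_amenable P \<longleftrightarrow> (\<exists>F. F \<noteq> bot \<and>
    (\<forall>\<^sub>F m in F. m \<in> subspace_dual (sigma_wc_tensor P) \<and>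
      (\<forall>a. a * pi_sigma_wc P m = pi_sigma_wc P m * a)) \<and>
    (\<forall>a. \<forall>h\<in>sigma_wc_tensor P. ((\<lambda>m. m (tensor_dual_ract h a) - m (tensor_dual_lact a h)) \<longlongrightarrow> 0) F) \<and>
    (\<forall>a. \<forall>f\<in>P. ((\<lambda>m. cdual_apply f (a * pi_sigma_wc P m)) \<longlongrightarrow> cdual_apply f a) F))"
proof -
  let ?S = "sigma_wc_tensor P"
  have S_ne: "(\<lambda>x m. m x) ` ?S \<noteq> {}"
    using tensor_mult_adjoint_in_sigma_wc predual_nonempty by blast
  have zero: "(\<lambda>h\<in>?S. 0) \<in> subspace_dual ?S"
    using csubspace_sigma_wc_tensor by (auto simp: subspace_dual_def csubspace_def intro!: exI[of _ 0])
  have wk: "limitin (weak_star_topology ?S)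
      (\<lambda>m. \<lambda>f\<in>?S. subspace_dual_lact ?S tensor_dual_ract a m f
        - subspace_dual_ract ?S tensor_dual_lact m a f) (\<lambda>f\<in>?S. 0) F
    \<longleftrightarrow> (\<forall>h\<in>?S. ((\<lambda>m. m (tensor_dual_ract h a) - m (tensor_dual_lact a h)) \<longlongrightarrow> 0) F)"
    if "\<forall>\<^sub>F m in F. m \<in> subspace_dual ?S" for F a
  proof -
    have eq: "(\<lambda>f\<in>?S. subspace_dual_lact ?S tensor_dual_ract a m f
        - subspace_dual_ract ?S tensor_dual_lact m a f)
      = (\<lambda>h\<in>?S. m (tensor_dual_ract h a) - m (tensor_dual_lact a h))" for m
      by (auto simp: subspace_dual_lact_def subspace_dual_ract_def)
    have "\<forall>\<^sub>F m in F. (\<lambda>h\<in>?S. m (tensor_dual_ract h a) - m (tensor_dual_lact a h)) \<in> subspace_dual ?S"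
      using that by eventually_elim (rule commutator_in_subspace_dual)
    then show ?thesis
      unfolding weak_star_topology_def limitin_initial_topology[OF S_ne] eq
      using zero by simp
  qed
  have pre: "limitin (predual_topology P) k l F \<longleftrightarrow> (\<forall>f\<in>P. ((\<lambda>m. cdual_apply f (k m)) \<longlongrightarrow> cdual_apply f l) F)"
    for k l and F :: "(('a, 'a) ptensor cdual \<Rightarrow> complex) filter"
    unfolding predual_topology_def using predual_nonempty by (subst limitin_initial_topology) auto
  show ?thesis
    unfolding strong_pseudo_Connes_amenable_def Let_def pre
  proof (rule arg_cong[where f = Ex], rule ext)
    fix F
    show "(F \<noteq> bot \<and> (\<forall>\<^sub>F m in F. m \<in> subspace_dual ?S \<and>
          (\<forall>a. a * pi_sigma_wc P m = pi_sigma_wc P m * a)) \<and>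
        (\<forall>a. limitin (weak_star_topology ?S)
          (\<lambda>m. \<lambda>f\<in>?S. subspace_dual_lact ?S tensor_dual_ract a m f
            - subspace_dual_ract ?S tensor_dual_lact m a f) (\<lambda>f\<in>?S. 0) F) \<and>
        (\<forall>a. \<forall>f\<in>P. ((\<lambda>m. cdual_apply f (a * pi_sigma_wc P m)) \<longlongrightarrow> cdual_apply f a) F)) \<longleftrightarrow>
      (F \<noteq> bot \<and> (\<forall>\<^sub>F m in F. m \<in> subspace_dual ?S \<and>
          (\<forall>a. a * pi_sigma_wc P m = pi_sigma_wc P m * a)) \<and>
        (\<forall>a. \<forall>h\<in>?S. ((\<lambda>m. m (tensor_dual_ract h a) - m (tensor_dual_lact a h)) \<longlongrightarrow> 0) F) \<and>
        (\<forall>a. \<forall>f\<in>P. ((\<lambda>m. cdual_apply f (a * pi_sigma_wc P m)) \<longlongrightarrow> cdual_apply f a) F))"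
    proof (cases "\<forall>\<^sub>F m in F. m \<in> subspace_dual ?S")
      case True
      show ?thesis unfolding wk[OF True] ..
    next
      case False
      then show ?thesis unfolding eventually_conj_iff by blast
    qed
  qed
qed

end

section \<open>Homomorphic images\<close>

text \<open>The adjoint \<open>T\<^sup>*\<close> of \<open>T = J \<otimes> J\<close> intertwines the action of \<open>J(a)\<close> on the dual of
  \<open>\<B> \<otimes> \<B>\<close> with that of \<open>a\<close> on the dual of \<open>\<A> \<otimes> \<A>\<close>, and it maps the
  \<open>\<sigma>wc\<close>-part into the \<open>\<sigma>wc\<close>-part because \<open>J\<close> is weak-star continuous.  So \<open>m \<circ> T\<^sup>*\<close> is a
  net for \<open>\<B>\<close>, and \<open>\<pi>(m \<circ> T\<^sup>*) = J(\<pi>(m))\<close>.\<close>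

lemma strong_pseudo_Connes_amenable_image:
  fixes J :: "'a::complex_banach_algebra \<Rightarrow> 'b::complex_banach_algebra"
  assumes P: "dual_banach_algebra P" and Q: "dual_banach_algebra Q"
    and J: "bounded_clinear J" and mult: "\<And>x y. J (x * y) = J x * J y" and surj: "surj J"
    and wk: "\<And>g. g \<in> Q \<Longrightarrow> cdual_adjoint J g \<in> P"
    and A: "strong_pseudo_Connes_amenable P"
  shows "strong_pseudo_Connes_amenable Q"
proof -
  let ?S = "sigma_wc_tensor P" and ?R = "sigma_wc_tensor Q"
  define T where "T = tensor_lift (\<lambda>x y. J x \<otimes>\<^sub>p J y)"
  have T: "bounded_clinear T" "T (x \<otimes>\<^sub>p y) = J x \<otimes>\<^sub>p J y" for x y
    unfolding T_def using tensor_lift[OF bounded_cbilinear_compose[OF bounded_cbilinear_tensor J J]]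
    by auto
  note comp = bounded_clinear_compose
  have T_lact: "T (tensor_lact a u) = tensor_lact (J a) (T u)" for a u
    by (rule tensor_ext[OF comp[OF T(1) tensor_lact(1)] comp[OF tensor_lact(1) T(1)]])
       (simp add: T(2) tensor_lact mult)
  have T_ract: "T (tensor_ract u a) = tensor_ract (T u) (J a)" for a u
    by (rule tensor_ext[OF comp[OF T(1) tensor_ract(1)] comp[OF tensor_ract(1) T(1)]])
       (simp add: T(2) tensor_ract mult)
  have T_mult: "tensor_mult (T u) = J (tensor_mult u)" for u
    by (rule tensor_ext[OF comp[OF tensor_mult(1) T(1)] comp[OF J tensor_mult(1)]])
       (simp add: T(2) tensor_mult mult)
  define T' where "T' = cdual_adjoint T"
  have T': "bounded_clinear T'" unfolding T'_def by (rule bounded_clinear_adjoint[OF T(1)])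
  have T'_lact: "T' (tensor_dual_lact (J a) h) = tensor_dual_lact a (T' h)"
    and T'_ract: "T' (tensor_dual_ract h (J a)) = tensor_dual_ract (T' h) a" for a h
    unfolding T'_def by (auto intro!: cdual_eqI simp: T(1) T_lact T_ract)
  have T'_mult: "T' (tensor_mult_adjoint g) = tensor_mult_adjoint (cdual_adjoint J g)" for g
    unfolding T'_def by (auto intro!: cdual_eqI simp: T(1) T_mult J)
  have T'_S: "T' h \<in> ?S" if h: "h \<in> ?R" for h
    unfolding sigma_wc_tensor_def sigma_wc_iff
  proof (intro allI conjI)
    fix \<Lambda>
    note cont = wk_star_continuous_compose[OF predual_nonempty[OF P] predual_nonempty[OF Q]]
    have "wk_star_continuous Q (\<lambda>b. cdual_apply (cdual_adjoint T' \<Lambda>) (tensor_dual_lact b h))"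
      "wk_star_continuous Q (\<lambda>b. cdual_apply (cdual_adjoint T' \<Lambda>) (tensor_dual_ract h b))"
      using h unfolding sigma_wc_tensor_def sigma_wc_iff by blast+
    note this[THEN cont, of J]
    then show "wk_star_continuous P (\<lambda>a. cdual_apply \<Lambda> (tensor_dual_lact a (T' h)))"
      "wk_star_continuous P (\<lambda>a. cdual_apply \<Lambda> (tensor_dual_ract (T' h) a))"
      using wk J by (force simp: T' T'_lact T'_ract)+
  qed
  define push where "push m = (\<lambda>h\<in>?R. m (T' h))" for m :: "('a, 'a) ptensor cdual \<Rightarrow> complex"
  have push_dual: "push m \<in> subspace_dual ?R" if m: "m \<in> subspace_dual ?S" for m
  proof -
    obtain K where K: "\<And>h. h \<in> ?S \<Longrightarrow> cmod (m h) \<le> K * norm h"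
      using m unfolding subspace_dual_def by blast
    obtain L where L: "\<And>h. norm (T' h) \<le> norm h * L"
      using bounded_linear.bounded[OF bounded_clinearD(1)[OF T']] by blast
    have bound: "cmod (m (T' h)) \<le> (\<bar>K\<bar> * L) * norm h" if "h \<in> ?R" for h
    proof -
      have "cmod (m (T' h)) \<le> K * norm (T' h)" by (rule K[OF T'_S[OF that]])
      also have "\<dots> \<le> \<bar>K\<bar> * norm (T' h)" by (intro mult_right_mono) auto
      also have "\<dots> \<le> \<bar>K\<bar> * (norm h * L)" by (intro mult_left_mono L) auto
      finally show ?thesis by (simp add: mult_ac)
    qed
    show ?thesis
      unfolding subspace_dual_def push_def
      by (intro CollectI conjI exI[of _ "\<bar>K\<bar> * L"])
         (use m csubspace_sigma_wc_tensor[OF Q] bound in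
           \<open>auto simp: csubspace_def subspace_dual_def bounded_clinear_simps[OF T'] T'_S\<close>)
  qed
  have push_pi: "pi_sigma_wc Q (push m) = J (pi_sigma_wc P m)" if m: "m \<in> subspace_dual ?S" for m
  proof (rule pi_sigma_wc_unique[OF Q])
    fix g assume g: "g \<in> Q"
    have "cdual_apply g (J (pi_sigma_wc P m)) = cdual_apply (cdual_adjoint J g) (pi_sigma_wc P m)"
      by (simp add: J)
    also have "\<dots> = m (T' (tensor_mult_adjoint g))"
      by (simp add: cdual_apply_pi_sigma_wc[OF P m wk[OF g]] T'_mult)
    also have "\<dots> = push m (tensor_mult_adjoint g)"
      by (simp add: push_def tensor_mult_adjoint_in_sigma_wc[OF Q g])
    finally show "cdual_apply g (J (pi_sigma_wc P m)) = push m (tensor_mult_adjoint g)" .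
  qed
  obtain F where F: "F \<noteq> bot"
    and ev: "\<forall>\<^sub>F m in F. m \<in> subspace_dual ?S \<and> (\<forall>a. a * pi_sigma_wc P m = pi_sigma_wc P m * a)"
    and comm: "\<And>a h. h \<in> ?S \<Longrightarrow> ((\<lambda>m. m (tensor_dual_ract h a) - m (tensor_dual_lact a h)) \<longlongrightarrow> 0) F"
    and unit: "\<And>a f. f \<in> P \<Longrightarrow> ((\<lambda>m. cdual_apply f (a * pi_sigma_wc P m)) \<longlongrightarrow> cdual_apply f a) F"
    using A unfolding strong_pseudo_Connes_amenable_iff[OF P] by blast
  show ?thesis
    unfolding strong_pseudo_Connes_amenable_iff[OF Q]
  proof (intro exI[of _ "filtermap push F"] conjI allI ballI)
    show "filtermap push F \<noteq> bot" using F by (simp add: filtermap_bot_iff)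
    show "\<forall>\<^sub>F m in filtermap push F. m \<in> subspace_dual ?R \<and>
        (\<forall>b. b * pi_sigma_wc Q m = pi_sigma_wc Q m * b)"
      unfolding eventually_filtermap using ev
    proof eventually_elim
      case (elim m)
      have "J a * J (pi_sigma_wc P m) = J (pi_sigma_wc P m) * J a" for a
        using elim by (metis mult)
      with surj have "b * J (pi_sigma_wc P m) = J (pi_sigma_wc P m) * b" for b
        by (metis surjD)
      with elim show ?case by (simp add: push_dual push_pi)
    qed
    fix b
    obtain a where b: "b = J a" using surj by (metis surjD)
    show "((\<lambda>m. m (tensor_dual_ract h b) - m (tensor_dual_lact b h)) \<longlongrightarrow> 0) (filtermap push F)"
      if h: "h \<in> ?R" for h
      using comm[OF T'_S[OF h], of a]
      by (simp add: filterlim_filtermap push_def sigma_wc_tensor_act[OF Q h] b T'_lact T'_ract)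
    fix g assume g: "g \<in> Q"
    have "((\<lambda>m. cdual_apply g (J (a * pi_sigma_wc P m))) \<longlongrightarrow> cdual_apply g (J a)) F"
      using unit[OF wk[OF g], of a] by (simp add: J)
    moreover have "\<forall>\<^sub>F m in F. cdual_apply g (J (a * pi_sigma_wc P m))
        = cdual_apply g (b * pi_sigma_wc Q (push m))"
      using ev by eventually_elim (simp add: push_pi b flip: mult)
    ultimately show "((\<lambda>m. cdual_apply g (b * pi_sigma_wc Q m)) \<longlongrightarrow> cdual_apply g b) (filtermap push F)"
      unfolding filterlim_filtermap b by (rule Lim_transform_eventually)
  qed
qed

section \<open>An obstruction\<close>

text \<open>The functional \<open>h(x \<otimes> y) = \<psi>(x) \<omega>(y)\<close> is obtained as \<open>\<psi> \<circ> R\<close> with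
  \<open>R(x \<otimes> y) = \<omega>(y) x\<close>.  This factorization reduces the continuity of \<open>a \<mapsto> h \<cdot> a\<close> to that of
  \<open>a \<mapsto> \<psi> \<cdot> a\<close>, since \<open>(\<psi> \<circ> R) \<cdot> a = (\<psi> \<cdot> a) \<circ> R\<close>, while \<open>a \<cdot> h = \<omega>(a) h\<close>.\<close>

lemma not_strong_pseudo_Connes_amenable:
  fixes P :: "'a::complex_banach_algebra cdual set"
  assumes P: "dual_banach_algebra P"
    and \<omega>: "\<omega> \<in> P" and mult: "\<And>x y. cdual_apply \<omega> (x * y) = cdual_apply \<omega> x * cdual_apply \<omega> y"
    and nz: "cdual_apply \<omega> u \<noteq> 0"
    and \<psi>: "\<psi> \<in> P" and \<psi>_e: "\<And>x. cdual_apply \<psi> (e * x) = cdual_apply \<omega> x"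
    and \<omega>_e: "cdual_apply \<omega> e = 0"
  shows "\<not> strong_pseudo_Connes_amenable P"
proof
  let ?S = "sigma_wc_tensor P"
  assume "strong_pseudo_Connes_amenable P"
  then obtain F where F: "F \<noteq> bot"
    and ev: "\<forall>\<^sub>F m in F. m \<in> subspace_dual ?S"
    and comm: "\<And>a h. h \<in> ?S \<Longrightarrow> ((\<lambda>m. m (tensor_dual_ract h a) - m (tensor_dual_lact a h)) \<longlongrightarrow> 0) F"
    and unit: "\<And>a f. f \<in> P \<Longrightarrow> ((\<lambda>m. cdual_apply f (a * pi_sigma_wc P m)) \<longlongrightarrow> cdual_apply f a) F"
    unfolding strong_pseudo_Connes_amenable_iff[OF P] eventually_conj_iff by blast
  define R where "R = tensor_lift (\<lambda>(x::'a) y. cdual_apply \<omega> y *\<^sub>C x)"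
  have bilinear: "bounded_cbilinear (\<lambda>(x::'a) y. cdual_apply \<omega> y *\<^sub>C x)"
  proof -
    have bound: "norm (cdual_apply \<omega> y *\<^sub>C x) \<le> norm x * norm y * norm \<omega>" for x y :: 'a
      using mult_right_mono[OF norm_cdual_apply[of \<omega> y], of "norm x"]
      by (simp add: norm_scaleC mult_ac)
    have "bounded_bilinear (\<lambda>(x::'a) y. cdual_apply \<omega> y *\<^sub>C x)"
      by (intro bounded_bilinear.intro exI[of _ "norm \<omega>"] allI bound)
         (simp_all add: scaleC_add_right scaleC_add_left scaleR_scaleC scaleC_scaleC mult.commute)
    then show ?thesis by (simp add: bounded_cbilinear_def scaleC_scaleC mult.commute)
  qed
  have R: "bounded_clinear R" "R (x \<otimes>\<^sub>p y) = cdual_apply \<omega> y *\<^sub>C x" for x y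
    unfolding R_def by (rule tensor_lift[OF bilinear])+
  note comp = bounded_clinear_compose
  have R_lact: "R (tensor_lact a v) = a * R v" for a v
    by (rule tensor_ext[OF comp[OF R(1) tensor_lact(1)] comp[OF bounded_clinear_mult_right R(1)]])
       (simp add: R(2) tensor_lact scaleC_mult_right)
  have R_ract: "R (tensor_ract v a) = cdual_apply \<omega> a *\<^sub>C R v" for a v
    by (rule tensor_ext[OF comp[OF R(1) tensor_ract(1)] comp[OF bounded_clinear_scaleC_right R(1)]])
       (simp add: R(2) tensor_ract mult scaleC_scaleC mult.commute)
  have R_\<omega>: "cdual_apply \<omega> (R v) = cdual_apply \<omega> (tensor_mult v)" for v
    by (rule tensor_ext[OF comp[OF cdual_apply_bounded_clinear R(1)]
          comp[OF cdual_apply_bounded_clinear tensor_mult(1)]])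
       (simp add: R(2) tensor_mult mult)
  define h where "h = cdual_adjoint R \<psi>"
  have h_lact: "tensor_dual_lact a h = cdual_apply \<omega> a *\<^sub>C h"
    and h_ract: "tensor_dual_ract h a = cdual_adjoint R (dual_ract (*) \<psi> a)" for a
    unfolding h_def by (auto intro!: cdual_eqI simp: R R_lact R_ract)
  have h: "h \<in> ?S"
    unfolding sigma_wc_tensor_def sigma_wc_iff
  proof (intro allI conjI)
    fix \<Lambda>
    have "wk_star_continuous P (\<lambda>a. cdual_apply \<omega> a * cdual_apply \<Lambda> h)"
      using continuous_map_compose[OF wk_star_continuous_predual[OF \<omega>], of euclidean "\<lambda>z. z * cdual_apply \<Lambda> h"]
      by (simp add: comp_def continuous_intros)
    then show "wk_star_continuous P (\<lambda>a. cdual_apply \<Lambda> (tensor_dual_lact a h))"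
      by (simp add: h_lact)
    show "wk_star_continuous P (\<lambda>a. cdual_apply \<Lambda> (tensor_dual_ract h a))"
      using wk_star_continuous_orbit(2)[OF P \<psi>, of "cdual_adjoint (cdual_adjoint R) \<Lambda>"]
      by (simp add: h_ract bounded_clinear_adjoint[OF R(1)])
  qed
  have "tensor_dual_ract h e = tensor_mult_adjoint \<omega>" "tensor_dual_lact e h = 0"
    unfolding h_ract h_lact by (auto intro!: cdual_eqI simp: R \<psi>_e R_\<omega> \<omega>_e)
  \<comment> \<open>\<open>m 0\<close> is not literally \<open>0\<close>: this holds only eventually along \<open>F\<close>, for the \<open>m\<close> that are linear.\<close>
  with comm[OF h, of e] have lim: "((\<lambda>m. m (tensor_mult_adjoint \<omega>) - m 0) \<longlongrightarrow> 0) F" by simp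
  have "\<forall>\<^sub>F m in F. m (tensor_mult_adjoint \<omega>) - m 0 = cdual_apply \<omega> (pi_sigma_wc P m)"
    using ev
  proof eventually_elim
    case (elim m)
    have "m (0 *\<^sub>C h) = 0 * m h" using elim h unfolding subspace_dual_def by blast
    then show ?case by (simp add: cdual_apply_pi_sigma_wc[OF P elim \<omega>])
  qed
  from Lim_transform_eventually[OF lim this]
  have "((\<lambda>m. cdual_apply \<omega> u * cdual_apply \<omega> (pi_sigma_wc P m)) \<longlongrightarrow> cdual_apply \<omega> u * 0) F"
    by (intro tendsto_intros)
  with unit[OF \<omega>, of u] have "cdual_apply \<omega> u = 0"
    using tendsto_unique[OF F] by (simp add: mult)
  with nz show False by contradiction
qed

section \<open>Matrix units\<close>

text \<open>Positions below the diagonal are allowed and give the zero matrix, so that \<open>single_entry i j\<close>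
  is a linear map for all \<open>i\<close> and \<open>j\<close>.\<close>

definition single_entry :: "'i \<Rightarrow> 'i \<Rightarrow> 'a \<Rightarrow> ('i::linorder, 'a::complex_banach_algebra) upmat"
  where "single_entry i j x = Abs_upmat (\<lambda>k l. if k = i \<and> l = j \<and> i \<le> j then x else 0)"

lemma single_entry:
  shows entry_single_entry [simp]:
      "entry (single_entry i j x) k l = (if k = i \<and> l = j \<and> i \<le> j then x else 0)"
    and norm_single_entry_le: "norm (single_entry i j x) \<le> norm x"
proof -
  let ?M = "\<lambda>k l. if k = i \<and> l = j \<and> i \<le> j then x else 0"
  have "(\<Sum>(k, l)\<in>F. norm (?M k l)) \<le> norm x" if "finite F" for F
  proof -
    have "(\<Sum>(k, l)\<in>F. norm (?M k l)) \<le> (\<Sum>p\<in>F. if p = (i, j) then norm x else 0)"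
      by (intro sum_mono) (auto split: if_splits)
    also have "\<dots> \<le> norm x" using that by simp
    finally show ?thesis .
  qed
  note M = abs_summable_matrix_bounded[of ?M, OF this]
  have "entry (Abs_upmat ?M) = ?M"
    by (rule entry_Abs_upmat[OF _ M(1)]) auto
  then show "entry (single_entry i j x) k l = ?M k l" "norm (single_entry i j x) \<le> norm x"
    using M(2) unfolding single_entry_def norm_upmat_eq by metis+
qed

lemma single_entry_below: "j < i \<Longrightarrow> single_entry i j x = 0"
  by (rule upmat_eqI) auto

lemma bounded_clinear_single_entry: "bounded_clinear (single_entry i j)"
  by (rule bounded_clinearI[where K = 1])
     (auto intro!: upmat_eqI simp: norm_single_entry_le)

lemma bounded_clinear_entry: "bounded_clinear (\<lambda>M. entry M i j)"
  by (rule bounded_clinearI[where K = 1]) (auto simp: norm_entry_le)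

lemma infsum_single:
  assumes "\<And>k. k \<noteq> j \<Longrightarrow> f k = 0"
  shows "(\<Sum>\<^sub>\<infinity>k. f k) = f j"
  by (rule infsumI, rule has_sum_finite_neutralI[of "{j}"]) (use assms in auto)

lemma entry_single_entry_mult:
  "entry (single_entry i j x * M) k l = (if k = i \<and> i \<le> j then x * entry M j l else 0)"
  unfolding entry_times by (subst infsum_single[of j]) auto

lemma single_entry_mult_single_entry:
  assumes "i \<le> j" "k \<le> l"
  shows "single_entry i j x * single_entry k l y = (if j = k then single_entry i l (x * y) else 0)"
  using assms by (intro upmat_eqI) (auto simp: entry_single_entry_mult)

lemma entry_mult_diagonal: "entry (M * N) j j = entry M j j * entry N j j"
proof -
  have "entry M j k * entry N k j = 0" if "k \<noteq> j" for k
    using that by (cases "k < j") auto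
  then show ?thesis unfolding entry_times by (rule infsum_single)
qed

text \<open>The series converges absolutely, hence has some sum, and this sum has the right entries because
  taking an entry is continuous.\<close>

lemma has_sum_single_entry:
  fixes M :: "('i::linorder, 'a::complex_banach_algebra) upmat"
  shows "((\<lambda>(i, j). single_entry i j (entry M i j)) has_sum M) UNIV"
proof -
  have "(\<lambda>(i, j). norm (entry M i j)) summable_on UNIV"
    using abs_summable_entry[of M] by (simp add: abs_summable_matrix_def)
  then have "(\<lambda>(i, j). single_entry i j (entry M i j)) abs_summable_on UNIV"
    by (rule Infinite_Sum.abs_summable_on_comparison_test') (auto simp: norm_single_entry_le)
  then obtain N where N: "((\<lambda>(i, j). single_entry i j (entry M i j)) has_sum N) UNIV"
    using abs_summable_summable unfolding summable_on_def by blast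
  have "entry N k l = entry M k l" for k l
  proof -
    have "((\<lambda>p. entry (case p of (i, j) \<Rightarrow> single_entry i j (entry M i j)) k l) has_sum entry N k l) UNIV"
      by (rule has_sum_bounded_linear[OF bounded_clinearD(1)[OF bounded_clinear_entry] N])
    moreover have "((\<lambda>p. entry (case p of (i, j) \<Rightarrow> single_entry i j (entry M i j)) k l) has_sum entry M k l) UNIV"
      by (rule has_sum_finite_neutralI[of "{(k, l)}"]) (auto simp: not_le split: if_splits)
    ultimately show ?thesis by (rule has_sum_unique)
  qed
  then have "N = M" by (rule upmat_eqI)
  with N show ?thesis by simp
qed

text \<open>This induction principle replaces infinite sums in the study of the module structure.\<close>

lemma closed_subspace_upmat:
  fixes M :: "('i::linorder, 'a::complex_banach_algebra) upmat"
  assumes "closed V" "csubspace V" "\<And>i j x. i \<le> j \<Longrightarrow> single_entry i j x \<in> V"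
  shows "M \<in> V"
proof (rule Lim_in_closed_set[OF assms(1)])
  have V: "0 \<in> V" "\<And>x y. x \<in> V \<Longrightarrow> y \<in> V \<Longrightarrow> x + y \<in> V"
    using assms(2) by (auto simp: csubspace_def)
  have "single_entry i j x \<in> V" for i j x
    using assms(3) V(1) by (cases "i \<le> j") (auto simp: single_entry_below)
  then have "(\<Sum>(i, j)\<in>F. single_entry i j (entry M i j)) \<in> V" for F
    by (induction F rule: infinite_finite_induct) (auto intro: V)
  then show "\<forall>\<^sub>F F in finite_subsets_at_top UNIV. (\<Sum>(i, j)\<in>F. single_entry i j (entry M i j)) \<in> V"
    by simp
  show "((\<lambda>F. \<Sum>(i, j)\<in>F. single_entry i j (entry M i j)) \<longlongrightarrow> M) (finite_subsets_at_top UNIV)"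
    using has_sum_single_entry[of M] by (simp add: has_sum_def)
qed (rule finite_subsets_at_top_neq_bot)

section \<open>The dual of the space of upper triangular matrices\<close>

definition cdual_entry ::
    "('i::linorder, 'a::complex_banach_algebra) upmat cdual \<Rightarrow> 'i \<Rightarrow> 'i \<Rightarrow> 'a cdual"
  where "cdual_entry g i j = cdual_adjoint (single_entry i j) g"

lemma cdual_entry_apply [simp]: "cdual_apply (cdual_entry g i j) x = cdual_apply g (single_entry i j x)"
  by (simp add: cdual_entry_def bounded_clinear_single_entry)

lemma bounded_clinear_cdual_entry: "bounded_clinear (\<lambda>g. cdual_entry g i j)"
  unfolding cdual_entry_def by (rule bounded_clinear_adjoint[OF bounded_clinear_single_entry])

lemma cdual_entry_below: "j < i \<Longrightarrow> cdual_entry g i j = 0"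
  by (rule cdual_eqI) (simp add: single_entry_below)

lemma norm_cdual_entry_le: "norm (cdual_entry g i j) \<le> norm g"
proof (rule norm_cdual_le)
  fix x
  show "cmod (cdual_apply (cdual_entry g i j) x) \<le> norm g * norm x"
    using norm_cdual_apply[of g "single_entry i j x"]
      mult_left_mono[OF norm_single_entry_le[of i j x] norm_ge_zero[of g]] by simp
qed simp

lemma has_sum_cdual_entry:
  "((\<lambda>(i, j). cdual_apply (cdual_entry g i j) (entry M i j)) has_sum cdual_apply g M) UNIV"
  using has_sum_bounded_linear[OF bounded_clinearD(1)[OF cdual_apply_bounded_clinear[of g]] has_sum_single_entry[of M]]
  by (simp add: case_prod_unfold)

text \<open>The dual of an \<open>\<ell>\<^sup>1\<close>-sum is the \<open>\<ell>\<^sup>\<infinity>\<close>-sum of the duals.\<close>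

lemma norm_upmat_cdual_le:
  fixes g :: "('i::linorder, 'a::complex_banach_algebra) upmat cdual"
  assumes "C \<ge> 0" "\<And>i j. i \<le> j \<Longrightarrow> norm (cdual_entry g i j) \<le> C"
  shows "norm g \<le> C"
proof (rule norm_cdual_le[OF assms(1)])
  fix M :: "('i, 'a) upmat"
  have "(\<lambda>(i, j). norm (entry M i j)) summable_on UNIV"
    using abs_summable_entry[of M] by (simp add: abs_summable_matrix_def)
  then have S: "((\<lambda>(i, j). norm (entry M i j)) has_sum norm M) UNIV"
    unfolding norm_upmat_eq matrix_l1_norm_def by (rule has_sum_infsum)
  show "cmod (cdual_apply g M) \<le> C * norm M"
  proof (rule norm_infsum_le[OF has_sum_cdual_entry has_sum_cmult_right[OF S]])
    fix p :: "'i \<times> 'i"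
    obtain i j where p: "p = (i, j)" by (cases p)
    have "norm (cdual_entry g i j) \<le> C"
      using assms by (cases "i \<le> j") (auto simp: cdual_entry_below)
    then have "norm (cdual_entry g i j) * norm (entry M i j) \<le> C * norm (entry M i j)"
      by (rule mult_right_mono) simp
    with norm_cdual_apply[of "cdual_entry g i j" "entry M i j"]
    show "cmod (case p of (i, j) \<Rightarrow> cdual_apply (cdual_entry g i j) (entry M i j))
        \<le> C * (case p of (i, j) \<Rightarrow> norm (entry M i j))"
      by (simp add: p)
  qed
qed

section \<open>The upper triangular matrices as a dual Banach algebra\<close>

text \<open>A functional determines the family that represents it: \<open>f\<^bsub>ij\<^esub>\<close> is the restriction of \<open>g\<close> to
  the matrices supported at \<open>(i, j)\<close>.  Membership in the predual thereby becomes a closed linear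
  condition on \<open>g\<close> itself.\<close>

lemma upmat_predual_iff:
  fixes P :: "'a::complex_banach_algebra cdual set"
    and g :: "('i::linorder, 'a) upmat cdual"
  shows "g \<in> upmat_predual P \<longleftrightarrow> (\<forall>i j. i \<le> j \<longrightarrow> cdual_entry g i j \<in> P) \<and>
    (\<forall>e>0. finite {(i, j). i \<le> j \<and> norm (cdual_entry g i j) \<ge> e})"
proof
  assume "g \<in> upmat_predual P"
  then obtain f :: "'i \<Rightarrow> 'i \<Rightarrow> 'a cdual" where f: "\<forall>i j. i \<le> j \<longrightarrow> f i j \<in> P"
    "\<forall>e>0. finite {(i, j). i \<le> j \<and> norm (f i j) \<ge> e}"
    and g: "\<forall>M. cdual_apply g M = (\<Sum>\<^sub>\<infinity>(i, j)\<in>{(i, j). i \<le> j}. cdual_apply (f i j) (entry M i j))"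
    unfolding upmat_predual_def mem_Collect_eq by (elim exE conjE) (rule that)
  have eq: "cdual_entry g i j = f i j" if "i \<le> j" for i j
  proof (rule cdual_eqI)
    fix x
    have "((\<lambda>(k, l). cdual_apply (f k l) (entry (single_entry i j x) k l)) has_sum cdual_apply (f i j) x)
        {(i, j). i \<le> j}"
      by (rule has_sum_finite_neutralI[of "{(i, j)}"]) (use that in \<open>auto split: if_splits\<close>)
    from infsumI[OF this] show "cdual_apply (cdual_entry g i j) x = cdual_apply (f i j) x"
      by (simp add: g)
  qed
  have "{(i, j). i \<le> j \<and> norm (cdual_entry g i j) \<ge> e} = {(i, j). i \<le> j \<and> norm (f i j) \<ge> e}" for e
    using eq by auto
  with f(2) have "\<forall>e>0. finite {(i, j). i \<le> j \<and> norm (cdual_entry g i j) \<ge> e}"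
    by (simp only:)
  moreover have "\<forall>i j. i \<le> j \<longrightarrow> cdual_entry g i j \<in> P"
    using eq f(1) by metis
  ultimately show "(\<forall>i j. i \<le> j \<longrightarrow> cdual_entry g i j \<in> P) \<and>
    (\<forall>e>0. finite {(i, j). i \<le> j \<and> norm (cdual_entry g i j) \<ge> e})" by (rule conjI[rotated])
next
  assume A: "(\<forall>i j. i \<le> j \<longrightarrow> cdual_entry g i j \<in> P) \<and>
    (\<forall>e>0. finite {(i, j). i \<le> j \<and> norm (cdual_entry g i j) \<ge> e})"
  have "\<forall>M. cdual_apply g M = (\<Sum>\<^sub>\<infinity>(i, j)\<in>{(i, j). i \<le> j}. cdual_apply (cdual_entry g i j) (entry M i j))"
  proof (intro allI, rule infsumI[symmetric])
    fix M
    show "((\<lambda>(i, j). cdual_apply (cdual_entry g i j) (entry M i j)) has_sum cdual_apply g M) {(i, j). i \<le> j}"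
      using has_sum_cdual_entry[of g M]
      by (rule has_sum_cong_neutral[THEN iffD1, rotated -1])
         (auto simp: cdual_entry_below simp del: cdual_entry_apply)
  qed
  note conjI[OF conjunct1[OF A] conjI[OF conjunct2[OF A] this]]
  then show "g \<in> upmat_predual P"
    unfolding upmat_predual_def by (intro CollectI) (rule exI[of _ "cdual_entry g"])
qed

lemma upmat_predualI:
  assumes "\<And>i j. i \<le> j \<Longrightarrow> cdual_entry g i j \<in> P"
    and "\<And>e. e > 0 \<Longrightarrow> \<exists>F. finite F \<and> (\<forall>i j. i \<le> j \<longrightarrow> norm (cdual_entry g i j) \<ge> e \<longrightarrow> (i, j) \<in> F)"
  shows "g \<in> upmat_predual P"
  unfolding upmat_predual_iff
proof (intro conjI allI impI)
  fix e :: real assume "e > 0"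
  with assms(2) obtain F where "finite F" "\<forall>i j. i \<le> j \<longrightarrow> norm (cdual_entry g i j) \<ge> e \<longrightarrow> (i, j) \<in> F"
    by blast
  then show "finite {(i, j). i \<le> j \<and> e \<le> norm (cdual_entry g i j)}"
    by (elim finite_subset[rotated]) auto
qed (use assms(1) in blast)

lemma upmat_predualD:
  assumes "g \<in> upmat_predual P"
  shows "i \<le> j \<Longrightarrow> cdual_entry g i j \<in> P"
    "e > 0 \<Longrightarrow> finite {(i, j). i \<le> j \<and> norm (cdual_entry g i j) \<ge> e}"
  using assms unfolding upmat_predual_iff by blast+

context
  fixes P :: "'a::complex_banach_algebra cdual set"
  assumes P: "dual_banach_algebra P"
begin

lemma predual_subspace:
  "0 \<in> P" "f \<in> P \<Longrightarrow> h \<in> P \<Longrightarrow> f + h \<in> P" "f \<in> P \<Longrightarrow> c *\<^sub>C f \<in> P"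
  using predual_csubspace[OF P] by (auto simp: csubspace_def)

lemma csubspace_upmat_predual: "csubspace (upmat_predual P :: ('i::linorder, 'a) upmat cdual set)"
  unfolding csubspace_def
proof (intro conjI ballI allI)
  note lin = bounded_clinear_simps[OF bounded_clinear_cdual_entry]
  show "0 \<in> upmat_predual P"
    by (rule upmat_predualI) (auto simp: lin(4) predual_subspace)
  fix g :: "('i, 'a) upmat cdual" assume g: "g \<in> upmat_predual P"
  show "g + h \<in> upmat_predual P" if h: "h \<in> upmat_predual P" for h
  proof (rule upmat_predualI)
    show "cdual_entry (g + h) i j \<in> P" if "i \<le> j" for i j
      unfolding lin(1) using that by (intro predual_subspace upmat_predualD g h)
    fix e :: real assume "e > 0"
    then have e: "e / 2 > 0" by simp
    let ?A = "\<lambda>g::('i, 'a) upmat cdual. {(i, j). i \<le> j \<and> norm (cdual_entry g i j) \<ge> e / 2}"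
    have "(i, j) \<in> ?A g \<union> ?A h" if "i \<le> j" "norm (cdual_entry (g + h) i j) \<ge> e" for i j
      using that norm_triangle_ineq[of "cdual_entry g i j" "cdual_entry h i j"]
      by (auto simp: lin(1))
    then show "\<exists>F. finite F \<and> (\<forall>i j. i \<le> j \<longrightarrow> norm (cdual_entry (g + h) i j) \<ge> e \<longrightarrow> (i, j) \<in> F)"
      using upmat_predualD(2)[OF g e] upmat_predualD(2)[OF h e] by (intro exI[of _ "?A g \<union> ?A h"]) blast
  qed
  show "c *\<^sub>C g \<in> upmat_predual P" for c
  proof (rule upmat_predualI)
    show "cdual_entry (c *\<^sub>C g) i j \<in> P" if "i \<le> j" for i j
      unfolding lin(5) using that by (intro predual_subspace upmat_predualD g)
    fix e :: real assume "e > 0"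
    then have e: "e / (cmod c + 1) > 0" by (simp add: add_nonneg_pos)
    have "norm (cdual_entry g i j) \<ge> e / (cmod c + 1)" if "norm (cdual_entry (c *\<^sub>C g) i j) \<ge> e" for i j
    proof -
      have "e \<le> cmod c * norm (cdual_entry g i j)" using that by (simp add: lin(5) norm_scaleC)
      also have "\<dots> \<le> (cmod c + 1) * norm (cdual_entry g i j)" by (intro mult_right_mono) auto
      finally show ?thesis by (simp add: pos_divide_le_eq add_nonneg_pos mult.commute)
    qed
    then show "\<exists>F. finite F \<and> (\<forall>i j. i \<le> j \<longrightarrow> norm (cdual_entry (c *\<^sub>C g) i j) \<ge> e \<longrightarrow> (i, j) \<in> F)"
      using upmat_predualD(2)[OF g e] by (intro exI conjI) auto
  qed
qed

lemma closed_upmat_predual: "closed (upmat_predual P :: ('i::linorder, 'a) upmat cdual set)"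
  unfolding closed_sequential_limits
proof (intro allI impI, elim conjE)
  note lin = bounded_clinear_simps[OF bounded_clinear_cdual_entry]
  fix X and g :: "('i, 'a) upmat cdual"
  assume X: "\<forall>n. X n \<in> upmat_predual P" and lim: "X \<longlonglongrightarrow> g"
  show "g \<in> upmat_predual P"
  proof (rule upmat_predualI)
    show "cdual_entry g i j \<in> P" if "i \<le> j" for i j
    proof (rule closed_sequentially[OF predual_closed[OF P]])
      show "cdual_entry (X n) i j \<in> P" for n using X that upmat_predualD(1) by blast
      show "(\<lambda>n. cdual_entry (X n) i j) \<longlonglongrightarrow> cdual_entry g i j"
        by (rule bounded_linear.tendsto[OF bounded_clinearD(1)[OF bounded_clinear_cdual_entry] lim])
    qed
    fix e :: real assume "e > 0"
    then have e: "e / 2 > 0" by simp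
    obtain n where n: "norm (X n - g) < e / 2"
      using LIMSEQ_D[OF lim e] by blast
    have "norm (cdual_entry (X n) i j) \<ge> e / 2" if "norm (cdual_entry g i j) \<ge> e" for i j
      using norm_cdual_entry_le[of "X n - g" i j] n that
        norm_triangle_ineq3[of "cdual_entry (X n) i j" "cdual_entry g i j"]
      by (simp add: lin(2))
    then show "\<exists>F. finite F \<and> (\<forall>i j. i \<le> j \<longrightarrow> norm (cdual_entry g i j) \<ge> e \<longrightarrow> (i, j) \<in> F)"
      using upmat_predualD(2)[OF X[rule_format, of n] e]
      by (intro exI[of _ "{(i, j). i \<le> j \<and> norm (cdual_entry (X n) i j) \<ge> e / 2}"]) auto
  qed
qed

lemma entry_functional_in_upmat_predual:
  assumes f: "f \<in> P" and ij: "i \<le> j"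
  shows "cdual_adjoint (\<lambda>M. entry M i j) f \<in> upmat_predual P"
proof (rule upmat_predualI)
  let ?g = "cdual_adjoint (\<lambda>M. entry M i j) f"
  have eq: "cdual_entry ?g k l = (if k = i \<and> l = j then f else 0)" for k l
    using ij by (auto intro!: cdual_eqI simp: bounded_clinear_entry)
  show "cdual_entry ?g k l \<in> P" for k l
    by (simp add: eq f predual_subspace)
  show "\<exists>F. finite F \<and> (\<forall>k l. k \<le> l \<longrightarrow> norm (cdual_entry ?g k l) \<ge> e \<longrightarrow> (k, l) \<in> F)"
    if "e > 0" for e
    by (rule exI[of _ "{(i, j)}"]) (use that in \<open>auto simp: eq split: if_splits\<close>)
qed

text \<open>For fixed \<open>g\<close>, the matrices that map \<open>g\<close> into the predual form a closed subspace, so it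
  suffices to treat matrices with one entry.  Such a matrix moves a row or a column of \<open>g\<close> to
  another place and multiplies its entries by \<open>x\<close>, which preserves the \<open>c\<^sub>0\<close>-condition.\<close>

lemma upmat_predual_act:
  fixes g :: "('i::linorder, 'a) upmat cdual"
  assumes g: "g \<in> upmat_predual P"
  shows "dual_lact (*) M g \<in> upmat_predual P" "dual_ract (*) g M \<in> upmat_predual P"
proof -
  let ?Q = "upmat_predual P :: ('i, 'a) upmat cdual set"
  have span: "M \<in> {M. T M \<in> ?Q}" if T: "bounded_clinear T"
    and single: "\<And>i j x. i \<le> j \<Longrightarrow> T (single_entry i j x) \<in> ?Q"
    for T :: "('i, 'a) upmat \<Rightarrow> ('i, 'a) upmat cdual"
  proof (rule closed_subspace_upmat)
    have "closed (T -` ?Q)"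
      by (intro continuous_closed_vimage closed_upmat_predual)
         (auto intro: linear_continuous_at bounded_clinearD(1)[OF T])
    then show "closed {M. T M \<in> ?Q}" by (simp add: vimage_def)
    show "csubspace {M. T M \<in> ?Q}"
      using csubspace_upmat_predual[where 'i = 'i] unfolding csubspace_def
      by (simp add: bounded_clinear_simps[OF T])
  qed (use single in simp)
  have L: "bounded_clinear (\<lambda>M. dual_lact (*) M g)" and R: "bounded_clinear (\<lambda>M. dual_ract (*) g M)"
    by (rule bounded_clinearI[where K = "norm g"],
        auto intro!: cdual_eqI norm_dual_act_le
          simp: distrib_left distrib_right scaleC_mult_left scaleC_mult_right)+
  \<comment> \<open>The map \<open>s\<close> records where the entries of \<open>g\<close> are moved.\<close>
  have small: "\<exists>F. finite F \<and> (\<forall>k l. k \<le> l \<longrightarrow> norm (cdual_entry h k l) \<ge> e \<longrightarrow> (k, l) \<in> F)"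
    if e: "e > 0" and K: "K \<ge> 0" and h: "\<And>k l. k \<le> l \<Longrightarrow> cdual_entry h k l \<noteq> 0 \<Longrightarrow>
        \<exists>p q. p \<le> q \<and> (k, l) = s (p, q) \<and> norm (cdual_entry h k l) \<le> K * norm (cdual_entry g p q)"
    for e K s and h :: "('i, 'a) upmat cdual"
  proof -
    have e': "e / (K + 1) > 0" using e K by simp
    let ?G = "{(p, q). p \<le> q \<and> norm (cdual_entry g p q) \<ge> e / (K + 1)}"
    have "(k, l) \<in> s ` ?G" if kl: "k \<le> l" "norm (cdual_entry h k l) \<ge> e" for k l
    proof -
      obtain p q where pq: "p \<le> q" "(k, l) = s (p, q)"
        "norm (cdual_entry h k l) \<le> K * norm (cdual_entry g p q)"
        using h[OF kl(1)] kl(2) e by force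
      have "e \<le> (K + 1) * norm (cdual_entry g p q)"
        using pq(3) kl(2) norm_ge_zero[of "cdual_entry g p q"] unfolding distrib_right by linarith
      then have "norm (cdual_entry g p q) \<ge> e / (K + 1)"
        using K by (simp add: pos_divide_le_eq mult.commute)
      with pq show ?thesis by blast
    qed
    then show ?thesis using upmat_predualD(2)[OF g e'] by (intro exI[of _ "s ` ?G"]) blast
  qed
  have "dual_lact (*) (single_entry i j x) g \<in> ?Q" if ij: "i \<le> j" for i j x
  proof (rule upmat_predualI)
    let ?h = "dual_lact (*) (single_entry i j x) g"
    have eq: "cdual_entry ?h k l = (if l = i then dual_lact (*) x (cdual_entry g k j) else 0)" if "k \<le> l" for k l
      using that ij by (auto intro!: cdual_eqI simp: single_entry_mult_single_entry)
    show "cdual_entry ?h k l \<in> P" if "k \<le> l" for k l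
      using that ij by (auto simp: eq predual_subspace intro!: predual_act[OF P] upmat_predualD(1)[OF g])
    show "\<exists>F. finite F \<and> (\<forall>k l. k \<le> l \<longrightarrow> norm (cdual_entry ?h k l) \<ge> e \<longrightarrow> (k, l) \<in> F)" if "e > 0" for e
    proof (rule small[OF that norm_ge_zero[of x], of _ "\<lambda>(p, q). (p, i)"])
      fix k l assume kl: "k \<le> l" "cdual_entry ?h k l \<noteq> 0"
      then show "\<exists>p q. p \<le> q \<and> (k, l) = (case (p, q) of (p, q) \<Rightarrow> (p, i)) \<and>
          norm (cdual_entry ?h k l) \<le> norm x * norm (cdual_entry g p q)"
        using ij norm_dual_act_le(1) by (intro exI[of _ k] exI[of _ j]) (auto simp: eq split: if_splits)
    qed
  qed
  from span[OF L this] show "dual_lact (*) M g \<in> ?Q" by simp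
  have "dual_ract (*) g (single_entry i j x) \<in> ?Q" if ij: "i \<le> j" for i j x
  proof (rule upmat_predualI)
    let ?h = "dual_ract (*) g (single_entry i j x)"
    have eq: "cdual_entry ?h k l = (if k = j then dual_ract (*) (cdual_entry g i l) x else 0)" if "k \<le> l" for k l
      using that ij by (auto intro!: cdual_eqI simp: single_entry_mult_single_entry)
    show "cdual_entry ?h k l \<in> P" if "k \<le> l" for k l
      using that ij by (auto simp: eq predual_subspace intro!: predual_act[OF P] upmat_predualD(1)[OF g])
    show "\<exists>F. finite F \<and> (\<forall>k l. k \<le> l \<longrightarrow> norm (cdual_entry ?h k l) \<ge> e \<longrightarrow> (k, l) \<in> F)" if "e > 0" for e
    proof (rule small[OF that norm_ge_zero[of x], of _ "\<lambda>(p, q). (j, q)"])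
      fix k l assume kl: "k \<le> l" "cdual_entry ?h k l \<noteq> 0"
      then show "\<exists>p q. p \<le> q \<and> (k, l) = (case (p, q) of (p, q) \<Rightarrow> (j, q)) \<and>
          norm (cdual_entry ?h k l) \<le> norm x * norm (cdual_entry g p q)"
        using ij norm_dual_act_le(2) by (intro exI[of _ i] exI[of _ l]) (auto simp: eq split: if_splits)
    qed
  qed
  from span[OF R this] show "dual_ract (*) g M \<in> ?Q" by simp
qed

lemma cdual_entry_sum:
  assumes F: "finite F" "F \<subseteq> {(i, j). i \<le> j}"
  shows "cdual_entry (\<Sum>(i, j)\<in>F. cdual_adjoint (\<lambda>M. entry M i j) (f i j)) k l
    = (if (k, l) \<in> F then f k l else 0)"
proof (rule cdual_eqI)
  fix x
  have "cdual_apply (cdual_entry (\<Sum>(i, j)\<in>F. cdual_adjoint (\<lambda>M. entry M i j) (f i j)) k l) x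
      = (\<Sum>(i, j)\<in>F. cdual_apply (f i j) (entry (single_entry k l x) i j))"
    by (simp add: case_prod_unfold bounded_clinear_entry)
  also have "\<dots> = (\<Sum>p\<in>F. if p = (k, l) then cdual_apply (f k l) x else 0)"
    by (rule sum.cong) (use F in \<open>auto split: if_splits\<close>)
  also have "\<dots> = cdual_apply (if (k, l) \<in> F then f k l else 0) x"
    using F by simp
  finally show "cdual_apply (cdual_entry (\<Sum>(i, j)\<in>F. cdual_adjoint (\<lambda>M. entry M i j) (f i j)) k l) x
      = cdual_apply (if (k, l) \<in> F then f k l else 0) x" .
qed

text \<open>A \<open>c\<^sub>0\<close>-family with entries of norm at most one almost attains the \<open>\<ell>\<^sup>1\<close>-norm over a finite set of
  positions, because norms in the unit ball of a \<open>c\<^sub>0\<close>-sum do not add up.\<close>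

lemma upmat_predual_norming:
  fixes A :: "'i::linorder \<Rightarrow> 'i \<Rightarrow> 'a"
  assumes F: "finite F" "F \<subseteq> {(i, j). i \<le> j}" and e: "e > 0"
  obtains f r where "\<And>i j. f i j \<in> P"
    "norm (\<Sum>(i, j)\<in>F. cdual_adjoint (\<lambda>M. entry M i j) (f i j)) \<le> 1"
    "\<And>i j. cdual_apply (f i j) (A i j) = complex_of_real (r i j)"
    "(\<Sum>(i, j)\<in>F. norm (A i j)) \<le> (\<Sum>(i, j)\<in>F. r i j) + e"
proof -
  \<comment> \<open>The error \<open>e\<close> is shared among the positions in \<open>F\<close>, which may be empty.\<close>
  define d where "d = e / (real (card F) + 1)"
  have d: "d > 0" "real (card F) * d \<le> e"
    using e by (simp_all add: d_def field_simps add_pos_nonneg)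
  have "\<exists>f r. f \<in> P \<and> norm f \<le> 1 \<and> cdual_apply f (A i j) = complex_of_real r \<and> norm (A i j) - d < r" for i j
    using predual_norming[OF P d(1)] by metis
  then obtain f r where f: "\<And>i j. f i j \<in> P" "\<And>i j. norm (f i j) \<le> 1"
    "\<And>i j. cdual_apply (f i j) (A i j) = complex_of_real (r i j)" "\<And>i j. norm (A i j) - d < r i j"
    by metis
  show ?thesis
  proof (rule that[of f r])
    let ?g = "\<Sum>(i, j)\<in>F. cdual_adjoint (\<lambda>M::('i, 'a) upmat. entry M i j) (f i j)"
    show "norm ?g \<le> 1"
    proof (rule norm_upmat_cdual_le)
      fix k l :: 'i
      show "norm (cdual_entry ?g k l) \<le> 1"
        unfolding cdual_entry_sum[OF F] using f by simp
    qed simp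
    have "(\<Sum>(i, j)\<in>F. norm (A i j)) \<le> (\<Sum>(i, j)\<in>F. r i j + d)"
      using f(4) by (intro sum_mono) (auto simp: less_imp_le algebra_simps)
    also have "\<dots> = (\<Sum>(i, j)\<in>F. r i j) + real (card F) * d"
      by (simp add: case_prod_unfold sum.distrib)
    finally show "(\<Sum>(i, j)\<in>F. norm (A i j)) \<le> (\<Sum>(i, j)\<in>F. r i j) + e" using d(2) by linarith
  qed (use f in auto)
qed

lemma upmat_predual_sum:
  assumes "finite F" "F \<subseteq> {(i, j). i \<le> j}" "\<And>i j. f i j \<in> P"
  shows "(\<Sum>(i, j)\<in>F. cdual_adjoint (\<lambda>M. entry M i j) (f i j)) \<in> upmat_predual P"
  using assms(1,2)
proof (induction F rule: finite_induct)
  case empty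
  then show ?case using csubspace_upmat_predual by (auto simp: csubspace_def)
next
  case (insert p F)
  obtain i j where p: "p = (i, j)" by (cases p)
  have "cdual_adjoint (\<lambda>M. entry M i j) (f i j) \<in> upmat_predual P"
    using insert.prems p by (intro entry_functional_in_upmat_predual assms) auto
  with insert csubspace_upmat_predual show ?case by (auto simp: csubspace_def p)
qed

text \<open>The dual of a \<open>c\<^sub>0\<close>-sum is the \<open>\<ell>\<^sup>1\<close>-sum of the duals.  Restricted to the copy of \<open>P\<close> at
  \<open>(i, j)\<close>, the functional \<open>m\<close> is a point \<open>a\<^bsub>ij\<^esub>\<close> of \<open>\<A>\<close>; testing \<open>m\<close> on almost norming
  families bounds the finite sums of the \<open>\<parallel>a\<^bsub>ij\<^esub>\<parallel>\<close> by the norm of \<open>m\<close>; and \<open>m\<close> agrees with the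
  resulting matrix on all of the predual since each \<open>g\<close> there is a norm limit of finite sums.\<close>

lemma upmat_predual_representation:
  fixes m :: "('i::linorder, 'a) upmat cdual \<Rightarrow> complex"
  assumes m: "m \<in> subspace_dual (upmat_predual P)"
  obtains M where "\<And>g. g \<in> upmat_predual P \<Longrightarrow> cdual_apply g M = m g"
proof -
  let ?Q = "upmat_predual P :: ('i, 'a) upmat cdual set"
  let ?\<iota> = "\<lambda>i j. cdual_adjoint (\<lambda>M::('i, 'a) upmat. entry M i j)"
  note Q = csubspace_upmat_predual[where 'i = 'i, unfolded csubspace_def]
  obtain K0 where K0: "\<And>g. g \<in> ?Q \<Longrightarrow> cmod (m g) \<le> K0 * norm g"
    using m unfolding subspace_dual_def by blast
  define K where "K = \<bar>K0\<bar>"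
  have K: "K \<ge> 0" "cmod (m g) \<le> K * norm g" if "g \<in> ?Q" for g
    using K0[OF that] mult_right_mono[OF abs_ge_self[of K0] norm_ge_zero[of g]] unfolding K_def by auto
  have K_nonneg: "K \<ge> 0" by (simp add: K_def)
  have m_add: "m (g + h) = m g + m h" if "g \<in> ?Q" "h \<in> ?Q" for g h
    using m that by (auto simp: subspace_dual_def)
  have m_scale: "m (c *\<^sub>C g) = c * m g" if "g \<in> ?Q" for c g
    using m that by (auto simp: subspace_dual_def)
  have m_0: "m 0 = 0" using m_scale[of 0 0] Q by simp
  have \<iota>: "bounded_clinear (?\<iota> i j)" for i j
    by (rule bounded_clinear_adjoint[OF bounded_clinear_entry])
  have \<iota>_bound: "norm (?\<iota> i j f) \<le> norm f" for i j f
  proof (rule norm_cdual_le)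
    fix M :: "('i, 'a) upmat"
    show "cmod (cdual_apply (?\<iota> i j f) M) \<le> norm f * norm M"
      using norm_cdual_apply[of f "entry M i j"] mult_left_mono[OF norm_entry_le[of M i j] norm_ge_zero[of f]]
      by (simp add: bounded_clinear_entry)
  qed simp
  have "\<exists>a. \<forall>f\<in>P. cdual_apply f a = m (?\<iota> i j f)" if ij: "i \<le> j" for i j
  proof -
    note mem = entry_functional_in_upmat_predual[OF _ ij]
    have bound: "cmod (m (?\<iota> i j f)) \<le> K * norm f" if "f \<in> P" for f
      using K(2)[OF mem[OF that]] mult_left_mono[OF \<iota>_bound[of i j f] K_nonneg] by linarith
    show ?thesis
    proof (rule predual_representation[OF P, of "\<lambda>f. m (?\<iota> i j f)", OF _ _ bound])
      show "\<exists>a. \<forall>f\<in>P. cdual_apply f a = m (?\<iota> i j f)"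
        if "\<And>f. f \<in> P \<Longrightarrow> cdual_apply f a = m (?\<iota> i j f)" for a
        using that by blast
    qed (simp_all add: bounded_clinear_simps(1,5)[OF \<iota>] m_add m_scale mem)
  qed
  then obtain a where a: "\<And>i j f. i \<le> j \<Longrightarrow> f \<in> P \<Longrightarrow> cdual_apply f (a i j) = m (?\<iota> i j f)"
    by metis
  define A where "A i j = (if i \<le> j then a i j else 0)" for i j
  have m_sum: "m (\<Sum>(i, j)\<in>F. ?\<iota> i j (f i j)) = (\<Sum>(i, j)\<in>F. cdual_apply (f i j) (A i j))"
    if F: "finite F" "F \<subseteq> {(i, j). i \<le> j}" and f: "\<And>i j. f i j \<in> P" for F f
    using F
  proof (induction F rule: finite_induct)
    case (insert p F)
    obtain i j where p: "p = (i, j)" by (cases p)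
    have ij: "i \<le> j" using insert.prems p by simp
    have "m (\<Sum>(i, j)\<in>insert p F. ?\<iota> i j (f i j))
        = m (?\<iota> i j (f i j)) + m (\<Sum>(i, j)\<in>F. ?\<iota> i j (f i j))"
      using insert ij f p
      by (simp add: m_add entry_functional_in_upmat_predual upmat_predual_sum)
    with insert show ?case by (simp add: p a[OF ij f] A_def ij)
  qed (simp add: m_0)
  have "(\<Sum>(i, j)\<in>F. norm (A i j)) \<le> K" if fin: "finite F" for F
  proof (rule field_le_epsilon)
    fix e :: real assume e: "e > 0"
    let ?F = "F \<inter> {(i, j). i \<le> j}"
    have F: "finite ?F" "?F \<subseteq> {(i, j). i \<le> j}" using fin by auto
    obtain f r where f: "\<And>i j. f i j \<in> P" "norm (\<Sum>(i, j)\<in>?F. ?\<iota> i j (f i j)) \<le> 1"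
      "\<And>i j. cdual_apply (f i j) (A i j) = complex_of_real (r i j)"
      "(\<Sum>(i, j)\<in>?F. norm (A i j)) \<le> (\<Sum>(i, j)\<in>?F. r i j) + e"
      by (rule upmat_predual_norming[OF F e, of "A"]) (rule that)
    let ?g = "\<Sum>(i, j)\<in>?F. ?\<iota> i j (f i j)"
    have "(\<Sum>(i, j)\<in>F. norm (A i j)) = (\<Sum>(i, j)\<in>?F. norm (A i j))"
      by (rule sum.mono_neutral_right) (use fin in \<open>auto simp: A_def split: if_splits\<close>)
    moreover have "m ?g = complex_of_real (\<Sum>(i, j)\<in>?F. r i j)"
      using m_sum[OF F, of f] f(1,3) by (simp add: case_prod_unfold)
    then have "(\<Sum>(i, j)\<in>?F. r i j) \<le> cmod (m ?g)"
      by (simp only: norm_of_real abs_ge_self)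
    moreover have "cmod (m ?g) \<le> K * 1"
      using K(2)[OF upmat_predual_sum[OF F, of f, OF f(1)]] mult_left_mono[OF f(2) K_nonneg] by linarith
    ultimately show "(\<Sum>(i, j)\<in>F. norm (A i j)) \<le> K + e" using f(4) by linarith
  qed
  then have "abs_summable_matrix A" by (rule abs_summable_matrix_bounded)
  then have M: "entry (Abs_upmat A) = A"
    by (intro entry_Abs_upmat) (auto simp: A_def)
  let ?M = "Abs_upmat A"
  show ?thesis
  proof (rule that[of ?M])
    fix g assume g: "g \<in> ?Q"
    have close: "cmod (cdual_apply g ?M - m g) \<le> (K + norm ?M) * e" if e: "e > 0" for e
    proof -
      let ?F = "{(i, j). i \<le> j \<and> norm (cdual_entry g i j) \<ge> e}"
      have F: "finite ?F" "?F \<subseteq> {(i, j). i \<le> j}" using upmat_predualD(2)[OF g e] by auto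
      define h where "h = (\<Sum>(i, j)\<in>?F. ?\<iota> i j (cdual_entry g i j))"
      have f: "cdual_entry g i j \<in> P" for i j
        using upmat_predualD(1)[OF g] predual_subspace(1) by (cases "i \<le> j") (auto simp: cdual_entry_below)
      then have h: "h \<in> ?Q" unfolding h_def by (rule upmat_predual_sum[OF F])
      have m_h: "m h = cdual_apply h ?M"
        unfolding h_def using m_sum[OF F, of "cdual_entry g"] f
        by (simp add: case_prod_unfold bounded_clinear_entry M)
      have gh: "g - h \<in> ?Q"
        using Q g h by (metis add_uminus_conv_diff uminus_scaleC)
      have small: "norm (g - h) \<le> e"
      proof (rule norm_upmat_cdual_le)
        fix k l :: 'i assume kl: "k \<le> l"
        have "cdual_entry h k l = (if (k, l) \<in> ?F then cdual_entry g k l else 0)"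
          unfolding h_def by (rule cdual_entry_sum[OF F])
        then show "norm (cdual_entry (g - h) k l) \<le> e"
          using kl e by (auto simp: bounded_clinear_simps(2)[OF bounded_clinear_cdual_entry])
      qed (use e in simp)
      have "m g = m (g - h) + m h" using m_add[OF gh h] by simp
      then have "cdual_apply g ?M - m g = cdual_apply (g - h) ?M - m (g - h)" by (simp add: m_h)
      also have "cmod \<dots> \<le> cmod (cdual_apply (g - h) ?M) + cmod (m (g - h))" by (rule norm_triangle_ineq4)
      also have "\<dots> \<le> e * norm ?M + K * e"
        using norm_cdual_apply[of "g - h" ?M] mult_right_mono[OF small norm_ge_zero[of ?M]]
          K(2)[OF gh] mult_left_mono[OF small K_nonneg] by linarith
      finally show ?thesis by (simp add: algebra_simps)
    qed
    have "cmod (cdual_apply g ?M - m g) \<le> 0 + e" if "e > 0" for e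
    proof -
      have "e / (K + norm ?M + 1) > 0" using that K_nonneg by (simp add: add_nonneg_pos)
      from close[OF this] have "cmod (cdual_apply g ?M - m g) \<le> e * ((K + norm ?M) / (K + norm ?M + 1))"
        by (simp add: mult.commute)
      also have "\<dots> \<le> e * 1"
        using that K_nonneg by (intro mult_left_mono) (simp_all add: divide_le_eq add_nonneg_pos)
      finally show ?thesis by simp
    qed
    then have "cmod (cdual_apply g ?M - m g) \<le> 0" by (rule field_le_epsilon)
    then show "cdual_apply g ?M = m g" by simp
  qed
qed

text \<open>The isometry comes from the same norming families as the representation of functionals.\<close>

theorem dual_banach_algebra_upmat_predual:
  "dual_banach_algebra (upmat_predual P :: ('i::linorder, 'a) upmat cdual set)"
proof -
  let ?Q = "upmat_predual P :: ('i, 'a) upmat cdual set"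
  let ?ev = "\<lambda>M. \<lambda>g\<in>?Q. cdual_apply g M"
  have eval: "?ev M \<in> subspace_dual ?Q" for M
    unfolding subspace_dual_def
    by (intro CollectI conjI exI[of _ "norm M"])
       (use csubspace_upmat_predual[where 'i = 'i] in
         \<open>auto simp: csubspace_def norm_cdual_apply mult.commute[of "norm M"]\<close>)
  have inj: "M = N" if eq: "?ev M = ?ev N" for M N
  proof (rule upmat_eqI)
    fix i j
    show "entry M i j = entry N i j"
    proof (cases "i \<le> j")
      case True
      show ?thesis
      proof (rule predual_separates[OF P])
        fix f assume "f \<in> P"
        then have "cdual_adjoint (\<lambda>M. entry M i j) f \<in> ?Q"
          using True by (rule entry_functional_in_upmat_predual)
        with eq have "cdual_apply (cdual_adjoint (\<lambda>M. entry M i j) f) M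
            = cdual_apply (cdual_adjoint (\<lambda>M. entry M i j) f) N"
          by (metis restrict_apply')
        then show "cdual_apply f (entry M i j) = cdual_apply f (entry N i j)"
          by (simp add: bounded_clinear_entry)
      qed
    qed simp
  qed
  have "m \<in> range ?ev" if m: "m \<in> subspace_dual ?Q" for m
  proof -
    obtain M where "\<And>g. g \<in> ?Q \<Longrightarrow> cdual_apply g M = m g"
      using upmat_predual_representation[OF m] by blast
    then have "m = ?ev M"
      using m by (auto simp: subspace_dual_def extensional_def)
    then show ?thesis by blast
  qed
  with eval inj have bij: "bij_betw ?ev UNIV (subspace_dual ?Q)"
    by (auto simp: bij_betw_def inj_def)
  have norm: "subspace_dual_norm ?Q (?ev M) = norm M" for M
  proof (rule antisym)
    let ?B = "{g \<in> ?Q. norm g \<le> 1}"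
    have le: "cmod (?ev M g) \<le> norm M" if "g \<in> ?B" for g
    proof -
      have "cmod (cdual_apply g M) \<le> norm g * norm M" by (rule norm_cdual_apply)
      also have "\<dots> \<le> norm M" using that by (intro mult_left_le_one_le) auto
      finally show ?thesis using that by simp
    qed
    have "0 \<in> ?B" using csubspace_upmat_predual[where 'i = 'i] by (simp add: csubspace_def)
    then show "subspace_dual_norm ?Q (?ev M) \<le> norm M"
      unfolding subspace_dual_norm_def by (intro cSUP_least le) auto
    have bdd: "bdd_above ((\<lambda>g. cmod (?ev M g)) ` ?B)"
      by (rule bdd_aboveI2[of _ _ "norm M"]) (rule le)
    have "(\<Sum>(i, j)\<in>F. norm (entry M i j)) \<le> subspace_dual_norm ?Q (?ev M)" if fin: "finite F" for F
    proof (rule field_le_epsilon)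
      fix e :: real assume e: "e > 0"
      let ?F = "F \<inter> {(i, j). i \<le> j}"
      have F: "finite ?F" "?F \<subseteq> {(i, j). i \<le> j}" using fin by auto
      obtain f r where f: "\<And>i j. f i j \<in> P"
        "norm (\<Sum>(i, j)\<in>?F. cdual_adjoint (\<lambda>M::('i, 'a) upmat. entry M i j) (f i j)) \<le> 1"
        "\<And>i j. cdual_apply (f i j) (entry M i j) = complex_of_real (r i j)"
        "(\<Sum>(i, j)\<in>?F. norm (entry M i j)) \<le> (\<Sum>(i, j)\<in>?F. r i j) + e"
        by (rule upmat_predual_norming[OF F e, of "entry M"]) (rule that)
      let ?g = "\<Sum>(i, j)\<in>?F. cdual_adjoint (\<lambda>M::('i, 'a) upmat. entry M i j) (f i j)"
      have g: "?g \<in> ?B" using upmat_predual_sum[OF F, of f, OF f(1)] f(2) by simp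
      have "(\<Sum>(i, j)\<in>F. norm (entry M i j)) = (\<Sum>(i, j)\<in>?F. norm (entry M i j))"
        by (rule sum.mono_neutral_right) (use fin in \<open>auto simp flip: not_less\<close>)
      moreover have "?ev M ?g = complex_of_real (\<Sum>(i, j)\<in>?F. r i j)"
      proof -
        have "?ev M ?g = cdual_apply ?g M" by (rule restrict_apply') (use g in blast)
        also have "\<dots> = complex_of_real (\<Sum>(i, j)\<in>?F. r i j)"
          using f(3) by (simp add: case_prod_unfold bounded_clinear_entry)
        finally show ?thesis .
      qed
      then have "(\<Sum>(i, j)\<in>?F. r i j) \<le> cmod (?ev M ?g)"
        by (simp only: norm_of_real abs_ge_self)
      moreover have "cmod (?ev M ?g) \<le> subspace_dual_norm ?Q (?ev M)"
        unfolding subspace_dual_norm_def by (rule cSUP_upper[OF g bdd])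
      ultimately show "(\<Sum>(i, j)\<in>F. norm (entry M i j)) \<le> subspace_dual_norm ?Q (?ev M) + e"
        using f(4) by linarith
    qed
    then show "norm M \<le> subspace_dual_norm ?Q (?ev M)"
      unfolding norm_upmat_eq by (rule abs_summable_matrix_bounded(2))
  qed
  show ?thesis
    unfolding dual_banach_algebra_def
    by (intro conjI allI ballI csubspace_upmat_predual closed_upmat_predual upmat_predual_act bij norm)
qed

end

section \<open>Amenability of the upper triangular matrices\<close>

text \<open>For upper triangular matrices, taking a diagonal entry is multiplicative.\<close>

lemma strong_pseudo_Connes_amenable_diagonal_block:
  fixes P :: "'a::complex_banach_algebra cdual set" and i :: "'i::linorder"
  assumes P: "dual_banach_algebra P"
    and A: "strong_pseudo_Connes_amenable (upmat_predual P :: ('i, 'a) upmat cdual set)"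
  shows "strong_pseudo_Connes_amenable P"
proof (rule strong_pseudo_Connes_amenable_image[OF dual_banach_algebra_upmat_predual[OF P] P _ _ _ _ A])
  show "bounded_clinear (\<lambda>M::('i, 'a) upmat. entry M i i)" by (rule bounded_clinear_entry)
  show "entry (M * N) i i = entry M i i * entry N i i" for M N :: "('i, 'a) upmat"
    by (rule entry_mult_diagonal)
  have "x = entry (single_entry i i x) i i" for x :: 'a by simp
  then show "surj (\<lambda>M::('i, 'a) upmat. entry M i i)" by (rule surjI[OF sym])
  show "cdual_adjoint (\<lambda>M. entry M i i) f \<in> upmat_predual P" if "f \<in> P" for f
    using P that by (rule entry_functional_in_upmat_predual) simp
qed

lemma strong_pseudo_Connes_amenable_upmat_singleton:
  fixes P :: "'a::complex_banach_algebra cdual set" and b :: "'i::linorder"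
  assumes P: "dual_banach_algebra P" and single: "\<And>i::'i. i = b"
    and A: "strong_pseudo_Connes_amenable P"
  shows "strong_pseudo_Connes_amenable (upmat_predual P :: ('i, 'a) upmat cdual set)"
proof (rule strong_pseudo_Connes_amenable_image[OF P dual_banach_algebra_upmat_predual[OF P] _ _ _ _ A])
  show "bounded_clinear (single_entry b b :: 'a \<Rightarrow> _)" by (rule bounded_clinear_single_entry)
  show "single_entry b b (x * y) = single_entry b b x * single_entry b b y" for x y :: 'a
    by (simp add: single_entry_mult_single_entry)
  have "single_entry b b (entry M b b) = M" for M :: "('i, 'a) upmat"
  proof (rule upmat_eqI)
    show "entry (single_entry b b (entry M b b)) i j = entry M i j" for i j
      using single[of i] single[of j] by simp
  qed
  then show "surj (single_entry b b :: 'a \<Rightarrow> _)" by (rule surjI)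
  show "cdual_adjoint (single_entry b b) g \<in> P" if "g \<in> upmat_predual P" for g
    using upmat_predualD(1)[OF that, of b b] by (simp add: cdual_entry_def)
qed

text \<open>The obstruction applies with \<open>\<omega>(M) = \<phi>(M\<^bsub>jj\<^esub>)\<close>, \<open>\<psi>(M) = \<phi>(M\<^bsub>ij\<^esub>)\<close> and \<open>e = u E\<^bsub>ij\<^esub>\<close>:
  left multiplication by \<open>e\<close> moves row \<open>j\<close> to row \<open>i\<close>, and \<open>e\<close> has no entry at \<open>(j, j)\<close> as
  \<open>i \<noteq> j\<close>.\<close>

lemma not_strong_pseudo_Connes_amenable_upmat:
  fixes P :: "'a::complex_banach_algebra cdual set" and i j :: "'i::linorder"
  assumes P: "dual_banach_algebra P" and \<phi>: "\<phi> \<in> wk_star_characters P" and ij: "i < j"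
  shows "\<not> strong_pseudo_Connes_amenable (upmat_predual P :: ('i, 'a) upmat cdual set)"
proof -
  have "\<exists>f\<in>P. \<forall>x. cdual_apply f x = \<phi> x"
    by (rule wk_star_continuous_linear_in_predual[OF predual_csubspace[OF P]])
       (use \<phi> in \<open>auto simp: wk_star_characters_def\<close>)
  then obtain f where f: "f \<in> P" "\<And>x. cdual_apply f x = \<phi> x" by blast
  have mult: "cdual_apply f (x * y) = cdual_apply f x * cdual_apply f y" for x y
    using \<phi> f(2) by (simp add: wk_star_characters_def)
  obtain v where v: "cdual_apply f v \<noteq> 0"
    using \<phi> f(2) by (auto simp: wk_star_characters_def)
  define u where "u = (1 / cdual_apply f v) *\<^sub>C v"
  have u: "cdual_apply f u = 1" using v by (simp add: u_def)
  let ?\<iota> = "\<lambda>k l. cdual_adjoint (\<lambda>M::('i, 'a) upmat. entry M k l) f"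
  show ?thesis
  proof (rule not_strong_pseudo_Connes_amenable[OF dual_banach_algebra_upmat_predual[OF P],
        where \<omega> = "?\<iota> j j" and \<psi> = "?\<iota> i j" and e = "single_entry i j u" and u = "single_entry j j u"])
    show "?\<iota> j j \<in> upmat_predual P" "?\<iota> i j \<in> upmat_predual P"
      using ij by (auto intro!: entry_functional_in_upmat_predual[OF P] f)
  qed (use ij in \<open>simp_all add: bounded_clinear_entry entry_mult_diagonal entry_single_entry_mult mult u\<close>)
qed

theorem theorem3p2:
  fixes P :: "'a::complex_banach_algebra cdual set"
  assumes "dual_banach_algebra P"
    and "\<exists>\<phi>. \<phi> \<in> wk_star_characters P"
    and "\<exists>b :: 'i::linorder. \<forall>i. b \<le> i"
  shows "strong_pseudo_Connes_amenable (upmat_predual P :: ('i, 'a) upmat cdual set) \<longleftrightarrow>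
    strong_pseudo_Connes_amenable P \<and> CARD('i) = 1"
proof
  assume A: "strong_pseudo_Connes_amenable (upmat_predual P :: ('i, 'a) upmat cdual set)"
  have "i = j" for i j :: 'i
    using not_strong_pseudo_Connes_amenable_upmat[OF assms(1)] assms(2) A
    by (metis linorder_less_linear)
  then have "(UNIV :: 'i set) = {undefined}" by auto
  then have "CARD('i) = 1" by (metis card_1_singleton_iff One_nat_def)
  with strong_pseudo_Connes_amenable_diagonal_block[OF assms(1) A]
  show "strong_pseudo_Connes_amenable P \<and> CARD('i) = 1" by blast
next
  assume A: "strong_pseudo_Connes_amenable P \<and> CARD('i) = 1"
  then obtain b :: 'i where "UNIV = {b}" using card_1_singletonE by blast
  then have "i = b" for i :: 'i by auto
  with A show "strong_pseudo_Connes_amenable (upmat_predual P :: ('i, 'a) upmat cdual set)"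
    using strong_pseudo_Connes_amenable_upmat_singleton[OF assms(1)] by blast
qed

end
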